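(* Let $(M,g)$ be a compact Riemannian manifold of dimension $n\ge 3$ with $g$ a harmonic critical metric, and let $\theta$ be a smooth 1-form satisfying $E_g=B_g^*\theta-\frac{n-2}{2n}\bar s_g\,g$. If $\bar s_g<0$ or, equivalently, $\int_M s_g\,dv_g<0$, then $g$ is Einstein with negative Einstein constant and $\theta=0$. More precisely, $$\mathrm{Ric}_g=\frac{\bar s_g}{n}\,g .$$
   Context: Notation: $\mathrm{Ric}_g$ is the Ricci tensor, $s_g$ the scalar curvature, $E_g=\mathrm{Ric}_g-\frac12 s_g g$ the Einstein tensor, $\bar s_g=\frac{1}{\mathrm{Vol}(M,g)}\int_M s_g\,dv_g$ the average scalar curvature. For a 1-form $\theta$: $\delta\theta=-\nabla^i\theta_i$, $(\delta^*\theta)_{ij}=\frac12(\nabla_i\theta_j+\nabla_j\theta_i)$, and $B_g^*\theta=\delta^*\theta+\frac12(\delta\theta)g$. A Riemannian metric $g$ on a compact $n$-manifold is called harmonic critical if there exists a smooth 1-form $\theta$ (called a gauge one-form) such that $E_g=B_g^*\theta-\frac{n-2}{2n}\bar s_g\,g$. *)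

theory Defs
  imports "HOL-Analysis.Analysis"
begin

section \<open>Smooth functions on open subsets of Euclidean space\<close>

definition pd :: "'n::finite \<Rightarrow> (real^'n \<Rightarrow> 'b::real_normed_vector) \<Rightarrow> real^'n \<Rightarrow> 'b" where
  "pd i f x = frechet_derivative f (at x) (axis i 1)"

text \<open>\<open>Ck_on k S f\<close> is used only for open \<open>S\<close>, where \<^const>\<open>differentiable_on\<close>
  is differentiability at every point of \<open>S\<close>.\<close>

primrec Ck_on :: "nat \<Rightarrow> (real^'n) set \<Rightarrow> (real^'n \<Rightarrow> 'b::real_normed_vector) \<Rightarrow> bool" where
  "Ck_on 0 S f \<longleftrightarrow> continuous_on S f"
| "Ck_on (Suc k) S f \<longleftrightarrow> f differentiable_on S \<and> (\<forall>i. Ck_on k S (pd i f))"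

definition smooth_on :: "(real^'n) set \<Rightarrow> (real^'n \<Rightarrow> 'b::real_normed_vector) \<Rightarrow> bool" where
  "smooth_on S f \<longleftrightarrow> (\<forall>k. Ck_on k S f)"

section \<open>Smooth manifolds\<close>

text \<open>A chart is a pair of its domain and its coordinate map. The dimension of the manifold is
  \<open>CARD('n)\<close>. Charts map onto open subsets of the whole space, so there is no boundary.\<close>

type_synonym ('a, 'n) chart = "'a set \<times> ('a \<Rightarrow> real^'n)"

definition is_chart :: "'a topology \<Rightarrow> ('a, 'n::finite) chart \<Rightarrow> bool" where
  "is_chart X c \<longleftrightarrow> openin X (fst c) \<and> open (snd c ` fst c) \<and>
     homeomorphic_map (subtopology X (fst c)) (top_of_set (snd c ` fst c)) (snd c)"

definition transition :: "('a, 'n::finite) chart \<Rightarrow> ('a, 'n) chart \<Rightarrow> real^'n \<Rightarrow> real^'n" where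
  "transition c d = snd d \<circ> inv_into (fst c) (snd c)"

text \<open>The smooth structure is given by an atlas, which need not be maximal.\<close>

definition smooth_manifold :: "'a topology \<Rightarrow> ('a, 'n::finite) chart set \<Rightarrow> bool" where
  "smooth_manifold X A \<longleftrightarrow>
     Hausdorff_space X \<and> second_countable X \<and>
     (\<forall>c\<in>A. is_chart X c) \<and> (\<Union>c\<in>A. fst c) = topspace X \<and>
     (\<forall>c\<in>A. \<forall>d\<in>A. smooth_on (snd c ` (fst c \<inter> fst d)) (transition c d))"

section \<open>Riemannian metrics and 1-forms\<close>

text \<open>Tensor fields are given by their components in the charts of the atlas, subject to the
  tensor transformation law: for a 1-form, \<open>\<theta> c x $ i\<close> is the coefficient of \<open>dx\<^sup>i\<close> at the point
  whose coordinates in the chart \<open>c\<close> are \<open>x\<close>; for a symmetric 2-tensor, \<open>g c x $ i $ j\<close> is its value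
  on the \<open>i\<close>-th and \<open>j\<close>-th coordinate vectors there. Only the values for \<open>c \<in> A\<close> and
  \<open>x \<in> snd c ` fst c\<close> are meaningful.\<close>

type_synonym ('a, 'n) one_form = "('a, 'n) chart \<Rightarrow> real^'n \<Rightarrow> real^'n"
type_synonym ('a, 'n) two_tensor = "('a, 'n) chart \<Rightarrow> real^'n \<Rightarrow> real^'n^'n"

definition smooth_one_form :: "('a, 'n::finite) chart set \<Rightarrow> ('a, 'n) one_form \<Rightarrow> bool" where
  "smooth_one_form A \<theta> \<longleftrightarrow>
     (\<forall>c\<in>A. smooth_on (snd c ` fst c) (\<theta> c)) \<and>
     (\<forall>c\<in>A. \<forall>d\<in>A. \<forall>p\<in>fst c \<inter> fst d. \<forall>i.
        \<theta> c (snd c p) $ i =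
          (\<Sum>k\<in>UNIV. pd i (transition c d) (snd c p) $ k * \<theta> d (snd d p) $ k))"

definition smooth_two_tensor :: "('a, 'n::finite) chart set \<Rightarrow> ('a, 'n) two_tensor \<Rightarrow> bool" where
  "smooth_two_tensor A g \<longleftrightarrow>
     (\<forall>c\<in>A. smooth_on (snd c ` fst c) (g c)) \<and>
     (\<forall>c\<in>A. \<forall>d\<in>A. \<forall>p\<in>fst c \<inter> fst d. \<forall>i j.
        g c (snd c p) $ i $ j =
          (\<Sum>k\<in>UNIV. \<Sum>l\<in>UNIV. pd i (transition c d) (snd c p) $ k *
             pd j (transition c d) (snd c p) $ l * g d (snd d p) $ k $ l))"

definition riemannian_metric :: "('a, 'n::finite) chart set \<Rightarrow> ('a, 'n) two_tensor \<Rightarrow> bool" where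
  "riemannian_metric A g \<longleftrightarrow> smooth_two_tensor A g \<and>
     (\<forall>c\<in>A. \<forall>x\<in>snd c ` fst c.
        transpose (g c x) = g c x \<and> (\<forall>v. v \<noteq> 0 \<longrightarrow> v \<bullet> (g c x *v v) > 0))"

section \<open>Curvature in local coordinates\<close>

text \<open>In this section \<open>G\<close> and \<open>w\<close> are the components of a metric and of a 1-form in a fixed chart.\<close>

definition christoffel :: "(real^'n \<Rightarrow> real^'n^'n) \<Rightarrow> 'n \<Rightarrow> 'n \<Rightarrow> 'n \<Rightarrow> real^'n \<Rightarrow> real" where
  "christoffel G k i j x = (1/2) * (\<Sum>l\<in>UNIV. matrix_inv (G x) $ k $ l *
     (pd i (\<lambda>y. G y $ j $ l) x + pd j (\<lambda>y. G y $ i $ l) x - pd l (\<lambda>y. G y $ i $ j) x))"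

text \<open>\<open>riemann G l k i j\<close> is the coefficient of \<open>\<partial>\<^sub>l\<close> in \<open>R(\<partial>\<^sub>i, \<partial>\<^sub>j) \<partial>\<^sub>k\<close>, where
  \<open>R(X, Y) = [\<nabla>\<^sub>X, \<nabla>\<^sub>Y] - \<nabla>\<^bsub>[X, Y]\<^esub>\<close>; with this sign round spheres have positive Ricci curvature.\<close>

definition riemann :: "(real^'n \<Rightarrow> real^'n^'n) \<Rightarrow> 'n \<Rightarrow> 'n \<Rightarrow> 'n \<Rightarrow> 'n \<Rightarrow> real^'n \<Rightarrow> real" where
  "riemann G l k i j x =
     pd i (christoffel G l j k) x - pd j (christoffel G l i k) x +
     (\<Sum>m\<in>UNIV. christoffel G l i m x * christoffel G m j k x -
                 christoffel G l j m x * christoffel G m i k x)"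

definition ricci :: "(real^'n \<Rightarrow> real^'n^'n) \<Rightarrow> real^'n \<Rightarrow> real^'n^'n" where
  "ricci G x = (\<chi> j k. \<Sum>i\<in>UNIV. riemann G i k i j x)"

definition scal :: "(real^'n \<Rightarrow> real^'n^'n) \<Rightarrow> real^'n \<Rightarrow> real" where
  "scal G x = (\<Sum>i\<in>UNIV. \<Sum>j\<in>UNIV. matrix_inv (G x) $ i $ j * ricci G x $ i $ j)"

definition einstein_tensor :: "(real^'n \<Rightarrow> real^'n^'n) \<Rightarrow> real^'n \<Rightarrow> real^'n^'n" where
  "einstein_tensor G x = ricci G x - ((1/2) * scal G x) *\<^sub>R G x"

definition cov_deriv ::
    "(real^'n \<Rightarrow> real^'n^'n) \<Rightarrow> (real^'n \<Rightarrow> real^'n) \<Rightarrow> 'n \<Rightarrow> 'n \<Rightarrow> real^'n \<Rightarrow> real" where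
  "cov_deriv G w i j x = pd i (\<lambda>y. w y $ j) x - (\<Sum>k\<in>UNIV. christoffel G k i j x * w x $ k)"

definition codiff :: "(real^'n \<Rightarrow> real^'n^'n) \<Rightarrow> (real^'n \<Rightarrow> real^'n) \<Rightarrow> real^'n \<Rightarrow> real" where
  "codiff G w x = - (\<Sum>i\<in>UNIV. \<Sum>j\<in>UNIV. matrix_inv (G x) $ i $ j * cov_deriv G w i j x)"

definition sym_deriv ::
    "(real^'n \<Rightarrow> real^'n^'n) \<Rightarrow> (real^'n \<Rightarrow> real^'n) \<Rightarrow> real^'n \<Rightarrow> real^'n^'n" where
  "sym_deriv G w x = (\<chi> i j. (1/2) * (cov_deriv G w i j x + cov_deriv G w j i x))"

definition bianchi_adjoint ::
    "(real^'n \<Rightarrow> real^'n^'n) \<Rightarrow> (real^'n \<Rightarrow> real^'n) \<Rightarrow> real^'n \<Rightarrow> real^'n^'n" where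
  "bianchi_adjoint G w x = sym_deriv G w x + ((1/2) * codiff G w x) *\<^sub>R G x"

section \<open>Riemannian volume and average scalar curvature\<close>

text \<open>The scalar curvature does not depend on the chart used to compute it.\<close>

definition scalar_curvature ::
    "('a, 'n::finite) chart set \<Rightarrow> ('a, 'n) two_tensor \<Rightarrow> 'a \<Rightarrow> real" where
  "scalar_curvature A g p = (let c = SOME c. c \<in> A \<and> p \<in> fst c in scal (g c) (snd c p))"

text \<open>The Riemannian volume is the unique measure on the Borel sets of \<open>X\<close> that is
  \<open>sqrt (det (g\<^sub>i\<^sub>j)) dx\<^sup>1 \<dots> dx\<^sup>n\<close> in every chart.\<close>

definition is_riemannian_volume ::
    "'a topology \<Rightarrow> ('a, 'n::finite) chart set \<Rightarrow> ('a, 'n) two_tensor \<Rightarrow> 'a measure \<Rightarrow> bool" where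
  "is_riemannian_volume X A g \<mu> \<longleftrightarrow>
     space \<mu> = topspace X \<and> sets \<mu> = sigma_sets (topspace X) {U. openin X U} \<and>
     (\<forall>c\<in>A. \<forall>B\<in>sets \<mu>. B \<subseteq> fst c \<longrightarrow>
        emeasure \<mu> B = (\<integral>\<^sup>+x\<in>snd c ` B. ennreal (sqrt (det (g c x))) \<partial>lborel))"

definition riemannian_volume ::
    "'a topology \<Rightarrow> ('a, 'n::finite) chart set \<Rightarrow> ('a, 'n) two_tensor \<Rightarrow> 'a measure" where
  "riemannian_volume X A g = (THE \<mu>. is_riemannian_volume X A g \<mu>)"

definition total_scalar_curvature ::
    "'a topology \<Rightarrow> ('a, 'n::finite) chart set \<Rightarrow> ('a, 'n) two_tensor \<Rightarrow> real" where
  "total_scalar_curvature X A g = (\<integral>p. scalar_curvature A g p \<partial>riemannian_volume X A g)"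

definition average_scalar_curvature ::
    "'a topology \<Rightarrow> ('a, 'n::finite) chart set \<Rightarrow> ('a, 'n) two_tensor \<Rightarrow> real" where
  "average_scalar_curvature X A g =
     total_scalar_curvature X A g / measure (riemannian_volume X A g) (topspace X)"

section \<open>Einstein and harmonic critical metrics\<close>

definition einstein_with_constant ::
    "('a, 'n::finite) chart set \<Rightarrow> ('a, 'n) two_tensor \<Rightarrow> real \<Rightarrow> bool" where
  "einstein_with_constant A g l \<longleftrightarrow>
     (\<forall>c\<in>A. \<forall>x\<in>snd c ` fst c. ricci (g c) x = l *\<^sub>R g c x)"

definition gauge_one_form ::
    "'a topology \<Rightarrow> ('a, 'n::finite) chart set \<Rightarrow> ('a, 'n) two_tensor \<Rightarrow> ('a, 'n) one_form \<Rightarrow> bool"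
  where
  "gauge_one_form X A g \<theta> \<longleftrightarrow> smooth_one_form A \<theta> \<and>
     (\<forall>c\<in>A. \<forall>x\<in>snd c ` fst c.
        einstein_tensor (g c) x = bianchi_adjoint (g c) (\<theta> c) x -
          ((real CARD('n) - 2) / (2 * real CARD('n)) * average_scalar_curvature X A g) *\<^sub>R g c x)"

definition harmonic_critical ::
    "'a topology \<Rightarrow> ('a, 'n::finite) chart set \<Rightarrow> ('a, 'n) two_tensor \<Rightarrow> bool" where
  "harmonic_critical X A g \<longleftrightarrow> (\<exists>\<theta>. gauge_one_form X A g \<theta>)"

end

theory Submission
  imports Defs
begin

text \<open>
  Let \<open>\<lambda> = s\<^sub>a\<^sub>v / n\<close>, where \<open>s\<^sub>a\<^sub>v\<close> is the average of the scalar curvature \<open>s\<close>. Since \<open>n \<noteq> 2\<close>, the trace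
  of the equation for the gauge form gives \<open>s = s\<^sub>a\<^sub>v - \<delta>\<theta>\<close>, and putting this back turns the equation
  into the soliton equation \<open>Ric = \<delta>\<^sup>*\<theta> + \<lambda> g\<close> (\<open>gauge_trace\<close>). For \<open>\<lambda> < 0\<close> this is a compact expanding
  soliton, and two applications of the maximum principle show that it is trivial.

  Solutions of the soliton equation satisfy \<open>\<Delta>s + \<langle>ds, \<theta>\<rangle> + 2 \<langle>Ric, Ric - \<lambda>g\<rangle> = 0\<close>
  (\<open>soliton_laplacian\<close>), and \<open>\<langle>Ric, Ric - \<lambda>g\<rangle> = \<bar>Ric - \<lambda>g\<bar>\<^sup>2 + \<lambda> (s - s\<^sub>a\<^sub>v)\<close>. Where \<open>s\<close> is minimal, the first
  term is nonnegative and the second one vanishes, hence \<open>\<lambda> (s - s\<^sub>a\<^sub>v) \<le> 0\<close>, which means \<open>s \<ge> s\<^sub>a\<^sub>v\<close>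
  there and so everywhere (\<open>scalar_at_minimum\<close>). A continuous function that is nowhere below its
  average is constant (\<open>scalar_constant\<close>). With \<open>s = s\<^sub>a\<^sub>v\<close> the identity reads \<open>\<bar>Ric - \<lambda>g\<bar>\<^sup>2 = 0\<close>, so
  \<open>g\<close> is Einstein and \<open>\<delta>\<^sup>*\<theta> = 0\<close>. For such a Killing form Bochner's formula
  \<open>\<Delta>\<bar>\<theta>\<bar>\<^sup>2 = 2 \<bar>\<nabla>\<theta>\<bar>\<^sup>2 - 2 \<lambda> \<bar>\<theta>\<bar>\<^sup>2\<close> (\<open>killing_laplacian\<close>) shows that the maximum of \<open>\<bar>\<theta>\<bar>\<^sup>2\<close> is zero
  (\<open>sqnorm_at_maximum\<close>).

  The two differential identities are purely algebraic: they hold in every commutative real algebra with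
  commuting derivations and a symmetric invertible matrix \<open>G\<close> with a compatible torsion-free
  connection. Germs of smooth functions at a point form such an algebra, and working with germs turns
  identities between functions on a neighbourhood into equations that hold without side conditions.

  Two facts connect this local calculus with the manifold. The functions \<open>\<delta>\<theta>\<close> (and with it \<open>s\<close>) and
  \<open>\<bar>\<theta>\<bar>\<^sup>2\<close> do not depend on the chart (\<open>theta_transform\<close>), so that they are continuous functions on a
  compact space and attain their extrema, with a whole chart around each extremal point available
  for the second derivative test. And the Riemannian volume exists, is unique, finite, and positive
  on nonempty open sets (\<open>riemannian_volume_eq\<close>, \<open>finite_vol_measure\<close>, \<open>vol_measure_open_pos\<close>), which
  is what the argument with the average uses.
\<close>

section \<open>Smooth functions on open subsets of Euclidean space\<close>

lemma frechet_derivative_cong: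
  assumes "open S" "x \<in> S" "\<And>y. y \<in> S \<Longrightarrow> f y = g y"
  shows "frechet_derivative f (at x) = frechet_derivative g (at x)"
proof -
  have "(f has_derivative f') (at x) \<longleftrightarrow> (g has_derivative f') (at x)" for f'
    using has_derivative_transform_within_open[OF _ assms(1,2), of f f' UNIV g]
      has_derivative_transform_within_open[OF _ assms(1,2), of g f' UNIV f] assms(3) by auto
  then show ?thesis unfolding frechet_derivative_def by simp
qed

lemma pd_cong:
  assumes "open S" "x \<in> S" "\<And>y. y \<in> S \<Longrightarrow> f y = g y"
  shows "pd i f x = pd i g x"
  unfolding pd_def using frechet_derivative_cong[OF assms] by simp

lemma has_derivative_pd:
  assumes "(f has_derivative f') (at x)" shows "pd i f x = f' (axis i 1)"
  unfolding pd_def using frechet_derivative_at[OF assms] by simp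

lemma differentiable_on_has_derivative:
  assumes "f differentiable_on S" "open S" "x \<in> S"
  shows "(f has_derivative frechet_derivative f (at x)) (at x)"
  using assms by (metis at_within_open differentiable_on_def frechet_derivative_works)

lemma derivative_pd_sum:
  assumes "(f has_derivative f') (at x)"
  shows "f' v = (\<Sum>i\<in>UNIV. v $ i *\<^sub>R pd i f x)"
proof -
  interpret f': bounded_linear f' using assms by (rule has_derivative_bounded_linear)
  have "f' v = f' (\<Sum>i\<in>UNIV. v $ i *\<^sub>R axis i 1)"
    using basis_expansion[of v] by (simp add: scalar_mult_eq_scaleR)
  then show ?thesis by (simp add: f'.sum f'.scaleR has_derivative_pd[OF assms])
qed

lemma Ck_on_cong:
  assumes "open S" "\<And>y. y \<in> S \<Longrightarrow> f y = g y" "Ck_on k S f"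
  shows "Ck_on k S g"
  using assms(2,3)
proof (induction k arbitrary: f g)
  case 0
  then have "continuous_on S f" by simp
  then have "continuous_on S g" using continuous_on_cong[OF refl, of S f g] 0(1) by blast
  then show ?case by simp
next
  case (Suc k)
  have "g differentiable_on S"
    unfolding differentiable_on_eq_differentiable_at[OF assms(1)]
  proof
    fix x assume x: "x \<in> S"
    have "(f has_derivative frechet_derivative f (at x)) (at x)"
      using Suc.prems(2) by (intro differentiable_on_has_derivative[OF _ assms(1) x]) simp
    then have "(g has_derivative frechet_derivative f (at x)) (at x)"
      by (rule has_derivative_transform_within_open[OF _ assms(1) x]) (use Suc.prems(1) in auto)
    then show "g differentiable at x" unfolding differentiable_def by blast
  qed
  moreover have "Ck_on k S (pd i g)" for i
    using Suc.IH[of "pd i f" "pd i g"] pd_cong[OF assms(1), of _ f g i] Suc.prems by auto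
  ultimately show ?case by simp
qed

lemma Ck_on_Suc_D: "open S \<Longrightarrow> Ck_on (Suc k) S f \<Longrightarrow> Ck_on k S f"
proof (induction k arbitrary: f)
  case 0 then show ?case by (auto intro: differentiable_imp_continuous_on)
next
  case (Suc k) then show ?case by (metis Ck_on.simps(2))
qed

lemma smooth_on_subset: "open S \<Longrightarrow> open T \<Longrightarrow> T \<subseteq> S \<Longrightarrow> smooth_on S f \<Longrightarrow> smooth_on T f"
proof -
  assume S: "T \<subseteq> S"
  have "Ck_on k S f \<Longrightarrow> Ck_on k T f" for k f
    by (induction k arbitrary: f) (use S in \<open>auto intro: continuous_on_subset differentiable_on_subset\<close>)
  then show "smooth_on S f \<Longrightarrow> smooth_on T f" by (auto simp: smooth_on_def)
qed

lemma smooth_on_cong: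
  "open S \<Longrightarrow> (\<And>y. y \<in> S \<Longrightarrow> f y = g y) \<Longrightarrow> smooth_on S f \<Longrightarrow> smooth_on S g"
  unfolding smooth_on_def using Ck_on_cong by blast

lemma smooth_on_pd: "smooth_on S f \<Longrightarrow> smooth_on S (pd i f)"
  unfolding smooth_on_def by (metis Ck_on.simps(2))
lemma smooth_on_differentiable: "smooth_on S f \<Longrightarrow> f differentiable_on S"
  unfolding smooth_on_def by (metis Ck_on.simps(2))
lemma smooth_on_continuous: "smooth_on S f \<Longrightarrow> continuous_on S f"
  unfolding smooth_on_def by (metis Ck_on.simps(1))

lemma smooth_on_has_derivative:
  "smooth_on S f \<Longrightarrow> open S \<Longrightarrow> x \<in> S \<Longrightarrow> (f has_derivative frechet_derivative f (at x)) (at x)"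
  by (intro differentiable_on_has_derivative smooth_on_differentiable)

lemma pd_add:
  assumes "f differentiable_on S" "g differentiable_on S" "open S" "x \<in> S"
  shows "pd i (\<lambda>x. f x + g x) x = pd i f x + pd i g x"
  by (rule trans[OF has_derivative_pd[OF has_derivative_add[OF
    differentiable_on_has_derivative[OF assms(1,3,4)] differentiable_on_has_derivative[OF assms(2,3,4)]]]])
    (simp add: pd_def)

lemma pd_mult:
  fixes f g :: "real^'n \<Rightarrow> real"
  assumes "f differentiable_on S" "g differentiable_on S" "open S" "x \<in> S"
  shows "pd i (\<lambda>x. f x * g x) x = pd i f x * g x + f x * pd i g x"
  by (rule trans[OF has_derivative_pd[OF has_derivative_mult[OF
    differentiable_on_has_derivative[OF assms(1,3,4)] differentiable_on_has_derivative[OF assms(2,3,4)]]]])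
    (simp add: pd_def add.commute)

lemma pd_linear:
  assumes "bounded_linear L" "f differentiable_on S" "open S" "x \<in> S"
  shows "pd i (\<lambda>x. L (f x)) x = L (pd i f x)"
  by (rule trans[OF has_derivative_pd[OF bounded_linear.has_derivative[OF assms(1)
    differentiable_on_has_derivative[OF assms(2-)]]]]) (simp add: pd_def)

lemma pd_const [simp]: "pd i (\<lambda>x. c) x = 0"
  by (rule has_derivative_pd[of _ "\<lambda>_. 0"]) simp

lemma Ck_on_const: "Ck_on k (S :: (real^'n) set) (\<lambda>x. c)"
proof (induction k arbitrary: c)
  case (Suc k)
  have "pd i (\<lambda>x::real^'n. c) = (\<lambda>x. 0)" for i by (rule ext) simp
  with Suc show ?case by (simp add: differentiable_on_def)
qed simp

lemma Ck_on_add: "open S \<Longrightarrow> Ck_on k S f \<Longrightarrow> Ck_on k S g \<Longrightarrow> Ck_on k S (\<lambda>x. f x + g x)"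
proof (induction k arbitrary: f g)
  case (Suc k)
  then have d: "f differentiable_on S" "g differentiable_on S" by auto
  have "Ck_on k S (pd i (\<lambda>x. f x + g x))" for i
  proof (rule Ck_on_cong[OF Suc.prems(1)])
    show "pd i f x + pd i g x = pd i (\<lambda>x. f x + g x) x" if "x \<in> S" for x
      using pd_add[OF d Suc.prems(1) that] by simp
    show "Ck_on k S (\<lambda>x. pd i f x + pd i g x)" using Suc by auto
  qed
  with d show ?case by (simp add: differentiable_on_add)
qed (simp add: continuous_on_add)

lemma Ck_on_linear: "bounded_linear L \<Longrightarrow> open S \<Longrightarrow> Ck_on k S f \<Longrightarrow> Ck_on k S (\<lambda>x. L (f x))"
proof (induction k arbitrary: f)
  case (Suc k)
  have "Ck_on k S (pd i (\<lambda>x. L (f x)))" for i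
  proof (rule Ck_on_cong[OF Suc.prems(2)])
    show "L (pd i f x) = pd i (\<lambda>x. L (f x)) x" if "x \<in> S" for x
      using pd_linear[OF Suc.prems(1) _ Suc.prems(2) that, of f] Suc.prems(3) by simp
    show "Ck_on k S (\<lambda>x. L (pd i f x))" using Suc by auto
  qed
  moreover have "(\<lambda>x. L (f x)) differentiable_on S"
    using Suc.prems bounded_linear.has_derivative[OF Suc.prems(1)]
    unfolding differentiable_on_def differentiable_def by (metis Ck_on.simps(2) differentiable_def differentiable_on_def)
  ultimately show ?case by simp
qed (simp add: bounded_linear.continuous_on)

lemma Ck_on_mult:
  fixes f g :: "real^'n \<Rightarrow> real"
  shows "open S \<Longrightarrow> Ck_on k S f \<Longrightarrow> Ck_on k S g \<Longrightarrow> Ck_on k S (\<lambda>x. f x * g x)"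
proof (induction k arbitrary: f g)
  case (Suc k)
  then have d: "f differentiable_on S" "g differentiable_on S" by auto
  have c: "Ck_on k S f" "Ck_on k S g" using Suc.prems Ck_on_Suc_D by blast+
  have "Ck_on k S (pd i (\<lambda>x. f x * g x))" for i
  proof (rule Ck_on_cong[OF Suc.prems(1)])
    show "pd i f x * g x + f x * pd i g x = pd i (\<lambda>x. f x * g x) x" if "x \<in> S" for x
      using pd_mult[OF d Suc.prems(1) that] by simp
    show "Ck_on k S (\<lambda>x. pd i f x * g x + f x * pd i g x)"
      using Suc c by (intro Ck_on_add) auto
  qed
  with d show ?case by simp
qed (simp add: continuous_on_mult)

text \<open>Induction works because \<open>pd i (1/f) = - (1/f)\<^sup>2 pd i f\<close> involves
  \<open>1/f\<close> itself only undifferentiated.\<close>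
lemma Ck_on_inverse:
  fixes f :: "real^'n \<Rightarrow> real"
  assumes "open S" and nz: "\<And>x. x \<in> S \<Longrightarrow> f x \<noteq> 0" and "Ck_on k S f"
  shows "Ck_on k S (\<lambda>x. inverse (f x))"
  using assms(3)
proof (induction k)
  case (Suc k)
  have IH: "Ck_on k S (\<lambda>x. inverse (f x))" using Suc Ck_on_Suc_D[OF assms(1)] by blast
  have d: "((\<lambda>x. inverse (f x)) has_derivative (\<lambda>v. - (inverse (f x) * frechet_derivative f (at x) v * inverse (f x)))) (at x)"
    if "x \<in> S" for x
    using Suc.prems differentiable_on_has_derivative[of f S x] assms(1) nz[OF that] that
    by (auto intro!: Deriv.has_derivative_inverse)
  have "Ck_on k S (pd i (\<lambda>x. inverse (f x)))" for i
  proof (rule Ck_on_cong[of S "\<lambda>x. (inverse (f x) * inverse (f x)) * (-1 * pd i f x)"])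
    show "inverse (f x) * inverse (f x) * (- 1 * pd i f x) = pd i (\<lambda>x. inverse (f x)) x" if "x \<in> S" for x
      using has_derivative_pd[OF d[OF that], of i] by (simp add: pd_def)
    show "Ck_on k S (\<lambda>x. inverse (f x) * inverse (f x) * (- 1 * pd i f x))"
      using Suc.prems by (intro Ck_on_mult assms(1) IH Ck_on_const) auto
  qed (rule assms(1))
  then show ?case using d
    by (auto simp: differentiable_on_def differentiable_def intro: has_derivative_at_withinI)
qed (use nz in \<open>auto intro: continuous_on_inverse\<close>)

lemma smooth_on_const: "smooth_on S (\<lambda>x. c)" by (simp add: smooth_on_def Ck_on_const)
lemma smooth_on_add: "open S \<Longrightarrow> smooth_on S f \<Longrightarrow> smooth_on S g \<Longrightarrow> smooth_on S (\<lambda>x. f x + g x)"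
  by (simp add: smooth_on_def Ck_on_add)
lemma smooth_on_linear: "bounded_linear L \<Longrightarrow> open S \<Longrightarrow> smooth_on S f \<Longrightarrow> smooth_on S (\<lambda>x. L (f x))"
  by (simp add: smooth_on_def Ck_on_linear)
lemma smooth_on_mult:
  fixes f g :: "real^'n \<Rightarrow> real"
  shows "open S \<Longrightarrow> smooth_on S f \<Longrightarrow> smooth_on S g \<Longrightarrow> smooth_on S (\<lambda>x. f x * g x)"
  by (simp add: smooth_on_def Ck_on_mult)
lemma smooth_on_inverse:
  fixes f :: "real^'n \<Rightarrow> real"
  shows "open S \<Longrightarrow> smooth_on S f \<Longrightarrow> (\<And>x. x \<in> S \<Longrightarrow> f x \<noteq> 0) \<Longrightarrow> smooth_on S (\<lambda>x. inverse (f x))"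
  by (simp add: smooth_on_def Ck_on_inverse)
lemma smooth_on_minus: "open S \<Longrightarrow> smooth_on S f \<Longrightarrow> smooth_on S (\<lambda>x. - f x)"
  by (rule smooth_on_linear) (simp_all add: bounded_linear_minus bounded_linear_ident)
lemma smooth_on_nth: "open S \<Longrightarrow> smooth_on S f \<Longrightarrow> smooth_on S (\<lambda>x. f x $ i)"
  by (rule smooth_on_linear[OF bounded_linear_vec_nth])
lemma smooth_on_sum: "open S \<Longrightarrow> (\<And>i. i \<in> I \<Longrightarrow> smooth_on S (f i)) \<Longrightarrow> smooth_on S (\<lambda>x. \<Sum>i\<in>I. f i x)"
  by (induction I rule: infinite_finite_induct) (auto intro: smooth_on_const smooth_on_add)
lemma smooth_on_prod:
  fixes f :: "'i \<Rightarrow> real^'n \<Rightarrow> real"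
  shows "open S \<Longrightarrow> (\<And>i. i \<in> I \<Longrightarrow> smooth_on S (f i)) \<Longrightarrow> smooth_on S (\<lambda>x. \<Prod>i\<in>I. f i x)"
  by (induction I rule: infinite_finite_induct) (auto intro: smooth_on_const smooth_on_mult)

lemma pd_line:
  fixes f :: "real^'n \<Rightarrow> real"
  assumes "f differentiable_on S" "open S" "y + u *\<^sub>R v \<in> S"
  shows "((\<lambda>u. f (y + u *\<^sub>R v)) has_real_derivative (\<Sum>i\<in>UNIV. v $ i * pd i f (y + u *\<^sub>R v))) (at u)"
proof -
  let ?f' = "frechet_derivative f (at (y + u *\<^sub>R v))"
  have d: "(f has_derivative ?f') (at (y + u *\<^sub>R v))"
    using differentiable_on_has_derivative[OF assms] .
  have "((\<lambda>u. y + u *\<^sub>R v) has_derivative (\<lambda>h. h *\<^sub>R v)) (at u)"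
    by (auto intro!: derivative_eq_intros)
  from diff_chain_at[OF this d]
  have "((\<lambda>u. f (y + u *\<^sub>R v)) has_derivative (\<lambda>h. ?f' (h *\<^sub>R v))) (at u)"
    by (simp add: o_def)
  moreover have "?f' (h *\<^sub>R v) = (\<Sum>i\<in>UNIV. v $ i * pd i f (y + u *\<^sub>R v)) * h" for h
    by (subst derivative_pd_sum[OF d]) (simp add: sum_distrib_left mult_ac)
  ultimately show ?thesis by (simp add: has_field_derivative_def)
qed

lemma pd_axis_line:
  fixes f :: "real^'n \<Rightarrow> real"
  assumes "f differentiable_on S" "open S" "y + u *\<^sub>R axis i 1 \<in> S"
  shows "((\<lambda>u. f (y + u *\<^sub>R axis i 1)) has_real_derivative pd i f (y + u *\<^sub>R axis i 1)) (at u)"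
proof -
  have "(\<Sum>k\<in>UNIV. axis i 1 $ k * pd k f (y + u *\<^sub>R axis i 1)) = pd i f (y + u *\<^sub>R axis i 1)"
    by (simp add: axis_def if_distrib if_distribR cong: if_cong)
  with pd_line[OF assms] show ?thesis by simp
qed

text \<open>The second difference quotient in the directions \<open>i\<close> and \<open>j\<close>: the
  mean value theorem is applied to the difference of two parallel lines in direction
  \<open>i\<close>, and then to \<open>pd i f\<close> in direction \<open>j\<close>.\<close>
lemma second_difference:
  fixes f :: "real^'n \<Rightarrow> real"
  assumes f: "Ck_on 2 S f" and S: "open S" "cball x (2 * t) \<subseteq> S" and t: "t > 0"
  shows "\<exists>z\<in>cball x (2 * t). f (x + t *\<^sub>R axis i 1 + t *\<^sub>R axis j 1) - f (x + t *\<^sub>R axis i 1)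
     - f (x + t *\<^sub>R axis j 1) + f x = t * t * pd j (pd i f) z"
proof -
  have fd: "f differentiable_on S" "pd i f differentiable_on S"
    using f by (auto simp: numeral_2_eq_2)
  have inball: "x + a *\<^sub>R axis i 1 + b *\<^sub>R axis j 1 \<in> cball x (2 * t)" if "0 \<le> a" "a \<le> t" "0 \<le> b" "b \<le> t" for a b
  proof -
    have "norm (a *\<^sub>R axis i 1 + b *\<^sub>R axis j 1 :: real^'n) \<le> a + b"
      using that norm_triangle_le[of "a *\<^sub>R axis i 1 :: real^'n" "b *\<^sub>R axis j 1" "a + b"] by (simp add: norm_axis_1)
    then have "norm (a *\<^sub>R axis i 1 + b *\<^sub>R axis j 1 :: real^'n) \<le> 2 * t" using that by simp
    moreover have "dist x (x + a *\<^sub>R axis i 1 + b *\<^sub>R axis j 1) = norm (a *\<^sub>R axis i 1 + b *\<^sub>R axis j 1 :: real^'n)"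
      unfolding add.assoc by (simp add: dist_norm norm_minus_commute add.commute del: minus_add_distrib)
    ultimately show ?thesis by simp
  qed
  define \<phi> where "\<phi> u = f ((x + t *\<^sub>R axis j 1) + u *\<^sub>R axis i 1) - f (x + u *\<^sub>R axis i 1)" for u
  have "\<exists>a. 0 < a \<and> a < t \<and> \<phi> t - \<phi> 0 = (t - 0) * (pd i f ((x + t *\<^sub>R axis j 1) + a *\<^sub>R axis i 1) - pd i f (x + a *\<^sub>R axis i 1))"
    unfolding \<phi>_def
  proof (rule MVT2[OF t], rule DERIV_diff)
    fix u assume u: "0 \<le> u" "u \<le> t"
    show "((\<lambda>u. f (x + t *\<^sub>R axis j 1 + u *\<^sub>R axis i 1)) has_real_derivative pd i f (x + t *\<^sub>R axis j 1 + u *\<^sub>R axis i 1)) (at u)"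
      by (rule pd_axis_line[OF fd(1) S(1)]) (use inball[of u t] u t S in \<open>auto simp: algebra_simps\<close>)
    show "((\<lambda>u. f (x + u *\<^sub>R axis i 1)) has_real_derivative pd i f (x + u *\<^sub>R axis i 1)) (at u)"
      by (rule pd_axis_line[OF fd(1) S(1)]) (use inball[of u 0] u t S in \<open>auto simp: algebra_simps\<close>)
  qed
  then obtain a where a: "0 < a" "a < t"
    "\<phi> t - \<phi> 0 = t * (pd i f ((x + a *\<^sub>R axis i 1) + t *\<^sub>R axis j 1) - pd i f (x + a *\<^sub>R axis i 1))"
    by (auto simp: algebra_simps)
  have "\<exists>b. 0 < b \<and> b < t \<and> pd i f ((x + a *\<^sub>R axis i 1) + t *\<^sub>R axis j 1) - pd i f ((x + a *\<^sub>R axis i 1) + 0 *\<^sub>R axis j 1)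
      = (t - 0) * pd j (pd i f) ((x + a *\<^sub>R axis i 1) + b *\<^sub>R axis j 1)"
  proof (rule MVT2[OF t])
    fix u assume u: "0 \<le> u" "u \<le> t"
    show "((\<lambda>u. pd i f (x + a *\<^sub>R axis i 1 + u *\<^sub>R axis j 1)) has_real_derivative pd j (pd i f) (x + a *\<^sub>R axis i 1 + u *\<^sub>R axis j 1)) (at u)"
      by (rule pd_axis_line[OF fd(2) S(1)]) (use inball[of a u] u a S in auto)
  qed
  then obtain b where b: "0 < b" "b < t" "pd i f ((x + a *\<^sub>R axis i 1) + t *\<^sub>R axis j 1) - pd i f (x + a *\<^sub>R axis i 1)
      = t * pd j (pd i f) ((x + a *\<^sub>R axis i 1) + b *\<^sub>R axis j 1)" by auto
  have "f (x + t *\<^sub>R axis i 1 + t *\<^sub>R axis j 1) - f (x + t *\<^sub>R axis i 1)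
     - f (x + t *\<^sub>R axis j 1) + f x = \<phi> t - \<phi> 0" by (simp add: \<phi>_def algebra_simps)
  then show ?thesis using a b inball[of a b] by (intro bexI[of _ "(x + a *\<^sub>R axis i 1) + b *\<^sub>R axis j 1"]) auto
qed

text \<open>Schwarz's theorem: the second difference quotient is symmetric in \<open>i\<close> and
  \<open>j\<close>, and by the preceding lemma it converges to both mixed derivatives.\<close>
lemma pd_commute:
  fixes f :: "real^'n \<Rightarrow> real"
  assumes f: "Ck_on 2 S f" and S: "open S" "x \<in> S"
  shows "pd i (pd j f) x = pd j (pd i f) x"
proof -
  obtain e where e: "e > 0" "cball x e \<subseteq> S" using S open_contains_cball by blast
  define t where "t n = e / 2 / real (Suc n)" for n
  have t: "t n > 0" "2 * t n \<le> e" for n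
    using e by (auto simp: t_def divide_simps)
  have sub: "cball x (2 * t n) \<subseteq> S" for n
    using e(2) t(2)[of n] by auto
  have t0: "t \<longlonglongrightarrow> 0" unfolding t_def
    by (intro real_tendsto_divide_at_top[OF tendsto_const] filterlim_compose[OF filterlim_real_sequentially filterlim_Suc])
  have lim: "(\<lambda>n. h (z n)) \<longlonglongrightarrow> h x" if "\<And>n. z n \<in> cball x (2 * t n)" "continuous_on S h" for z and h :: "real^'n \<Rightarrow> real"
  proof -
    have "z \<longlonglongrightarrow> x"
    proof (rule metric_tendsto_imp_tendsto)
      show "(\<lambda>n. 2 * t n) \<longlonglongrightarrow> 0" using tendsto_mult_right_zero[OF t0, of 2] by simp
      show "\<forall>\<^sub>F n in sequentially. dist (z n) x \<le> dist (2 * t n) 0"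
        using that(1) t by (auto simp: dist_commute less_imp_le)
    qed
    moreover have "isCont h x" using that(2) S by (simp add: continuous_on_eq_continuous_at)
    ultimately show ?thesis by (rule isCont_tendsto_compose[rotated])
  qed
  have "\<exists>z. \<forall>n. z n \<in> cball x (2 * t n) \<and>
     f (x + t n *\<^sub>R axis i 1 + t n *\<^sub>R axis j 1) - f (x + t n *\<^sub>R axis i 1)
     - f (x + t n *\<^sub>R axis j 1) + f x = t n * t n * pd j (pd i f) (z n)" for i j
    by (rule choice, rule allI)
      (use second_difference[OF f S(1) sub t(1), where i = i and j = j] in \<open>unfold Bex_def\<close>)
  then obtain z w where
    z: "\<And>n. z n \<in> cball x (2 * t n)"
    "\<And>n. f (x + t n *\<^sub>R axis i 1 + t n *\<^sub>R axis j 1) - f (x + t n *\<^sub>R axis i 1)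
     - f (x + t n *\<^sub>R axis j 1) + f x = t n * t n * pd j (pd i f) (z n)" and
    w: "\<And>n. w n \<in> cball x (2 * t n)"
    "\<And>n. f (x + t n *\<^sub>R axis j 1 + t n *\<^sub>R axis i 1) - f (x + t n *\<^sub>R axis j 1)
     - f (x + t n *\<^sub>R axis i 1) + f x = t n * t n * pd i (pd j f) (w n)"
    by blast
  have "pd j (pd i f) (z n) = pd i (pd j f) (w n)" for n
  proof -
    have "t n * t n * pd j (pd i f) (z n) = t n * t n * pd i (pd j f) (w n)"
      unfolding z(2)[symmetric] w(2)[symmetric] by (simp add: algebra_simps)
    then show ?thesis using t(1)[of n] by simp
  qed
  then have eq: "(\<lambda>n. pd j (pd i f) (z n)) = (\<lambda>n. pd i (pd j f) (w n))" by (rule ext)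
  have "continuous_on S (pd j (pd i f))" "continuous_on S (pd i (pd j f))"
    using f by (auto simp: numeral_2_eq_2)
  then have "(\<lambda>n. pd j (pd i f) (z n)) \<longlonglongrightarrow> pd j (pd i f) x"
    "(\<lambda>n. pd i (pd j f) (w n)) \<longlonglongrightarrow> pd i (pd j f) x"
    using lim z(1) w(1) by blast+
  then show ?thesis using LIMSEQ_unique unfolding eq by blast
qed

section \<open>Curvature over a ring with commuting derivations\<close>

lemma eq_neg_self_zero:
  fixes a :: "'a::real_vector"
  assumes "a = - a" shows "a = 0"
proof -
  have "2 *\<^sub>R a = 0" using assms by (metis add.right_inverse scaleR_2)
  then show ?thesis by simp
qed

text \<open>Contractions of a symmetric with an antisymmetric array vanish. Torsion-freeness of the
  connection always enters through this lemma.\<close>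
lemma sum_sym_antisym_zero:
  fixes S K :: "'n::finite \<Rightarrow> 'n \<Rightarrow> 'a::{comm_ring_1,real_algebra_1}"
  assumes "\<And>i j. S i j = S j i" "\<And>i j. K i j = - K j i"
  shows "(\<Sum>i\<in>UNIV. \<Sum>j\<in>UNIV. S i j * K i j) = 0"
proof (rule eq_neg_self_zero)
  have "(\<Sum>i\<in>UNIV. \<Sum>j\<in>UNIV. S i j * K i j) = (\<Sum>i\<in>UNIV. \<Sum>j\<in>UNIV. S j i * K j i)"
    by (rule sum.swap)
  also have "\<dots> = (\<Sum>i\<in>UNIV. \<Sum>j\<in>UNIV. - (S i j * K i j))"
  proof (intro sum.cong refl)
    fix i j show "S j i * K j i = - (S i j * K i j)"
      using assms(1)[of j i] assms(2)[of j i] by simp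
  qed
  finally show "(\<Sum>i\<in>UNIV. \<Sum>j\<in>UNIV. S i j * K i j) = - (\<Sum>i\<in>UNIV. \<Sum>j\<in>UNIV. S i j * K i j)"
    by (simp add: sum_negf)
qed

lemma matrix_sub_ldistrib: "A ** (B - C) = A ** B - A ** (C :: 'a::ring_1^'n^'m)"
  by (vector matrix_matrix_mult_def sum_subtractf algebra_simps)
lemma matrix_sub_rdistrib: "(A - B) ** C = A ** C - B ** (C :: 'a::ring_1^'n^'m)"
  by (vector matrix_matrix_mult_def sum_subtractf algebra_simps)
lemma matrix_add_rdistrib_ring: "(A + B) ** C = A ** C + B ** (C :: 'a::ring_1^'n^'m)"
  by (vector matrix_matrix_mult_def sum.distrib algebra_simps)
lemma matrix_neg_left: "(- A) ** B = - (A ** (B :: 'a::ring_1^'n^'m))"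
  by (vector matrix_matrix_mult_def sum_negf)
lemma matrix_neg_right: "A ** (- B) = - (A ** (B :: 'a::ring_1^'n^'m))"
  by (vector matrix_matrix_mult_def sum_negf)
lemma transpose_add: "transpose (A + B) = transpose A + transpose B"
  by (vector transpose_def)
lemma transpose_diff: "transpose (A - B) = transpose A - transpose B"
  by (vector transpose_def)
lemma transpose_neg: "transpose (- A) = - transpose A"
  by (vector transpose_def)
lemma trace_transpose: "trace (transpose A) = trace A"
  by (simp add: trace_def transpose_def)
lemma trace_neg: "trace (- A :: 'a::comm_ring_1^'n^'n) = - trace A"
  by (simp add: trace_def sum_negf)

lemma matrix_mult_nth: "(A ** B) $ i $ j = (\<Sum>k\<in>UNIV. A $ i $ k * B $ k $ j)"
  by (simp add: matrix_matrix_mult_def)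
lemma transpose_nth: "transpose A $ i $ j = A $ j $ i"
  by (simp add: transpose_def)

lemmas matrix_ring = matrix_add_ldistrib matrix_add_rdistrib_ring matrix_sub_ldistrib matrix_sub_rdistrib
  matrix_neg_left matrix_neg_right matrix_mul_assoc
lemmas transpose_ring = transpose_add transpose_diff transpose_neg matrix_transpose_mul

text \<open>The abstract counterpart of the smooth functions on a coordinate patch: \<open>D i\<close>
  plays the role of \<open>\<partial>\<^sub>i\<close>. The laws are required without side
  conditions, which allows purely equational proofs.\<close>
locale diff_ring =
  fixes D :: "'n::finite \<Rightarrow> 'a \<Rightarrow> 'a::{comm_ring_1,real_algebra_1}"
  assumes D_add: "D i (a + b) = D i a + D i b"
    and D_mult: "D i (a * b) = D i a * b + a * D i b"
    and D_scaleR: "D i (c *\<^sub>R a) = c *\<^sub>R D i a"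
    and D_comm: "D i (D j a) = D j (D i a)"
begin

lemma D_zero [simp]: "D i 0 = 0" using D_scaleR[of i 0 0] by simp
lemma D_one [simp]: "D i 1 = 0" using D_mult[of i 1 1] by simp
lemma D_neg: "D i (- a) = - D i a" using D_scaleR[of i "-1" a] by simp
lemma D_diff: "D i (a - b) = D i a - D i b" using D_add[of i a "-b"] by (simp add: D_neg)
lemma D_sum: "D i (sum f S) = (\<Sum>x\<in>S. D i (f x))"
  by (induction S rule: infinite_finite_induct) (auto simp: D_add)

definition mderiv :: "'n \<Rightarrow> 'a^'n^'n \<Rightarrow> 'a^'n^'n" where
  "mderiv i A = (\<chi> k l. D i (A $ k $ l))"

lemma mderiv_nth [simp]: "mderiv i A $ k $ l = D i (A $ k $ l)" by (simp add: mderiv_def)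
lemma mderiv_add: "mderiv i (A + B) = mderiv i A + mderiv i B" by (simp add: vec_eq_iff D_add)
lemma mderiv_diff: "mderiv i (A - B) = mderiv i A - mderiv i B" by (simp add: vec_eq_iff D_diff)
lemma mderiv_neg: "mderiv i (- B) = - mderiv i B" by (simp add: vec_eq_iff D_neg)
lemma mderiv_mult: "mderiv i (A ** B) = mderiv i A ** B + A ** mderiv i B"
  by (simp add: vec_eq_iff matrix_matrix_mult_def D_sum D_mult sum.distrib)
lemma mderiv_one [simp]: "mderiv i (mat 1) = 0" by (simp add: vec_eq_iff mat_def)
lemma mderiv_transpose: "mderiv i (transpose A) = transpose (mderiv i A)"
  by (simp add: vec_eq_iff transpose_def)
lemma mderiv_comm: "mderiv i (mderiv j A) = mderiv j (mderiv i A)" by (simp add: vec_eq_iff D_comm)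

lemmas mderiv_rules = mderiv_add mderiv_diff mderiv_neg mderiv_mult mderiv_transpose

end

text \<open>A metric \<open>G\<close> with inverse \<open>H\<close> and its Levi-Civita connection. The
  Christoffel symbols are collected into matrices, one for each direction of differentiation:
  \<open>\<Gamma> i $ k $ j\<close> is \<open>\<Gamma>\<^sup>k\<^sub>i\<^sub>j\<close>. In this
  form \<open>\<Gamma> i\<close> is the connection matrix of \<open>\<nabla>\<^sub>i\<close>
  acting on vectors, and curvature identities become identities between products of matrices.\<close>
locale metric_ring = diff_ring D
  for D :: "'n::finite \<Rightarrow> 'a \<Rightarrow> 'a::{comm_ring_1,real_algebra_1}" +
  fixes G H :: "'a^'n^'n" and \<Gamma> :: "'n \<Rightarrow> 'a^'n^'n"
  assumes G_sym: "transpose G = G"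
    and HG: "H ** G = mat 1" and GH: "G ** H = mat 1"
    and torsion: "\<Gamma> i $ k $ j = \<Gamma> j $ k $ i"
    and compat: "mderiv i G = transpose (\<Gamma> i) ** G + G ** \<Gamma> i"
begin

lemma H_sym: "transpose H = H"
proof -
  have "transpose H ** G = mat 1"
    using arg_cong[OF GH, of transpose] by (simp add: matrix_transpose_mul G_sym)
  then have "transpose H ** G ** H = H" by simp
  then show ?thesis by (simp add: matrix_mul_assoc[symmetric] GH)
qed

lemma G_nth_sym: "G $ i $ j = G $ j $ i" using G_sym by (simp add: transpose_def vec_eq_iff)
lemma H_nth_sym: "H $ i $ j = H $ j $ i" using H_sym by (simp add: transpose_def vec_eq_iff)

lemma compat_H: "mderiv i H = - (\<Gamma> i ** H + H ** transpose (\<Gamma> i))"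
proof -
  have "mderiv i (H ** G) = 0" by (simp add: HG)
  then have "mderiv i H ** G + H ** (transpose (\<Gamma> i) ** G) + H ** (G ** \<Gamma> i) = 0"
    by (simp add: mderiv_mult compat matrix_add_ldistrib add.assoc)
  then have "(mderiv i H ** G + H ** transpose (\<Gamma> i) ** G + \<Gamma> i) ** H = 0 ** H"
    by (simp add: matrix_mul_assoc HG)
  then have "mderiv i H ** (G ** H) + H ** transpose (\<Gamma> i) ** (G ** H) + \<Gamma> i ** H = 0"
    by (simp add: matrix_add_rdistrib_ring matrix_mul_assoc)
  then show ?thesis by (simp add: GH eq_neg_iff_add_eq_0 algebra_simps)
qed

text \<open>The curvature of the connection as a commutator, \<open>F i j = [\<nabla>\<^sub>i,
  \<nabla>\<^sub>j]\<close>; its entry \<open>F i j $ l $ k\<close> is the coefficient of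
  \<open>\<partial>\<^sub>l\<close> in \<open>R(\<partial>\<^sub>i, \<partial>\<^sub>j)
  \<partial>\<^sub>k\<close>.\<close>
definition F :: "'n \<Rightarrow> 'n \<Rightarrow> 'a^'n^'n" where
  "F i j = mderiv i (\<Gamma> j) - mderiv j (\<Gamma> i) + (\<Gamma> i ** \<Gamma> j - \<Gamma> j ** \<Gamma> i)"

lemma F_antisym: "F i j = - F j i" by (simp add: F_def)

text \<open>The Jacobi identity for \<open>\<nabla>\<^sub>m\<close>, \<open>\<nabla>\<^sub>i\<close> and
  \<open>\<nabla>\<^sub>j\<close>. The form indices are left undifferentiated: the corresponding
  Christoffel terms cancel in the cyclic sum.\<close>
lemma bianchi:
  "(mderiv m (F i j) + \<Gamma> m ** F i j - F i j ** \<Gamma> m) +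
   (mderiv i (F j m) + \<Gamma> i ** F j m - F j m ** \<Gamma> i) +
   (mderiv j (F m i) + \<Gamma> j ** F m i - F m i ** \<Gamma> j) = 0"
  by (simp add: F_def mderiv_rules matrix_ring mderiv_comm[of m] mderiv_comm[of j i])

text \<open>Commute two derivatives of \<open>H\<close>, using that \<open>H\<close> is parallel.\<close>
lemma F_skew_adjoint: "F i j ** H + H ** transpose (F i j) = 0"
proof -
  have "mderiv i (mderiv j H) - mderiv j (mderiv i H) + (F i j ** H + H ** transpose (F i j)) = 0"
    by (simp add: compat_H mderiv_rules matrix_ring transpose_ring F_def)
  then show ?thesis by (simp add: mderiv_comm[of i])
qed

text \<open>The curvature with its second index raised, \<open>R\<^sup>l\<^sup>k\<^sub>i\<^sub>j\<close>.
  It is antisymmetric in both pairs, so that contracting an upper with a lower index always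
  produces the Ricci endomorphism up to sign.\<close>
definition K :: "'n \<Rightarrow> 'n \<Rightarrow> 'a^'n^'n" where "K i j = F i j ** H"

lemma K_anti: "K i j = - K j i" unfolding K_def by (subst F_antisym) (simp add: matrix_neg_left)
lemma K_skew: "K i j = - transpose (K i j)"
  using F_skew_adjoint[of i j] by (simp add: K_def matrix_transpose_mul H_sym eq_neg_iff_add_eq_0)
lemma K_anti_nth: "K i j $ a $ b = - K j i $ a $ b"
  using K_anti[of i j] by (metis vector_uminus_component)
lemma K_skew_nth: "K i j $ a $ b = - K i j $ b $ a"
  using arg_cong[OF K_skew[of i j], of "\<lambda>m. m $ a $ b"] by (simp add: transpose_def)

lemma bianchi_K:
  "(mderiv m (K i j) + \<Gamma> m ** K i j + K i j ** transpose (\<Gamma> m)) +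
   (mderiv i (K j m) + \<Gamma> i ** K j m + K j m ** transpose (\<Gamma> i)) +
   (mderiv j (K m i) + \<Gamma> j ** K m i + K m i ** transpose (\<Gamma> j)) = 0"
proof -
  have *: "mderiv m (K i j) + \<Gamma> m ** K i j + K i j ** transpose (\<Gamma> m)
      = (mderiv m (F i j) + \<Gamma> m ** F i j - F i j ** \<Gamma> m) ** H" for m i j
    by (simp add: K_def mderiv_mult compat_H matrix_ring)
  show ?thesis unfolding * matrix_add_rdistrib_ring[symmetric] bianchi by simp
qed

text \<open>In coordinates this is \<open>\<partial>\<^sub>i log (sqrt (det G))\<close>, the density term
  of the divergence.\<close>
definition \<gamma> :: "'n \<Rightarrow> 'a" where "\<gamma> i = trace (\<Gamma> i)"

text \<open>\<open>F i j\<close> is skew-adjoint for the metric, hence conjugate to the negative of its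
  transpose.\<close>
lemma trace_F: "trace (F i j) = 0"
proof (rule eq_neg_self_zero)
  have "F i j = (F i j ** H) ** G" by (simp add: matrix_mul_assoc[symmetric] HG)
  also have "\<dots> = - (H ** transpose (F i j)) ** G"
    using F_skew_adjoint[of i j] by (simp only: eq_neg_iff_add_eq_0[symmetric])
  finally have "trace (F i j) = - trace (H ** transpose (F i j) ** G)"
    by (metis matrix_neg_left trace_neg)
  also have "trace (H ** transpose (F i j) ** G) = trace (transpose (F i j))"
    by (metis trace_mul_sym matrix_mul_assoc GH matrix_mul_lid)
  finally show "trace (F i j) = - trace (F i j)" by (simp add: trace_transpose)
qed

text \<open>This replaces the symmetry of second derivatives of \<open>log (sqrt (det G))\<close>: the
  trace of \<open>F i j\<close> vanishes, and commutators have trace zero.\<close>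
lemma \<gamma>_closed: "D i (\<gamma> j) = D j (\<gamma> i)"
proof -
  have "trace (mderiv i A) = D i (trace A)" for i A by (simp add: trace_def D_sum)
  moreover have "trace (mderiv i (\<Gamma> j)) - trace (mderiv j (\<Gamma> i)) = 0"
    using trace_F[of i j] by (simp add: F_def trace_add trace_sub trace_mul_sym[of "\<Gamma> i"])
  ultimately show ?thesis by (simp add: \<gamma>_def)
qed

definition divergence :: "'a^'n \<Rightarrow> 'a" where
  "divergence V = (\<Sum>i\<in>UNIV. D i (V $ i) + \<gamma> i * V $ i)"

text \<open>The divergence \<open>\<nabla>\<^sub>i T\<^sup>i\<^sub>j\<close> of an endomorphism field; the
  Christoffel terms of the upper index have been contracted to \<open>\<gamma>\<close>.\<close>
definition div_endo :: "'a^'n^'n \<Rightarrow> 'a^'n" where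
  "div_endo T = (\<chi> j. (\<Sum>i\<in>UNIV. D i (T $ i $ j) + \<gamma> i * T $ i $ j)
     - (\<Sum>i\<in>UNIV. \<Sum>p\<in>UNIV. \<Gamma> j $ p $ i * T $ i $ p))"

definition Ric :: "'a^'n^'n" where
  "Ric = (\<chi> j k. \<Sum>i\<in>UNIV. F i j $ i $ k)"

definition ric_endo :: "'a^'n^'n" where
  "ric_endo = (\<chi> k j. \<Sum>i\<in>UNIV. K i j $ i $ k)"

definition scalar :: 'a where "scalar = trace ric_endo"

lemma ric_endo_Ric: "ric_endo = transpose (Ric ** H)"
  unfolding vec_eq_iff
  by (intro allI, simp add: ric_endo_def Ric_def K_def transpose_def matrix_matrix_mult_def
      sum_distrib_right) (rule sum.swap)

text \<open>Set \<open>l = i\<close> and \<open>k = j\<close> in the Bianchi identity for \<open>K\<close>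
  and sum. Up to Christoffel terms, the first cyclic term yields the derivative of the scalar
  curvature, and each of the other two the negative of \<open>\<partial>\<^sub>i
  Ric\<^sup>i\<^sub>m\<close>; the Christoffel terms complete the latter to covariant
  divergences.\<close>
lemma contracted_bianchi: "2 *\<^sub>R div_endo ric_endo $ m = D m scalar"
proof -
  have 1: "(\<Sum>i\<in>UNIV. K i j $ i $ k) = ric_endo $ k $ j" for j k by (simp add: ric_endo_def)
  have 2: "(\<Sum>j\<in>UNIV. K i j $ p $ j) = ric_endo $ p $ i" for i p
    unfolding 1[symmetric]
    by (intro sum.cong refl) (metis K_anti_nth K_skew_nth minus_minus)
  have 3: "(\<Sum>j\<in>UNIV. K j m $ p $ j) = - ric_endo $ p $ m" for p
    unfolding 1[symmetric] sum_negf[symmetric]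
    by (intro sum.cong refl) (rule K_skew_nth)
  have 4: "(\<Sum>j\<in>UNIV. K m j $ j $ p) = - ric_endo $ p $ m" for p
    unfolding 1[symmetric] sum_negf[symmetric]
    by (intro sum.cong refl) (rule K_anti_nth)
  \<comment> \<open>In the names below the digit is the number of the cyclic term of \<open>bianchi_K\<close>, and a, b, c stand for its summand with the derivative, with \<open>\<Gamma>\<close> on the left, and with \<open>\<Gamma>\<close> on the right.\<close>
  have S1a: "(\<Sum>i\<in>UNIV. \<Sum>j\<in>UNIV. mderiv m (K i j) $ i $ j) = D m scalar"
    by (subst sum.swap) (simp add: scalar_def trace_def ric_endo_def D_sum)
  have S1b: "(\<Sum>i\<in>UNIV. \<Sum>j\<in>UNIV. (\<Gamma> m ** K i j) $ i $ j)
      = (\<Sum>i\<in>UNIV. \<Sum>p\<in>UNIV. \<Gamma> m $ i $ p * ric_endo $ p $ i)"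
  proof -
    have "(\<Sum>i\<in>UNIV. \<Sum>j\<in>UNIV. (\<Gamma> m ** K i j) $ i $ j)
      = (\<Sum>i\<in>UNIV. \<Sum>p\<in>UNIV. \<Sum>j\<in>UNIV. \<Gamma> m $ i $ p * K i j $ p $ j)"
      unfolding matrix_mult_nth by (rule sum.cong[OF refl]) (rule sum.swap)
    then show ?thesis by (simp add: sum_distrib_left[symmetric] 2)
  qed
  have S1c: "(\<Sum>i\<in>UNIV. \<Sum>j\<in>UNIV. (K i j ** transpose (\<Gamma> m)) $ i $ j)
      = (\<Sum>i\<in>UNIV. \<Sum>p\<in>UNIV. \<Gamma> m $ i $ p * ric_endo $ p $ i)"
  proof -
    have "(\<Sum>i\<in>UNIV. \<Sum>j\<in>UNIV. (K i j ** transpose (\<Gamma> m)) $ i $ j)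
      = (\<Sum>j\<in>UNIV. \<Sum>i\<in>UNIV. \<Sum>p\<in>UNIV. \<Gamma> m $ j $ p * K i j $ i $ p)"
      unfolding matrix_mult_nth transpose_nth by (subst sum.swap) (simp only: mult.commute)
    also have "\<dots> = (\<Sum>j\<in>UNIV. \<Sum>p\<in>UNIV. \<Sum>i\<in>UNIV. \<Gamma> m $ j $ p * K i j $ i $ p)"
      by (rule sum.cong[OF refl]) (rule sum.swap)
    finally show ?thesis by (simp add: sum_distrib_left[symmetric] 1)
  qed
  have S2a: "(\<Sum>i\<in>UNIV. \<Sum>j\<in>UNIV. mderiv i (K j m) $ i $ j) = - (\<Sum>i\<in>UNIV. D i (ric_endo $ i $ m))"
    by (simp add: D_sum[symmetric] 3 D_neg sum_negf)
  have S2b: "(\<Sum>i\<in>UNIV. \<Sum>j\<in>UNIV. (\<Gamma> i ** K j m) $ i $ j) = - (\<Sum>p\<in>UNIV. \<gamma> p * ric_endo $ p $ m)"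
  proof -
    have "(\<Sum>i\<in>UNIV. \<Sum>j\<in>UNIV. (\<Gamma> i ** K j m) $ i $ j)
       = (\<Sum>i\<in>UNIV. \<Sum>p\<in>UNIV. \<Sum>j\<in>UNIV. \<Gamma> i $ i $ p * K j m $ p $ j)"
      unfolding matrix_mult_nth by (rule sum.cong[OF refl]) (rule sum.swap)
    also have "\<dots> = (\<Sum>p\<in>UNIV. \<Sum>i\<in>UNIV. \<Gamma> i $ i $ p * - ric_endo $ p $ m)"
      by (subst sum.swap) (simp add: sum_distrib_left[symmetric] 3)
    also have "\<dots> = - (\<Sum>p\<in>UNIV. \<gamma> p * ric_endo $ p $ m)"
      by (simp add: \<gamma>_def trace_def torsion[of _ _ _] sum_distrib_right sum_negf)
    finally show ?thesis .
  qed
  have S2c: "(\<Sum>i\<in>UNIV. \<Sum>j\<in>UNIV. (K j m ** transpose (\<Gamma> i)) $ i $ j) = 0"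
  proof -
    have "(\<Sum>i\<in>UNIV. \<Sum>j\<in>UNIV. (K j m ** transpose (\<Gamma> i)) $ i $ j)
      = (\<Sum>j\<in>UNIV. \<Sum>i\<in>UNIV. \<Sum>p\<in>UNIV. \<Gamma> i $ j $ p * K j m $ i $ p)"
      unfolding matrix_mult_nth transpose_nth by (subst sum.swap) (simp only: mult.commute)
    also have "\<dots> = 0"
      by (rule sum.neutral, rule ballI, rule sum_sym_antisym_zero, rule torsion, rule K_skew_nth)
    finally show ?thesis .
  qed
  have S3a: "(\<Sum>i\<in>UNIV. \<Sum>j\<in>UNIV. mderiv j (K m i) $ i $ j) = - (\<Sum>i\<in>UNIV. D i (ric_endo $ i $ m))"
    by (subst sum.swap) (simp add: D_sum[symmetric] 4 D_neg sum_negf)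
  have S3b: "(\<Sum>i\<in>UNIV. \<Sum>j\<in>UNIV. (\<Gamma> j ** K m i) $ i $ j) = 0"
    unfolding matrix_mult_nth
  proof (rule sum.neutral, rule ballI)
    fix i
    have "(\<Sum>j\<in>UNIV. \<Sum>p\<in>UNIV. \<Gamma> j $ i $ p * K m i $ p $ j) =
      (\<Sum>j\<in>UNIV. \<Sum>p\<in>UNIV. \<Gamma> j $ i $ p * - K m i $ j $ p)"
      using K_skew_nth[of m i] by (intro sum.cong refl arg_cong2[where f = "(*)"]) metis
    also have "\<dots> = 0"
      by (intro sum_sym_antisym_zero torsion) (metis K_skew_nth)
    finally show "(\<Sum>j\<in>UNIV. \<Sum>p\<in>UNIV. \<Gamma> j $ i $ p * K m i $ p $ j) = 0" .
  qed
  have S3c: "(\<Sum>i\<in>UNIV. \<Sum>j\<in>UNIV. (K m i ** transpose (\<Gamma> j)) $ i $ j)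
      = - (\<Sum>p\<in>UNIV. \<gamma> p * ric_endo $ p $ m)"
  proof -
    have "(\<Sum>i\<in>UNIV. \<Sum>j\<in>UNIV. (K m i ** transpose (\<Gamma> j)) $ i $ j)
       = (\<Sum>j\<in>UNIV. \<Sum>p\<in>UNIV. \<Sum>i\<in>UNIV. \<Gamma> j $ j $ p * K m i $ i $ p)"
      unfolding matrix_mult_nth transpose_nth
      by (subst sum.swap, rule sum.cong[OF refl], subst sum.swap) (simp only: mult.commute)
    also have "\<dots> = (\<Sum>p\<in>UNIV. \<Sum>i\<in>UNIV. \<Gamma> i $ i $ p * - ric_endo $ p $ m)"
      by (subst sum.swap) (simp add: sum_distrib_left[symmetric] 4)
    also have "\<dots> = - (\<Sum>p\<in>UNIV. \<gamma> p * ric_endo $ p $ m)"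
      by (simp add: \<gamma>_def trace_def torsion[of _ _ _] sum_distrib_right sum_negf)
    finally show ?thesis .
  qed
  have S4: "(\<Sum>i\<in>UNIV. \<Sum>p\<in>UNIV. \<Gamma> m $ p $ i * ric_endo $ i $ p)
      = (\<Sum>i\<in>UNIV. \<Sum>p\<in>UNIV. \<Gamma> m $ i $ p * ric_endo $ p $ i)" by (rule sum.swap)
  have "(\<Sum>i\<in>UNIV. \<Sum>j\<in>UNIV. ((mderiv m (K i j) + \<Gamma> m ** K i j + K i j ** transpose (\<Gamma> m)) +
   (mderiv i (K j m) + \<Gamma> i ** K j m + K j m ** transpose (\<Gamma> i)) +
   (mderiv j (K m i) + \<Gamma> j ** K m i + K m i ** transpose (\<Gamma> j))) $ i $ j) = 0"
    unfolding bianchi_K by simp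
  then show ?thesis
    unfolding vector_add_component sum.distrib S1a S1b S1c S2a S2b S2c S3a S3b S3c
    using S4 by (simp add: div_endo_def scaleR_2 sum.distrib algebra_simps)
qed

end

section \<open>Divergences and the Ricci identity\<close>

context diff_ring begin
definition vderiv :: "'n \<Rightarrow> 'a^'n \<Rightarrow> 'a^'n" where "vderiv i W = (\<chi> k. D i (W $ k))"
lemma vderiv_nth [simp]: "vderiv i W $ k = D i (W $ k)" by (simp add: vderiv_def)
lemma vderiv_add: "vderiv i (V + W) = vderiv i V + vderiv i W" by (simp add: vec_eq_iff D_add)
lemma vderiv_mult: "vderiv i (A *v W) = mderiv i A *v W + A *v vderiv i W"
  by (simp add: vec_eq_iff matrix_vector_mult_def D_sum D_mult sum.distrib)
lemma vderiv_comm: "vderiv i (vderiv j W) = vderiv j (vderiv i W)" by (simp add: vec_eq_iff D_comm)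
definition grad :: "'a \<Rightarrow> 'a^'n" where "grad f = (\<chi> i. D i f)"
lemma grad_nth [simp]: "grad f $ i = D i f" by (simp add: grad_def)
end

context metric_ring begin

text \<open>The covariant derivative of a vector field as an endomorphism: \<open>nabla W $ k $ i\<close>
  is \<open>\<nabla>\<^sub>i W\<^sup>k\<close>.\<close>
definition nabla :: "'a^'n \<Rightarrow> 'a^'n^'n" where
  "nabla W = (\<chi> k i. D i (W $ k) + (\<Gamma> i *v W) $ k)"

lemma matrix_vector_mult_nth: "(A *v W) $ k = (\<Sum>p\<in>UNIV. A $ k $ p * W $ p)"
  by (simp add: matrix_vector_mult_def)

lemma gamma_sum: "\<gamma> p = (\<Sum>i\<in>UNIV. \<Gamma> i $ i $ p)"
  by (simp add: \<gamma>_def trace_def torsion[of _ _ p])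

text \<open>The commutator \<open>[\<nabla>\<^sub>i, \<nabla>\<^sub>j] W = F i j W\<close>, contracted
  over \<open>i\<close>.\<close>
lemma ricci_commutator: "div_endo (nabla W) $ j = D j (trace (nabla W)) + (Ric *v W) $ j"
proof -
  \<comment> \<open>the columns of \<open>nabla W\<close>, on which \<open>\<nabla>\<^sub>i\<close> acts as on vectors\<close>
  define N where "N i = vderiv i W + \<Gamma> i *v W" for i
  have N: "N j $ k = nabla W $ k $ j" for j k by (simp add: N_def nabla_def)
  have "vderiv i (N j) + \<Gamma> i *v N j - (vderiv j (N i) + \<Gamma> j *v N i) = F i j *v W" for i
    by (simp add: N_def vderiv_add vderiv_mult vderiv_comm[of i] F_def matrix_vector_mul_assoc
        matrix_vector_mult_add_rdistrib matrix_vector_mult_diff_rdistrib matrix_vector_right_distrib)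
  then have eq: "(\<Sum>i\<in>UNIV. (F i j *v W) $ i) = (\<Sum>i\<in>UNIV. D i (nabla W $ i $ j) + (\<Gamma> i *v N j) $ i
      - (D j (nabla W $ i $ i) + (\<Gamma> j *v N i) $ i))"
    by (metis (no_types, lifting) vector_minus_component vector_add_component vderiv_nth N)
  have 1: "(\<Sum>i\<in>UNIV. (\<Gamma> i *v N j) $ i) = (\<Sum>p\<in>UNIV. \<gamma> p * nabla W $ p $ j)"
    unfolding matrix_vector_mult_nth gamma_sum N by (subst sum.swap) (simp add: sum_distrib_right)
  have 2: "(\<Sum>i\<in>UNIV. (F i j *v W) $ i) = (Ric *v W) $ j"
    unfolding matrix_vector_mult_nth by (subst sum.swap) (simp add: Ric_def sum_distrib_right)
  have 3: "(\<Sum>i\<in>UNIV. (\<Gamma> j *v N i) $ i) = (\<Sum>i\<in>UNIV. \<Sum>p\<in>UNIV. \<Gamma> j $ p $ i * nabla W $ i $ p)"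
    unfolding matrix_vector_mult_nth N by (rule sum.swap)
  show ?thesis
    using eq unfolding sum.distrib sum_subtractf 1 2 3
    by (simp add: div_endo_def trace_def D_sum sum.distrib algebra_simps)
qed

lemma div_endo_diff: "div_endo (S - T) = div_endo S - div_endo T"
  by (simp add: div_endo_def vec_eq_iff D_diff sum.distrib sum_subtractf algebra_simps)

text \<open>Constant multiples of the identity are parallel.\<close>
lemma div_endo_scalar: "div_endo (c *\<^sub>R mat 1) = 0"
proof -
  have "(\<Sum>p\<in>UNIV. \<Gamma> j $ p $ i * (c *\<^sub>R (mat 1 :: 'a^'n^'n)) $ i $ p) = c *\<^sub>R \<Gamma> j $ i $ i" for i j
    by (simp add: mat_def if_distrib cong: if_cong)
  moreover have "(\<Sum>i\<in>UNIV. D i ((c *\<^sub>R (mat 1 :: 'a^'n^'n)) $ i $ j) + \<gamma> i * (c *\<^sub>R (mat 1 :: 'a^'n^'n)) $ i $ j)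
    = c *\<^sub>R \<gamma> j" for j
    by (simp add: mat_def if_distrib D_scaleR cong: if_cong)
  ultimately show ?thesis
    by (simp add: div_endo_def vec_eq_iff \<gamma>_def trace_def scaleR_sum_right)
qed

lemma divergence_add: "divergence (V + W) = divergence V + divergence W"
  by (simp add: divergence_def D_add sum.distrib algebra_simps)
lemma divergence_scaleR: "divergence (c *\<^sub>R V) = c *\<^sub>R divergence V"
  by (simp add: divergence_def D_scaleR scaleR_sum_right algebra_simps)

text \<open>The Leibniz rule \<open>\<nabla>\<^sub>i (T\<^sup>i\<^sub>l W\<^sup>l) = (\<nabla>\<^sub>i
  T\<^sup>i\<^sub>l) W\<^sup>l + T\<^sup>i\<^sub>l \<nabla>\<^sub>i W\<^sup>l\<close>.\<close>
lemma divergence_mult: "divergence (T *v W) = (\<Sum>l\<in>UNIV. div_endo T $ l * W $ l) + trace (T ** nabla W)"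
proof -
  have a: "(\<Sum>l\<in>UNIV. div_endo T $ l * W $ l) =
     (\<Sum>i\<in>UNIV. \<Sum>l\<in>UNIV. (D i (T $ i $ l) + \<gamma> i * T $ i $ l) * W $ l)
      - (\<Sum>i\<in>UNIV. \<Sum>p\<in>UNIV. \<Sum>l\<in>UNIV. \<Gamma> l $ p $ i * T $ i $ p * W $ l)"
  proof -
    have "(\<Sum>l\<in>UNIV. (\<Sum>i\<in>UNIV. \<Sum>p\<in>UNIV. \<Gamma> l $ p $ i * T $ i $ p) * W $ l)
      = (\<Sum>i\<in>UNIV. \<Sum>l\<in>UNIV. \<Sum>p\<in>UNIV. \<Gamma> l $ p $ i * T $ i $ p * W $ l)"
      by (subst sum.swap) (simp add: sum_distrib_right)
    also have "\<dots> = (\<Sum>i\<in>UNIV. \<Sum>p\<in>UNIV. \<Sum>l\<in>UNIV. \<Gamma> l $ p $ i * T $ i $ p * W $ l)"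
      by (rule sum.cong[OF refl]) (rule sum.swap)
    moreover have "(\<Sum>l\<in>UNIV. (\<Sum>i\<in>UNIV. D i (T $ i $ l) + \<gamma> i * T $ i $ l) * W $ l) =
      (\<Sum>i\<in>UNIV. \<Sum>l\<in>UNIV. (D i (T $ i $ l) + \<gamma> i * T $ i $ l) * W $ l)"
      by (subst sum.swap) (simp add: sum_distrib_right)
    ultimately show ?thesis by (simp add: div_endo_def left_diff_distrib sum_subtractf)
  qed
  have b: "trace (T ** nabla W) = (\<Sum>i\<in>UNIV. \<Sum>p\<in>UNIV. T $ i $ p * D i (W $ p))
      + (\<Sum>i\<in>UNIV. \<Sum>p\<in>UNIV. \<Sum>l\<in>UNIV. \<Gamma> l $ p $ i * T $ i $ p * W $ l)"
    by (simp add: trace_def matrix_mult_nth nabla_def matrix_vector_mult_nth sum.distrib distrib_left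
        sum_distrib_left torsion[of _ _ "_"] mult_ac)
  show ?thesis unfolding a b divergence_def matrix_vector_mult_nth
    by (simp add: D_sum D_mult sum.distrib sum_distrib_left distrib_right distrib_left mult_ac)
qed

text \<open>For an antisymmetric tensor with upper indices the divergence needs no Christoffel symbols
  besides \<open>\<gamma>\<close>, since \<open>\<Gamma>\<^sup>j\<^sub>i\<^sub>m
  A\<^sup>i\<^sup>m = 0\<close>.\<close>
lemma raise_div_endo_skew:
  assumes "transpose (A ** H) = - (A ** H)"
  shows "H *v div_endo A = (\<chi> j. \<Sum>i\<in>UNIV. D i ((A ** H) $ i $ j) + \<gamma> i * (A ** H) $ i $ j)"
proof -
  have anti: "(A ** H) $ i $ j = - (A ** H) $ j $ i" for i j
    using arg_cong[OF assms, of "\<lambda>m. m $ j $ i"] by (simp add: transpose_nth)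
  { fix j
    have "(\<Sum>i\<in>UNIV. D i ((A ** H) $ i $ j)) = (\<Sum>i\<in>UNIV. (mderiv i A ** H) $ i $ j)
        - (\<Sum>i\<in>UNIV. (A ** (\<Gamma> i ** H)) $ i $ j) - (\<Sum>i\<in>UNIV. (A ** H ** transpose (\<Gamma> i)) $ i $ j)"
      unfolding mderiv_nth[symmetric] mderiv_mult compat_H sum_subtractf[symmetric]
      by (rule sum.cong[OF refl]) (simp add: matrix_ring)
    moreover have "(\<Sum>i\<in>UNIV. (A ** H ** transpose (\<Gamma> i)) $ i $ j) = 0"
    proof -
      have "(\<Sum>i\<in>UNIV. (A ** H ** transpose (\<Gamma> i)) $ i $ j)
        = (\<Sum>i\<in>UNIV. \<Sum>p\<in>UNIV. \<Gamma> i $ j $ p * (A ** H) $ i $ p)"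
        unfolding matrix_mult_nth[of "A ** H"] transpose_nth by (simp only: mult.commute)
      also have "\<dots> = 0" by (rule sum_sym_antisym_zero) (rule torsion, rule anti)
      finally show ?thesis .
    qed
    moreover have "(\<Sum>i\<in>UNIV. (A ** (\<Gamma> i ** H)) $ i $ j)
      = (\<Sum>k\<in>UNIV. (\<Sum>i\<in>UNIV. \<Sum>p\<in>UNIV. \<Gamma> k $ p $ i * A $ i $ p) * H $ j $ k)"
    proof -
      have comm: "\<Gamma> k $ p $ i * A $ i $ p = A $ i $ p * \<Gamma> i $ p $ k" for k p i
        using torsion[of k p i] by (simp only: mult.commute)
      have "(\<Sum>k\<in>UNIV. (\<Sum>i\<in>UNIV. \<Sum>p\<in>UNIV. \<Gamma> k $ p $ i * A $ i $ p) * H $ j $ k)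
        = (\<Sum>k\<in>UNIV. \<Sum>i\<in>UNIV. (A ** \<Gamma> i) $ i $ k * H $ k $ j)"
        unfolding matrix_mult_nth sum_distrib_right
        by (simp only: comm H_nth_sym[of j])
      also have "\<dots> = (\<Sum>i\<in>UNIV. (A ** \<Gamma> i ** H) $ i $ j)"
        by (subst sum.swap) (simp only: matrix_mult_nth[of "A ** _"])
      finally show ?thesis by (simp add: matrix_mul_assoc)
    qed
    moreover have "(\<Sum>i\<in>UNIV. (mderiv i A ** H) $ i $ j) = (\<Sum>k\<in>UNIV. H $ j $ k * (\<Sum>i\<in>UNIV. D i (A $ i $ k)))"
      unfolding matrix_mult_nth sum_distrib_left
      by (subst sum.swap) (simp add: mult.commute H_nth_sym[of j])
    moreover have "(\<Sum>i\<in>UNIV. \<gamma> i * (A ** H) $ i $ j) = (\<Sum>k\<in>UNIV. H $ j $ k * (\<Sum>i\<in>UNIV. \<gamma> i * A $ i $ k))"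
      unfolding matrix_mult_nth sum_distrib_left
      by (subst sum.swap) (simp add: mult_ac H_nth_sym[of j])
    moreover have "(H *v div_endo A) $ j = (\<Sum>k\<in>UNIV. H $ j $ k * (\<Sum>i\<in>UNIV. D i (A $ i $ k)))
        + (\<Sum>k\<in>UNIV. H $ j $ k * (\<Sum>i\<in>UNIV. \<gamma> i * A $ i $ k))
        - (\<Sum>k\<in>UNIV. (\<Sum>i\<in>UNIV. \<Sum>p\<in>UNIV. \<Gamma> k $ p $ i * A $ i $ p) * H $ j $ k)"
      by (simp add: matrix_vector_mult_nth div_endo_def sum.distrib right_diff_distrib distrib_left sum_subtractf
          mult.commute[of _ "H $ j $ _"])
    ultimately have "(H *v div_endo A) $ j = (\<Sum>i\<in>UNIV. D i ((A ** H) $ i $ j) + \<gamma> i * (A ** H) $ i $ j)"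
      unfolding sum.distrib by (simp only: diff_zero add_diff_eq diff_add_eq)
  }
  then show ?thesis by (simp add: vec_eq_iff)
qed

text \<open>The double divergence of an antisymmetric tensor vanishes: the operators \<open>D i + \<gamma>
  i\<close> commute because \<open>\<gamma>\<close> is closed.\<close>
lemma divergence_antisym:
  assumes "transpose B = - B"
  shows "divergence (\<chi> j. \<Sum>i\<in>UNIV. D i (B $ i $ j) + \<gamma> i * B $ i $ j) = 0"
proof (rule eq_neg_self_zero)
  have anti: "B $ i $ j = - B $ j $ i" for i j
    using arg_cong[OF assms, of "\<lambda>m. m $ j $ i"] by (simp add: transpose_nth)
  define E where "E j i = D j (D i (B $ i $ j)) + D j (\<gamma> i * B $ i $ j) + \<gamma> j * D i (B $ i $ j) + \<gamma> j * \<gamma> i * B $ i $ j" for i j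
  have "divergence (\<chi> j. \<Sum>i\<in>UNIV. D i (B $ i $ j) + \<gamma> i * B $ i $ j) = (\<Sum>j\<in>UNIV. \<Sum>i\<in>UNIV. E j i)"
    by (simp add: divergence_def E_def D_sum D_add sum.distrib sum_distrib_left distrib_left mult.assoc)
  also have "\<dots> = (\<Sum>j\<in>UNIV. \<Sum>i\<in>UNIV. E i j)" by (rule sum.swap)
  also have "\<dots> = (\<Sum>j\<in>UNIV. \<Sum>i\<in>UNIV. - E j i)"
  proof (intro sum.cong refl)
    fix i j
    show "E i j = - E j i"
      unfolding E_def D_mult D_comm[of i j] \<gamma>_closed[of i j]
      by (subst (1 2 3 4 5) anti[of j i]) (simp add: D_neg algebra_simps)
  qed
  also have "\<dots> = - (\<Sum>j\<in>UNIV. \<Sum>i\<in>UNIV. E j i)" by (simp add: sum_negf)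
  also have "(\<Sum>j\<in>UNIV. \<Sum>i\<in>UNIV. E j i)
      = divergence (\<chi> j. \<Sum>i\<in>UNIV. D i (B $ i $ j) + \<gamma> i * B $ i $ j)"
    by (simp add: divergence_def E_def D_sum D_add sum.distrib sum_distrib_left distrib_left mult.assoc)
  finally show "divergence (\<chi> j. \<Sum>i\<in>UNIV. D i (B $ i $ j) + \<gamma> i * B $ i $ j)
      = - divergence (\<chi> j. \<Sum>i\<in>UNIV. D i (B $ i $ j) + \<gamma> i * B $ i $ j)" .
qed

end

section \<open>Laplacian identities for solitons and Killing fields\<close>

lemma matrix_vector_scaleR: "A *v (b *\<^sub>R x) = b *\<^sub>R (A *v x)"
  for A :: "'a::real_algebra_1^'n^'m"
  by (simp add: vec_eq_iff matrix_vector_mult_def scaleR_sum_right)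

context metric_ring begin

text \<open>Write \<open>\<nabla>W = (Ric - c) + A\<close>, where \<open>A\<close> is the antisymmetric
  part of \<open>\<nabla>W\<close>. The soliton equation gives \<open>d (tr \<nabla>W) =
  ds\<close>, so the Ricci identity and the contracted Bianchi identity determine the divergence
  of \<open>A\<close> as \<open>ds/2 + Ric W\<close>. Its own divergence is zero, and expanding
  \<open>div (Ric W)\<close> yields the formula. The inner product of \<open>Ric\<close> with
  \<open>\<nabla>W\<close> involves only the symmetric part \<open>Ric - c\<close>.\<close>
lemma soliton_laplacian:
  assumes sol: "2 *\<^sub>R Ric = G ** nabla W + transpose (G ** nabla W) + (2 * c) *\<^sub>R G"
  shows "divergence (H *v grad scalar) + (\<Sum>l\<in>UNIV. D l scalar * W $ l)
    + 2 *\<^sub>R trace (ric_endo ** (ric_endo - c *\<^sub>R mat 1)) = 0"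
proof -
  let ?M = "nabla W"
  have scl: "(b *\<^sub>R X) ** Y = b *\<^sub>R (X ** Y)" "X ** (b *\<^sub>R Y) = b *\<^sub>R (X ** Y)"
    for b and X Y :: "'a^'n^'n"
    by (simp_all add: vec_eq_iff matrix_mult_nth scaleR_sum_right)
  \<comment> \<open>\<open>H ** transpose ?M ** G\<close> is the adjoint of \<open>?M\<close> with respect to the metric.\<close>
  define A where "A = (1/2) *\<^sub>R (?M - H ** transpose ?M ** G)"
  have Ric_sym: "transpose Ric = Ric"
  proof -
    have "transpose (2 *\<^sub>R Ric) = 2 *\<^sub>R Ric"
      unfolding sol by (simp add: transpose_ring transpose_scalar G_sym add_ac)
    then have "2 *\<^sub>R (transpose Ric - Ric) = 0" by (simp add: transpose_scalar algebra_simps)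
    then show ?thesis by simp
  qed
  have ric_endo: "ric_endo = H ** Ric" by (simp add: ric_endo_Ric matrix_transpose_mul H_sym Ric_sym)
  have two_ric_endo: "2 *\<^sub>R ric_endo = ?M + H ** transpose ?M ** G + (2 * c) *\<^sub>R mat 1"
  proof -
    have "2 *\<^sub>R ric_endo = H ** (2 *\<^sub>R Ric)" by (simp add: ric_endo scl)
    also have "\<dots> = ?M + H ** transpose ?M ** G + (2 * c) *\<^sub>R mat 1"
      unfolding sol
      by (simp add: matrix_ring scl HG transpose_ring G_sym)
    finally show ?thesis .
  qed
  have M: "?M = (ric_endo - c *\<^sub>R mat 1) + A"
  proof -
    have "2 *\<^sub>R ((ric_endo - c *\<^sub>R mat 1) + A) = 2 *\<^sub>R ric_endo - (2 * c) *\<^sub>R mat 1 + (?M - H ** transpose ?M ** G)"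
      by (simp add: A_def algebra_simps)
    also have "\<dots> = 2 *\<^sub>R ?M" unfolding two_ric_endo by (simp add: scaleR_2)
    finally show ?thesis by simp
  qed
  have AH: "A ** H = (1/2) *\<^sub>R (?M ** H - H ** transpose ?M)"
    by (simp add: A_def scl matrix_ring) (simp add: matrix_mul_assoc[symmetric] GH)
  have A_anti: "transpose (A ** H) = - (A ** H)"
    unfolding AH by (simp add: transpose_scalar transpose_ring H_sym algebra_simps)
  have trHM: "trace (H ** transpose ?M ** G) = trace ?M"
    by (metis trace_mul_sym matrix_mul_assoc GH matrix_mul_lid trace_transpose)
  have tr_scaleR: "trace (b *\<^sub>R X) = b *\<^sub>R trace X" for b and X :: "'a^'n^'n"
    by (simp add: trace_def scaleR_sum_right)
  have "2 *\<^sub>R scalar = trace (2 *\<^sub>R ric_endo)" by (simp add: scalar_def tr_scaleR)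
  then have scalar: "2 *\<^sub>R scalar = 2 *\<^sub>R trace ?M + (2 * c) *\<^sub>R trace (mat 1 :: 'a^'n^'n)"
    unfolding two_ric_endo by (simp add: trace_add trHM tr_scaleR scaleR_2)
  have D_one: "D l (trace (mat 1 :: 'a^'n^'n)) = 0" for l
    unfolding trace_def D_sum by (simp add: mat_def)
  have "2 *\<^sub>R D l scalar = 2 *\<^sub>R D l (trace ?M)" for l
    using arg_cong[OF scalar, of "D l"] by (simp add: D_scaleR D_add D_one)
  then have Ds: "D l (trace ?M) = D l scalar" for l by simp
  have dvRm: "div_endo ric_endo = (1/2) *\<^sub>R grad scalar"
  proof -
    have "2 *\<^sub>R div_endo ric_endo = grad scalar" by (simp add: vec_eq_iff contracted_bianchi)
    then show ?thesis by (metis scaleR_half_double scaleR_2 scaleR_scaleR scaleR_one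
      nonzero_eq_divide_eq times_divide_eq_left mult_1 zero_neq_numeral)
  qed
  have "div_endo A = div_endo (?M - (ric_endo - c *\<^sub>R mat 1))" using M by (metis add_diff_cancel_left')
  also have "\<dots> = grad scalar + Ric *v W - (1/2) *\<^sub>R grad scalar"
    by (simp add: div_endo_diff div_endo_scalar dvRm vec_eq_iff ricci_commutator Ds)
  finally have "div_endo A = (grad scalar - (1/2) *\<^sub>R grad scalar) + Ric *v W" by (simp add: algebra_simps)
  moreover have "grad scalar - (1/2) *\<^sub>R grad scalar = (1/2) *\<^sub>R grad scalar"
    using scaleR_half_double[of "grad scalar"] by (simp only: scaleR_add_right diff_eq_eq)
  ultimately have dvA: "div_endo A = (1/2) *\<^sub>R grad scalar + Ric *v W"
    by simp
  have "divergence (H *v div_endo A) = 0"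
    unfolding raise_div_endo_skew[OF A_anti] by (rule divergence_antisym[OF A_anti])
  then have "(1/2) *\<^sub>R divergence (H *v grad scalar) + divergence (ric_endo *v W) = 0"
    unfolding dvA by (simp add: matrix_vector_right_distrib matrix_vector_scaleR divergence_add
        divergence_scaleR ric_endo matrix_vector_mul_assoc)
  moreover have "trace (ric_endo ** A) = 0"
  proof -
    have "trace (ric_endo ** A) = trace (Ric ** (A ** H))"
      by (metis ric_endo trace_mul_sym matrix_mul_assoc)
    also have "\<dots> = (\<Sum>i\<in>UNIV. \<Sum>j\<in>UNIV. Ric $ i $ j * (A ** H) $ j $ i)"
      unfolding trace_def matrix_mult_nth[of Ric] ..
    also have "\<dots> = 0"
    proof (rule sum_sym_antisym_zero)
      show "Ric $ i $ j = Ric $ j $ i" for i j using Ric_sym by (metis transpose_nth)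
      show "(A ** H) $ j $ i = - (A ** H) $ i $ j" for i j
        using A_anti by (metis transpose_nth vector_uminus_component)
    qed
    finally show ?thesis .
  qed
  moreover have "divergence (ric_endo *v W) = (1/2) *\<^sub>R (\<Sum>l\<in>UNIV. D l scalar * W $ l) + trace (ric_endo ** ?M)"
    unfolding divergence_mult dvRm by (simp add: scaleR_sum_right)
  moreover have "ric_endo ** ?M = ric_endo ** (ric_endo - c *\<^sub>R mat 1) + ric_endo ** A"
    by (subst M) (rule matrix_add_ldistrib)
  ultimately have "(1/2) *\<^sub>R divergence (H *v grad scalar) + ((1/2) *\<^sub>R (\<Sum>l\<in>UNIV. D l scalar * W $ l)
    + trace (ric_endo ** (ric_endo - c *\<^sub>R mat 1))) = 0"
    by (simp add: trace_add)
  then have "2 *\<^sub>R ((1/2) *\<^sub>R divergence (H *v grad scalar) + ((1/2) *\<^sub>R (\<Sum>l\<in>UNIV. D l scalar * W $ l)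
    + trace (ric_endo ** (ric_endo - c *\<^sub>R mat 1)))) = 0" by simp
  then show ?thesis by (simp add: scaleR_add_right add.assoc)
qed

text \<open>As \<open>\<nabla>W\<close> is skew-adjoint, \<open>\<nabla>W W\<close> is minus half the
  gradient of \<open>\<bar>W\<bar>\<^sup>2\<close>. Its divergence is \<open>c
  \<bar>W\<bar>\<^sup>2 + tr (\<nabla>W \<nabla>W)\<close> by the Leibniz rule and the Ricci
  identity.\<close>
lemma killing_laplacian:
  assumes ric: "Ric = c *\<^sub>R G" and kil: "G ** nabla W + transpose (G ** nabla W) = 0"
  defines "f \<equiv> \<Sum>i\<in>UNIV. W $ i * (G *v W) $ i"
  shows "divergence (H *v grad f) + (2 * c) *\<^sub>R f + 2 *\<^sub>R trace (nabla W ** nabla W) = 0"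
proof -
  let ?M = "nabla W"
  have MT: "transpose ?M ** G = - (G ** ?M)"
    using kil by (simp add: matrix_transpose_mul G_sym eq_neg_iff_add_eq_0 add.commute)
  have tr0: "trace ?M = 0"
  proof (rule eq_neg_self_zero)
    have "trace ?M = trace (transpose ?M ** (G ** H))" by (simp add: GH trace_transpose)
    also have "\<dots> = - trace (G ** ?M ** H)"
      by (simp add: matrix_mul_assoc MT matrix_neg_left trace_neg)
    also have "trace (G ** ?M ** H) = trace ?M"
      by (metis trace_mul_sym matrix_mul_assoc HG matrix_mul_lid)
    finally show "trace ?M = - trace ?M" .
  qed
  have ip: "(\<Sum>i\<in>UNIV. x $ i * (G *v y) $ i) = (\<Sum>i\<in>UNIV. y $ i * (G *v x) $ i)" for x y :: "'a^'n"
    unfolding matrix_vector_mult_nth sum_distrib_left by (subst sum.swap) (simp add: mult_ac G_nth_sym)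
  have Df: "grad f = - 2 *\<^sub>R (G *v (?M *v W))"
  proof -
    { fix l
      define N where "N = vderiv l W + \<Gamma> l *v W"
      have N: "N $ k = ?M $ k $ l" for k by (simp add: N_def nabla_def)
      have "D l f = (\<Sum>i\<in>UNIV. D l (W $ i) * (G *v W) $ i) + (\<Sum>i\<in>UNIV. W $ i * vderiv l (G *v W) $ i)"
        by (simp add: f_def D_sum D_mult sum.distrib)
      also have "vderiv l (G *v W) = transpose (\<Gamma> l) *v (G *v W) + G *v N"
        by (simp add: vderiv_mult compat N_def matrix_vector_mult_add_rdistrib
            matrix_vector_mul_assoc matrix_vector_right_distrib add.assoc)
      also have "(\<Sum>i\<in>UNIV. W $ i * (transpose (\<Gamma> l) *v (G *v W) + G *v N) $ i)
        = (\<Sum>i\<in>UNIV. W $ i * (transpose (\<Gamma> l) *v (G *v W)) $ i) + (\<Sum>i\<in>UNIV. N $ i * (G *v W) $ i)"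
        by (simp only: vector_add_component distrib_left sum.distrib ip[of W N])
      also have "(\<Sum>i\<in>UNIV. W $ i * (transpose (\<Gamma> l) *v (G *v W)) $ i)
          = (\<Sum>i\<in>UNIV. (\<Gamma> l *v W) $ i * (G *v W) $ i)"
        unfolding matrix_vector_mult_nth[of "transpose _"] matrix_vector_mult_nth[of "\<Gamma> l"] transpose_nth sum_distrib_left sum_distrib_right
        by (subst sum.swap) (simp add: mult_ac)
      finally have "D l f = 2 *\<^sub>R (\<Sum>i\<in>UNIV. N $ i * (G *v W) $ i)"
        by (simp add: scaleR_2 N_def distrib_right sum.distrib add_ac)
      also have "(\<Sum>i\<in>UNIV. N $ i * (G *v W) $ i) = (transpose ?M *v (G *v W)) $ l"
        by (simp only: matrix_vector_mult_nth[of "transpose _"] transpose_nth N)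
      also have "\<dots> = (- (G *v (?M *v W))) $ l"
        by (simp only: matrix_vector_mul_assoc MT) (simp add: matrix_vector_mult_nth sum_negf)
      finally have "D l f = (- 2 *\<^sub>R (G *v (?M *v W))) $ l" by simp
    }
    then show ?thesis by (simp add: vec_eq_iff)
  qed
  have "divergence (H *v grad f) = - 2 *\<^sub>R divergence (?M *v W)"
    unfolding Df
    by (simp only: matrix_vector_scaleR divergence_scaleR matrix_vector_mul_assoc HG matrix_vector_mul_lid
        matrix_mul_assoc matrix_mul_lid)
  also have "divergence (?M *v W) = c *\<^sub>R f + trace (?M ** ?M)"
  proof -
    have "div_endo ?M $ l = c *\<^sub>R (G *v W) $ l" for l
      unfolding ricci_commutator tr0 ric by (simp add: matrix_vector_mult_nth scaleR_sum_right)
    then show ?thesis unfolding divergence_mult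
      by (simp add: f_def scaleR_sum_right mult.commute)
  qed
  finally show ?thesis by (simp add: algebra_simps)
qed

end

section \<open>Germs of smooth functions\<close>

text \<open>Partial equivalence: the functions related to themselves are those that are smooth near
  \<open>0\<close>.\<close>
definition germ_rel :: "(real^'n \<Rightarrow> real) \<Rightarrow> (real^'n \<Rightarrow> real) \<Rightarrow> bool" where
  "germ_rel f g \<longleftrightarrow> (\<exists>S. open S \<and> 0 \<in> S \<and> smooth_on S f \<and> smooth_on S g \<and> (\<forall>x\<in>S. f x = g x))"

lemma germ_rel_binary:
  fixes f g :: "real^'n \<Rightarrow> real"
  assumes "germ_rel f f'" "germ_rel g g'"
    and "\<And>S f g. open (S :: (real^'n) set) \<Longrightarrow> smooth_on S f \<Longrightarrow> smooth_on S g \<Longrightarrow> smooth_on S (\<lambda>x. h (f x) (g x))"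
  shows "germ_rel (\<lambda>x. h (f x) (g x)) (\<lambda>x. h (f' x) (g' x))"
proof -
  obtain S T where S: "open S" "0 \<in> S" "smooth_on S f" "smooth_on S f'" "\<forall>x\<in>S. f x = f' x"
    and T: "open T" "0 \<in> T" "smooth_on T g" "smooth_on T g'" "\<forall>x\<in>T. g x = g' x"
    using assms(1,2) unfolding germ_rel_def by blast
  have "smooth_on (S \<inter> T) f" "smooth_on (S \<inter> T) f'" "smooth_on (S \<inter> T) g" "smooth_on (S \<inter> T) g'"
    using S T by (auto intro: smooth_on_subset[of S] smooth_on_subset[of T])
  moreover have o: "open (S \<inter> T)" using S T by auto
  ultimately show ?thesis
    unfolding germ_rel_def using S T assms(3)[OF o, of f g] assms(3)[OF o, of f' g']
    by (intro exI[of _ "S \<inter> T"]) auto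
qed

lemma germ_rel_sym: "germ_rel f g \<Longrightarrow> germ_rel g f"
  unfolding germ_rel_def by metis

lemma germ_rel_trans: "germ_rel f g \<Longrightarrow> germ_rel g h \<Longrightarrow> germ_rel f h"
proof -
  assume "germ_rel f g" "germ_rel g h"
  then obtain S T where S: "open S" "0 \<in> S" "smooth_on S f" "\<forall>x\<in>S. f x = g x"
    and T: "open T" "0 \<in> T" "smooth_on T h" "\<forall>x\<in>T. g x = h x"
    unfolding germ_rel_def by blast
  have "smooth_on (S \<inter> T) f" "smooth_on (S \<inter> T) h"
    using S T by (auto intro: smooth_on_subset[of S] smooth_on_subset[of T])
  then show ?thesis unfolding germ_rel_def using S T by (intro exI[of _ "S \<inter> T"]) auto
qed

lemma germ_rel_const: "germ_rel (\<lambda>x. c) (\<lambda>x. c)"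
  unfolding germ_rel_def by (intro exI[of _ UNIV]) (simp add: smooth_on_const)

text \<open>Germs at the origin suffice; a germ at another point is obtained by translation, see
  \<open>germ_at\<close>.\<close>
quotient_type (overloaded) 'n germ = "real^'n::finite \<Rightarrow> real" / partial: germ_rel
proof (rule part_equivpI)
  show "\<exists>x. germ_rel x x" using germ_rel_const by blast
  show "symp germ_rel" by (rule sympI) (rule germ_rel_sym)
  show "transp germ_rel" by (rule transpI) (rule germ_rel_trans)
qed

instantiation germ :: (finite) "{comm_ring_1,real_algebra_1}"
begin
lift_definition zero_germ :: "'a germ" is "\<lambda>x. 0" by (rule germ_rel_const)
lift_definition one_germ :: "'a germ" is "\<lambda>x. 1" by (rule germ_rel_const)
lift_definition plus_germ :: "'a germ \<Rightarrow> 'a germ \<Rightarrow> 'a germ" is "\<lambda>f g x. f x + g x"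
  by (rule germ_rel_binary[where h = "(+)"]) (auto intro: smooth_on_add)
lift_definition times_germ :: "'a germ \<Rightarrow> 'a germ \<Rightarrow> 'a germ" is "\<lambda>f g x. f x * g x"
  by (rule germ_rel_binary[where h = "(*)"]) (auto intro: smooth_on_mult)
lift_definition uminus_germ :: "'a germ \<Rightarrow> 'a germ" is "\<lambda>f x. - f x"
  by (rule germ_rel_binary[where h = "\<lambda>a b. - a"]) (auto intro: smooth_on_minus)
lift_definition minus_germ :: "'a germ \<Rightarrow> 'a germ \<Rightarrow> 'a germ" is "\<lambda>f g x. f x - g x"
  by (rule germ_rel_binary[where h = "\<lambda>a b. a - b"])
    (auto intro: smooth_on_add[of _ _ "\<lambda>x. - _ x", simplified] smooth_on_minus)
lift_definition scaleR_germ :: "real \<Rightarrow> 'a germ \<Rightarrow> 'a germ" is "\<lambda>c f x. c * f x"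
  by (rule germ_rel_binary[where h = "\<lambda>a b. _ * a"]) (auto intro: smooth_on_mult smooth_on_const)

instance
proof
  fix a b c :: "'a germ" and r s :: real
  have P: "germ_rel f f \<Longrightarrow> germ_rel g g \<Longrightarrow> germ_rel (\<lambda>x. f x + g x) (\<lambda>x. f x + g x)"
    "germ_rel f f \<Longrightarrow> germ_rel g g \<Longrightarrow> germ_rel (\<lambda>x. f x * g x) (\<lambda>x. f x * g x)"
    "germ_rel f f \<Longrightarrow> germ_rel (\<lambda>x. r * f x) (\<lambda>x. r * f x)"
    "germ_rel f f \<Longrightarrow> germ_rel g g \<Longrightarrow> germ_rel (\<lambda>x. f x - g x) (\<lambda>x. f x - g x)" for f g :: "real^'a \<Rightarrow> real" and r
    using plus_germ.rsp times_germ.rsp scaleR_germ.rsp minus_germ.rsp by (auto simp: rel_fun_def)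
  show "a + b + c = a + (b + c)" by transfer (simp add: add.assoc P)
  show "a + b = b + a" by transfer (simp add: add.commute P)
  show "0 + a = a" by transfer simp
  show "- a + a = 0" by transfer (simp add: germ_rel_const)
  show "a - b = a + - b" by transfer (simp add: P)
  show "a * b * c = a * (b * c)" by transfer (simp add: mult.assoc P)
  show "a * b = b * a" by transfer (simp add: mult.commute P)
  show "1 * a = a" by transfer simp
  show "a * 1 = a" by transfer simp
  show "a * (b + c) = a * b + a * c" by transfer (simp add: distrib_left P)
  show "(a + b) * c = a * c + b * c" by transfer (simp add: distrib_right P)
  show "r *\<^sub>R (a + b) = r *\<^sub>R a + r *\<^sub>R b" by transfer (simp add: distrib_left P)
  show "(r + s) *\<^sub>R a = r *\<^sub>R a + s *\<^sub>R a" by transfer (simp add: distrib_right P)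
  show "r *\<^sub>R s *\<^sub>R a = (r * s) *\<^sub>R a" by transfer (simp add: mult.assoc P)
  show "1 *\<^sub>R a = a" by transfer simp
  show "r *\<^sub>R a * b = r *\<^sub>R (a * b)" by transfer (simp add: mult.assoc P)
  show "a * r *\<^sub>R b = r *\<^sub>R (a * b)" by transfer (simp add: mult.left_commute P)
  show "(0::'a germ) \<noteq> 1" by transfer (auto simp: germ_rel_def)
qed
end

lift_definition germ_pd :: "'n::finite \<Rightarrow> 'n germ \<Rightarrow> 'n germ" is "\<lambda>i f. pd i f"
  unfolding germ_rel_def using smooth_on_pd pd_cong by metis

lift_definition germ_val :: "'n::finite germ \<Rightarrow> real" is "\<lambda>f. f 0"
  by (auto simp: germ_rel_def)

lemma germ_val_hom [simp]: "germ_val 0 = 0" "germ_val 1 = 1" "germ_val (a + b) = germ_val a + germ_val b"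
  "germ_val (a - b) = germ_val a - germ_val b" "germ_val (- a) = - germ_val a"
  "germ_val (a * b) = germ_val a * germ_val b" "germ_val (c *\<^sub>R a) = c * germ_val a"
  by (transfer, simp)+

lemma germ_val_sum: "germ_val (sum f I) = (\<Sum>i\<in>I. germ_val (f i))"
  by (induction I rule: infinite_finite_induct) auto

lemma germ_relI: "open S \<Longrightarrow> 0 \<in> S \<Longrightarrow> smooth_on S f \<Longrightarrow> (\<And>x. x \<in> S \<Longrightarrow> f x = g x) \<Longrightarrow> germ_rel f g"
  unfolding germ_rel_def using smooth_on_cong by metis

lemma germ_rel_pairE:
  assumes "germ_rel f f" "germ_rel g g"
  obtains S where "open S" "0 \<in> S" "smooth_on S f" "smooth_on S g"
proof -
  obtain S T where S: "open S" "0 \<in> S" "smooth_on S f"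
    and T: "open T" "0 \<in> T" "smooth_on T g"
    using assms unfolding germ_rel_def by blast
  then show thesis using that[of "S \<inter> T"] smooth_on_subset[of S "S \<inter> T"] smooth_on_subset[of T "S \<inter> T"]
    by auto
qed

interpretation germ: diff_ring "germ_pd :: 'n::finite \<Rightarrow> 'n germ \<Rightarrow> 'n germ"
proof
  fix i j :: 'n and a b :: "'n germ" and c :: real
  show "germ_pd i (a + b) = germ_pd i a + germ_pd i b"
  proof transfer
    fix i :: 'n and f g :: "real^'n \<Rightarrow> real" assume "germ_rel f f" "germ_rel g g"
    then obtain S where S: "open S" "0 \<in> S" "smooth_on S f" "smooth_on S g" by (rule germ_rel_pairE)
    show "germ_rel (pd i (\<lambda>x. f x + g x)) (\<lambda>x. pd i f x + pd i g x)"
      by (rule germ_relI[of S]) (use S pd_add[of f S g _ i] in \<open>auto intro!: smooth_on_pd smooth_on_add smooth_on_differentiable\<close>)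
  qed
  show "germ_pd i (a * b) = germ_pd i a * b + a * germ_pd i b"
  proof transfer
    fix i :: 'n and f g :: "real^'n \<Rightarrow> real" assume "germ_rel f f" "germ_rel g g"
    then obtain S where S: "open S" "0 \<in> S" "smooth_on S f" "smooth_on S g" by (rule germ_rel_pairE)
    show "germ_rel (pd i (\<lambda>x. f x * g x)) (\<lambda>x. pd i f x * g x + f x * pd i g x)"
      by (rule germ_relI[of S]) (use S pd_mult[of f S g _ i] in \<open>auto intro!: smooth_on_pd smooth_on_mult smooth_on_differentiable\<close>)
  qed
  show "germ_pd i (c *\<^sub>R a) = c *\<^sub>R germ_pd i a"
  proof transfer
    fix i :: 'n and f :: "real^'n \<Rightarrow> real" and c assume "germ_rel f f"
    then obtain S where S: "open S" "0 \<in> S" "smooth_on S f" unfolding germ_rel_def by blast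
    show "germ_rel (pd i (\<lambda>x. c * f x)) (\<lambda>x. c * pd i f x)"
      by (rule germ_relI[of S]) (use S pd_linear[OF bounded_linear_mult_right, of f S _ i c] in \<open>auto intro!: smooth_on_pd smooth_on_mult smooth_on_const smooth_on_differentiable\<close>)
  qed
  show "germ_pd i (germ_pd j a) = germ_pd j (germ_pd i a)"
  proof transfer
    fix i j :: 'n and f :: "real^'n \<Rightarrow> real" assume "germ_rel f f"
    then obtain S where S: "open S" "0 \<in> S" "smooth_on S f" unfolding germ_rel_def by blast
    show "germ_rel (pd i (pd j f)) (pd j (pd i f))"
    proof (rule germ_relI[OF S(1,2)])
      show "smooth_on S (pd i (pd j f))" using S(3) by (intro smooth_on_pd)
      show "pd i (pd j f) x = pd j (pd i f) x" if "x \<in> S" for x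
        using S(3) by (intro pd_commute[OF _ S(1) that]) (simp add: smooth_on_def)
    qed
  qed
qed

definition germ_at :: "real^'n::finite \<Rightarrow> (real^'n \<Rightarrow> real) \<Rightarrow> 'n germ" where
  "germ_at x f = abs_germ (\<lambda>y. f (x + y))"

text \<open>Translation is an isometry, so difference quotients are literally the same; this makes
  \<open>pd\<close> commute with translations even where the function is not differentiable.\<close>
lemma has_derivative_shift:
  "((\<lambda>y. f (x + y)) has_derivative f') (at y) \<longleftrightarrow> (f has_derivative f') (at (x + y))"
proof
  assume "(f has_derivative f') (at (x + y))"
  moreover have "((\<lambda>y. x + y) has_derivative (\<lambda>h. h)) (at y)"
    by (auto intro!: derivative_eq_intros)
  ultimately show "((\<lambda>y. f (x + y)) has_derivative f') (at y)"
    using diff_chain_at[of "\<lambda>y. x + y" "\<lambda>h. h" y f f'] by (simp add: o_def)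
next
  assume "((\<lambda>y. f (x + y)) has_derivative f') (at y)"
  then have "((\<lambda>y. f (x + y)) has_derivative f') (at ((x + y) - x))" by simp
  moreover have "((\<lambda>y. y - x) has_derivative (\<lambda>h. h)) (at (x + y))"
    by (auto intro!: derivative_eq_intros)
  ultimately have "((\<lambda>y. f (x + y)) \<circ> (\<lambda>y. y - x) has_derivative f' \<circ> (\<lambda>h. h)) (at (x + y))"
    by (intro diff_chain_at)
  then show "(f has_derivative f') (at (x + y))" by (simp add: o_def)
qed

lemma pd_shift: "pd i (\<lambda>y. f (x + y)) y = pd i f (x + y)"
  unfolding pd_def frechet_derivative_def has_derivative_shift ..

lemma smooth_on_shift:
  fixes f :: "real^'n::finite \<Rightarrow> real"
  assumes "open S" "smooth_on S f" shows "smooth_on ((\<lambda>y. y - x) ` S) (\<lambda>y. f (x + y))"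
proof -
  have "Ck_on k S f \<Longrightarrow> Ck_on k ((\<lambda>y. y - x) ` S) (\<lambda>y. f (x + y))" for k
  proof (induction k arbitrary: f)
    case 0
    then have "continuous_on S f" by simp
    then have "continuous_on ((\<lambda>y. y - x) ` S) (\<lambda>y. f (x + y))"
      by (rule continuous_on_compose2) (auto intro!: continuous_intros)
    then show ?case by simp
  next
    case (Suc k)
    have "pd i (\<lambda>y. f (x + y)) = (\<lambda>y. pd i f (x + y))" for i by (rule ext) (rule pd_shift)
    moreover have "(\<lambda>y. f (x + y)) differentiable_on ((\<lambda>y. y - x) ` S)"
      unfolding differentiable_on_def
    proof
      fix y assume "y \<in> (\<lambda>y. y - x) ` S"
      then have "x + y \<in> S" by auto
      moreover have "f differentiable_on S" using Suc.prems by simp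
      ultimately have "(f has_derivative frechet_derivative f (at (x + y))) (at (x + y))"
        using differentiable_on_has_derivative assms(1) by blast
      then show "(\<lambda>y. f (x + y)) differentiable at y within (\<lambda>y. y - x) ` S"
        unfolding has_derivative_shift[symmetric] differentiable_def
        using has_derivative_at_withinI by blast
    qed
    ultimately show ?case using Suc by simp
  qed
  then show ?thesis using assms by (simp add: smooth_on_def)
qed

lemma germ_rel_at:
  assumes "open S" "x \<in> S" "smooth_on S f"
  shows "germ_rel (\<lambda>y. f (x + y)) (\<lambda>y. f (x + y))"
  by (rule germ_relI[OF _ _ smooth_on_shift[OF assms(1,3), of x]])
    (use assms open_translation_subtract in auto)

lemma germ_at_pd:
  assumes "open S" "x \<in> S" "smooth_on S f"
  shows "germ_pd i (germ_at x f) = germ_at x (pd i f)"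
proof -
  have "germ_pd i (abs_germ (\<lambda>y. f (x + y))) = abs_germ (pd i (\<lambda>y. f (x + y)))"
    by (rule germ_pd.abs_eq) (use germ_rel_at[OF assms] in \<open>simp add: eq_onp_def\<close>)
  also have "pd i (\<lambda>y. f (x + y)) = (\<lambda>y. pd i f (x + y))" by (rule ext) (rule pd_shift)
  finally show ?thesis by (simp add: germ_at_def)
qed

lemma germ_at_val: "open S \<Longrightarrow> x \<in> S \<Longrightarrow> smooth_on S f \<Longrightarrow> germ_val (germ_at x f) = f x"
  unfolding germ_at_def by (subst germ_val.abs_eq) (simp_all add: eq_onp_def germ_rel_at)

lemma germ_at_add:
  "open S \<Longrightarrow> x \<in> S \<Longrightarrow> smooth_on S f \<Longrightarrow> smooth_on S g \<Longrightarrow>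
    germ_at x (\<lambda>y. f y + g y) = germ_at x f + germ_at x g"
  unfolding germ_at_def by (subst plus_germ.abs_eq) (simp_all add: eq_onp_def germ_rel_at)
lemma germ_at_mult:
  "open S \<Longrightarrow> x \<in> S \<Longrightarrow> smooth_on S f \<Longrightarrow> smooth_on S g \<Longrightarrow>
    germ_at x (\<lambda>y. f y * g y) = germ_at x f * germ_at x g"
  unfolding germ_at_def by (subst times_germ.abs_eq) (simp_all add: eq_onp_def germ_rel_at)
lemma germ_at_diff:
  "open S \<Longrightarrow> x \<in> S \<Longrightarrow> smooth_on S f \<Longrightarrow> smooth_on S g \<Longrightarrow>
    germ_at x (\<lambda>y. f y - g y) = germ_at x f - germ_at x g"
  unfolding germ_at_def by (subst minus_germ.abs_eq) (simp_all add: eq_onp_def germ_rel_at)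
lemma germ_at_scale:
  "open S \<Longrightarrow> x \<in> S \<Longrightarrow> smooth_on S f \<Longrightarrow> germ_at x (\<lambda>y. c * f y) = c *\<^sub>R germ_at x f"
  unfolding germ_at_def by (subst scaleR_germ.abs_eq) (simp_all add: eq_onp_def germ_rel_at)
lemma germ_at_sum:
  assumes "open S" "x \<in> S" "\<And>i. i \<in> I \<Longrightarrow> smooth_on S (f i)"
  shows "germ_at x (\<lambda>y. \<Sum>i\<in>I. f i y) = (\<Sum>i\<in>I. germ_at x (f i))"
proof -
  have z: "germ_at x (\<lambda>y. 0) = 0" by (simp add: germ_at_def zero_germ.abs_eq)
  show ?thesis using assms(3)
    by (induction I rule: infinite_finite_induct)
      (simp_all add: z germ_at_add[OF assms(1,2)] smooth_on_sum assms(1))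
qed
lemma germ_at_cong:
  assumes "open S" "x \<in> S" "smooth_on S f" "\<And>y. y \<in> S \<Longrightarrow> f y = g y"
  shows "germ_at x f = germ_at x g"
  unfolding germ_at_def
proof (rule Quotient_rel_abs[OF Quotient_germ])
  show "germ_rel (\<lambda>y. f (x + y)) (\<lambda>y. g (x + y))"
    by (rule germ_relI[OF _ _ smooth_on_shift[OF assms(1,3), of x]])
      (use assms open_translation_subtract in auto)
qed

section \<open>Metrics on open subsets of Euclidean space\<close>

lemma smooth_on_diff:
  "open S \<Longrightarrow> smooth_on S f \<Longrightarrow> smooth_on S g \<Longrightarrow> smooth_on S (\<lambda>x. f x - g x)"
  using smooth_on_add[of S f "\<lambda>x. - g x"] smooth_on_minus[of S g] by simp

lemma smooth_on_det:
  fixes A :: "real^'m::finite \<Rightarrow> real^'n^'n"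
  assumes "open S" "\<And>i j. smooth_on S (\<lambda>x. A x $ i $ j)"
  shows "smooth_on S (\<lambda>x. det (A x))"
  unfolding det_def using assms
  by (intro smooth_on_sum smooth_on_mult smooth_on_prod smooth_on_const)

lemma matrix_inv_right: "invertible (A :: real^'n^'n) \<Longrightarrow> A ** matrix_inv A = mat 1"
  and matrix_inv_left: "invertible (A :: real^'n^'n) \<Longrightarrow> matrix_inv A ** A = mat 1"
  unfolding invertible_def matrix_inv_def by (rule someI2_ex; simp)+

text \<open>Cramer's rule shows that the entries of the inverse are rational functions of those of
  \<open>A\<close>, hence smooth functions of a point if \<open>A\<close> is.\<close>
lemma matrix_inv_cramer:
  fixes A :: "real^'n^'n"
  assumes "invertible A"
  shows "matrix_inv A $ k $ l = det (\<chi> i j. if j = k then axis l 1 $ i else A $ i $ j) / det A"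
proof -
  have "A *v (matrix_inv A *v axis l 1) = axis l 1"
    by (simp add: matrix_vector_mul_assoc matrix_inv_right[OF assms])
  then have "matrix_inv A *v axis l 1 = (\<chi> k. det (\<chi> i j. if j = k then axis l 1 $ i else A $ i $ j) / det A)"
    using cramer[of A] assms by (simp add: invertible_det_nz)
  then have "(matrix_inv A *v axis l 1) $ k = det (\<chi> i j. if j = k then axis l 1 $ i else A $ i $ j) / det A"
    by simp
  moreover have "(matrix_inv A *v axis l 1) $ k = matrix_inv A $ k $ l"
    by (simp add: matrix_vector_mult_def axis_def if_distrib cong: if_cong)
  ultimately show ?thesis by simp
qed

lemma posdef_invertible:
  fixes A :: "real^'n^'n"
  assumes "\<And>v. v \<noteq> 0 \<Longrightarrow> v \<bullet> (A *v v) > 0"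
  shows "invertible A"
proof -
  have "inj ((*v) A)"
  proof (rule injI)
    fix x y assume "A *v x = A *v y"
    then have "(x - y) \<bullet> (A *v (x - y)) = 0" by (simp add: matrix_vector_mult_diff_distrib)
    then show "x = y" using assms[of "x - y"] by fastforce
  qed
  then show ?thesis by (simp add: invertible_left_inverse matrix_left_invertible_injective)
qed

text \<open>Lowering an index commutes with covariant differentiation, since \<open>G\<close> is parallel.\<close>
lemma (in metric_ring) nabla_lower:
  assumes "w = G *v W"
  shows "(G ** nabla W) $ j $ i = D i (w $ j) - (\<Sum>k\<in>UNIV. \<Gamma> i $ k $ j * w $ k)"
proof -
  define N where "N = vderiv i W + \<Gamma> i *v W"
  have N: "N $ k = nabla W $ k $ i" for k by (simp add: N_def nabla_def)
  have "vderiv i w - transpose (\<Gamma> i) *v w = G *v N"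
    by (simp add: assms vderiv_mult compat N_def matrix_vector_mult_add_rdistrib
            matrix_vector_mul_assoc matrix_vector_right_distrib)
  then have "(G *v N) $ j = D i (w $ j) - (transpose (\<Gamma> i) *v w) $ j"
    by (metis vderiv_nth vector_minus_component)
  then show ?thesis unfolding matrix_vector_mult_nth matrix_mult_nth transpose_nth N .
qed

lemma (in metric_ring) scalar_contract: "scalar = (\<Sum>i\<in>UNIV. \<Sum>j\<in>UNIV. H $ i $ j * Ric $ i $ j)"
  by (simp add: scalar_def ric_endo_Ric trace_transpose, simp add: trace_def matrix_mult_nth H_nth_sym mult.commute)

definition sqnorm :: "(real^'n::finite \<Rightarrow> real^'n^'n) \<Rightarrow> (real^'n \<Rightarrow> real^'n) \<Rightarrow> real^'n \<Rightarrow> real" where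
  "sqnorm G w y = (\<Sum>i\<in>UNIV. \<Sum>j\<in>UNIV. matrix_inv (G y) $ i $ j * w y $ i * w y $ j)"

locale local_metric =
  fixes U :: "(real^'n::finite) set" and G :: "real^'n \<Rightarrow> real^'n^'n"
  assumes U: "open U" and smooth: "smooth_on U G"
    and sym: "x \<in> U \<Longrightarrow> transpose (G x) = G x"
    and pos: "x \<in> U \<Longrightarrow> v \<noteq> 0 \<Longrightarrow> v \<bullet> (G x *v v) > 0"
begin

lemma inv: "x \<in> U \<Longrightarrow> invertible (G x)" using posdef_invertible pos by blast

lemma smooth_G: "smooth_on U (\<lambda>x. G x $ i $ j)"
  using smooth U by (intro smooth_on_nth)

lemma smooth_H: "smooth_on U (\<lambda>x. matrix_inv (G x) $ k $ l)"
proof -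
  have nz: "det (G x) \<noteq> 0" if "x \<in> U" for x using inv[OF that] by (simp add: invertible_det_nz)
  have "smooth_on U (\<lambda>x. det (\<chi> i j. if j = k then axis l 1 $ i else G x $ i $ j) * inverse (det (G x)))"
  proof (intro smooth_on_mult smooth_on_inverse smooth_on_det U smooth_G nz)
    fix i j
    show "smooth_on U (\<lambda>x. (\<chi> i j. if j = k then axis l 1 $ i else G x $ i $ j) $ i $ j)"
      by (cases "j = k") (simp_all add: smooth_on_const smooth_G)
  qed
  then show ?thesis
    by (rule smooth_on_cong[OF U, rotated]) (simp add: matrix_inv_cramer[OF inv] divide_inverse)
qed

lemma smooth_christoffel: "smooth_on U (christoffel G k i j)"
  unfolding christoffel_def[abs_def]
  by (intro smooth_on_mult smooth_on_sum smooth_on_add smooth_on_diff smooth_on_const smooth_on_pd U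
      smooth_G smooth_H)

lemma smooth_riemann: "smooth_on U (riemann G l k i j)"
  unfolding riemann_def[abs_def]
  by (intro smooth_on_mult smooth_on_sum smooth_on_add smooth_on_diff smooth_on_const smooth_on_pd U
      smooth_christoffel)

lemma smooth_ricci: "smooth_on U (\<lambda>x. ricci G x $ j $ k)"
  unfolding ricci_def by simp (intro smooth_on_sum U smooth_riemann)

lemma smooth_scal: "smooth_on U (scal G)"
  unfolding scal_def[abs_def]
  by (intro smooth_on_sum smooth_on_mult U smooth_H smooth_ricci)

definition germG :: "real^'n \<Rightarrow> 'n germ^'n^'n" where
  "germG x = (\<chi> i j. germ_at x (\<lambda>y. G y $ i $ j))"
definition germH :: "real^'n \<Rightarrow> 'n germ^'n^'n" where
  "germH x = (\<chi> i j. germ_at x (\<lambda>y. matrix_inv (G y) $ i $ j))"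
definition germC :: "real^'n \<Rightarrow> 'n \<Rightarrow> 'n germ^'n^'n" where
  "germC x i = (\<chi> k j. germ_at x (christoffel G k i j))"

text \<open>The Christoffel symbols of the first kind.\<close>
lemma lower_christoffel:
  assumes "x \<in> U"
  shows "(\<Sum>k\<in>UNIV. G x $ m $ k * christoffel G k i j x)
    = (1/2) * (pd i (\<lambda>y. G y $ j $ m) x + pd j (\<lambda>y. G y $ i $ m) x - pd m (\<lambda>y. G y $ i $ j) x)"
proof -
  define q where "q l = pd i (\<lambda>y. G y $ j $ l) x + pd j (\<lambda>y. G y $ i $ l) x - pd l (\<lambda>y. G y $ i $ j) x" for l
  have "(\<Sum>k\<in>UNIV. G x $ m $ k * christoffel G k i j x)
    = (1/2) * (\<Sum>l\<in>UNIV. (G x ** matrix_inv (G x)) $ m $ l * q l)"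
    unfolding christoffel_def q_def[symmetric] matrix_mult_nth sum_distrib_left sum_distrib_right
    by (subst sum.swap) (simp add: mult_ac)
  also have "\<dots> = (1/2) * q m"
    by (simp add: matrix_inv_right[OF inv[OF assms]] mat_def if_distrib[of "\<lambda>c. c * _"] cong: if_cong)
  finally show ?thesis by (simp add: q_def)
qed

lemma G_nth_sym: "x \<in> U \<Longrightarrow> G x $ i $ j = G x $ j $ i"
  using sym[of x] by (metis transpose_nth)

lemma pd_G_sym: "x \<in> U \<Longrightarrow> pd l (\<lambda>y. G y $ i $ j) x = pd l (\<lambda>y. G y $ j $ i) x"
  by (rule pd_cong[OF U]) (auto intro: G_nth_sym)

lemma christoffel_sym: "x \<in> U \<Longrightarrow> christoffel G k i j x = christoffel G k j i x"
  by (simp add: christoffel_def pd_G_sym[of x _ i j] add.commute)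

lemma pd_G_christoffel:
  assumes "x \<in> U"
  shows "pd i (\<lambda>y. G y $ j $ k) x =
    (\<Sum>m\<in>UNIV. christoffel G m i j x * G x $ m $ k) + (\<Sum>m\<in>UNIV. G x $ j $ m * christoffel G m i k x)"
proof -
  have "(\<Sum>m\<in>UNIV. christoffel G m i j x * G x $ m $ k) = (\<Sum>m\<in>UNIV. G x $ k $ m * christoffel G m i j x)"
    by (intro sum.cong refl) (simp add: G_nth_sym[OF assms] mult.commute)
  then show ?thesis
    unfolding lower_christoffel[OF assms]
    using pd_G_sym[OF assms, of j i k] pd_G_sym[OF assms, of k i j] pd_G_sym[OF assms, of i k j]
    by (simp add: field_simps)
qed

context
  fixes x assumes x: "x \<in> U"
begin

text \<open>At every point the germs of the metric, its inverse and its Christoffel symbols satisfy the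
  laws of \<open>metric_ring\<close>, so the abstract identities apply to them.\<close>
lemma metric_ring_germ: "metric_ring germ_pd (germG x) (germH x) (germC x)"
proof
  have mult: "germ_at x (\<lambda>y. \<Sum>k\<in>UNIV. a k y * b k y) = (\<Sum>k\<in>UNIV. germ_at x (a k) * germ_at x (b k))"
    if "\<And>k. smooth_on U (a k)" "\<And>k. smooth_on U (b k)" for a b :: "'n \<Rightarrow> real^'n \<Rightarrow> real"
    using that by (simp add: germ_at_sum[OF U x] germ_at_mult[OF U x] smooth_on_mult U)
  have one: "germ_at x (\<lambda>y. if P then 1 else 0) = (if P then 1 else 0)" for P
    by (simp add: germ_at_def zero_germ.abs_eq one_germ.abs_eq)
  show "transpose (germG x) = germG x"
    by (simp add: vec_eq_iff transpose_def germG_def) (intro allI germ_at_cong[OF U x smooth_G] G_nth_sym)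
  show "germH x ** germG x = mat 1"
  proof -
    have "germ_at x (\<lambda>y. \<Sum>k\<in>UNIV. matrix_inv (G y) $ i $ k * G y $ k $ j) = germ_at x (\<lambda>y. if i = j then 1 else 0)" for i j
    proof (rule germ_at_cong[OF U x])
      show "smooth_on U (\<lambda>y. \<Sum>k\<in>UNIV. matrix_inv (G y) $ i $ k * G y $ k $ j)"
        by (intro smooth_on_sum smooth_on_mult U smooth_G smooth_H)
      show "(\<Sum>k\<in>UNIV. matrix_inv (G y) $ i $ k * G y $ k $ j) = (if i = j then 1 else 0)" if "y \<in> U" for y
        unfolding matrix_mult_nth[symmetric] matrix_inv_left[OF inv[OF that]] by (simp add: mat_def)
    qed
    then show ?thesis
      by (simp add: vec_eq_iff matrix_mult_nth germG_def germH_def mult[symmetric] smooth_G smooth_H one)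
        (simp add: mat_def)
  qed
  show "germG x ** germH x = mat 1"
  proof -
    have "germ_at x (\<lambda>y. \<Sum>k\<in>UNIV. G y $ i $ k * matrix_inv (G y) $ k $ j) = germ_at x (\<lambda>y. if i = j then 1 else 0)" for i j
    proof (rule germ_at_cong[OF U x])
      show "smooth_on U (\<lambda>y. \<Sum>k\<in>UNIV. G y $ i $ k * matrix_inv (G y) $ k $ j)"
        by (intro smooth_on_sum smooth_on_mult U smooth_G smooth_H)
      show "(\<Sum>k\<in>UNIV. G y $ i $ k * matrix_inv (G y) $ k $ j) = (if i = j then 1 else 0)" if "y \<in> U" for y
        unfolding matrix_mult_nth[symmetric] matrix_inv_right[OF inv[OF that]] by (simp add: mat_def)
    qed
    then show ?thesis
      by (simp add: vec_eq_iff matrix_mult_nth germG_def germH_def mult[symmetric] smooth_G smooth_H one)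
        (simp add: mat_def)
  qed
  show "germC x i $ k $ j = germC x j $ k $ i" for i j k
    by (simp add: germC_def) (intro germ_at_cong[OF U x smooth_christoffel] christoffel_sym)
  show "diff_ring.mderiv germ_pd i (germG x) = transpose (germC x i) ** germG x + germG x ** germC x i" for i
  proof -
    have "germ_pd i (germ_at x (\<lambda>y. G y $ j $ k)) = germ_at x (\<lambda>y. (\<Sum>m\<in>UNIV. christoffel G m i j y * G y $ m $ k) + (\<Sum>m\<in>UNIV. G y $ j $ m * christoffel G m i k y))" for j k
      unfolding germ_at_pd[OF U x smooth_G]
      by (rule germ_at_cong[OF U x smooth_on_pd[OF smooth_G] pd_G_christoffel])
    then show ?thesis
      by (simp add: vec_eq_iff matrix_mult_nth transpose_nth germG_def germC_def mult[symmetric] smooth_G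
          smooth_christoffel germ_at_add[OF U x] smooth_on_sum smooth_on_mult U)
  qed
qed

interpretation M: metric_ring germ_pd "germG x" "germH x" "germC x" by (rule metric_ring_germ)

lemma germ_riemann: "M.F i j $ l $ k = germ_at x (riemann G l k i j)"
  unfolding riemann_def[abs_def]
  by (simp add: M.F_def matrix_mult_nth germC_def germ_at_pd[OF U x smooth_christoffel]
      germ_at_add[OF U x] germ_at_diff[OF U x] germ_at_sum[OF U x] germ_at_mult[OF U x]
      smooth_on_mult smooth_on_sum smooth_on_add smooth_on_diff smooth_on_pd U smooth_christoffel sum_subtractf)

lemma germ_ricci: "M.Ric $ j $ k = germ_at x (\<lambda>y. ricci G y $ j $ k)"
  by (simp add: M.Ric_def ricci_def germ_riemann germ_at_sum[OF U x] smooth_riemann)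

lemma germ_scal: "M.scalar = germ_at x (scal G)"
  unfolding scal_def[abs_def] M.scalar_contract germ_ricci
  by (simp add: germH_def germ_at_sum[OF U x] germ_at_mult[OF U x]
      smooth_on_mult smooth_on_sum U smooth_H smooth_ricci)

text \<open>At a critical point the Laplacian is the trace of the matrix of second derivatives.\<close>
lemma germ_laplacian_value:
  assumes "\<And>j. germ_val (germ_pd j f) = 0"
  shows "germ_val (M.divergence (germH x *v germ.grad f)) =
    (\<Sum>i\<in>UNIV. \<Sum>j\<in>UNIV. matrix_inv (G x) $ i $ j * germ_val (germ_pd i (germ_pd j f)))"
  using assms
  by (simp add: M.divergence_def germ_val_sum M.matrix_vector_mult_nth germ.D_sum germ.D_mult germH_def germ_at_val[OF U x smooth_H])

definition valm :: "'n germ^'n^'n \<Rightarrow> real^'n^'n" where "valm A = (\<chi> i j. germ_val (A $ i $ j))"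

lemma valm_nth: "valm A $ i $ j = germ_val (A $ i $ j)" by (simp add: valm_def)
lemma valm_mult: "valm (A ** B) = valm A ** valm B"
  by (simp add: vec_eq_iff valm_nth matrix_mult_nth germ_val_sum)
lemma valm_diff: "valm (A - B) = valm A - valm B" by (simp add: vec_eq_iff valm_nth)
lemma valm_add: "valm (A + B) = valm A + valm B" by (simp add: vec_eq_iff valm_nth)
lemma valm_zero: "valm 0 = 0" by (simp add: vec_eq_iff valm_nth)
lemma valm_transpose: "valm (transpose A) = transpose (valm A)"
  by (simp add: vec_eq_iff valm_nth transpose_nth)
lemma valm_scalar: "valm (c *\<^sub>R mat 1) = c *\<^sub>R mat 1" by (simp add: vec_eq_iff valm_nth mat_def)
lemma val_trace: "germ_val (trace A) = trace (valm A)"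
  by (simp add: trace_def germ_val_sum valm_nth)
lemma valm_G: "valm (germG x) = G x"
  by (simp add: vec_eq_iff valm_nth germG_def germ_at_val[OF U x smooth_G])
lemma valm_H: "valm (germH x) = matrix_inv (G x)"
  by (simp add: vec_eq_iff valm_nth germH_def germ_at_val[OF U x smooth_H])
lemma valm_Ric: "valm M.Ric = ricci G x"
  by (simp add: vec_eq_iff valm_nth germ_ricci germ_at_val[OF U x smooth_ricci])

context
  fixes w :: "real^'n \<Rightarrow> real^'n"
  assumes w: "smooth_on U w"
begin

text \<open>The vector field dual to \<open>w\<close>.\<close>
definition germW :: "'n germ^'n" where
  "germW = germH x *v (\<chi> j. germ_at x (\<lambda>y. w y $ j))"

lemma smooth_w: "smooth_on U (\<lambda>y. w y $ j)" using w U by (intro smooth_on_nth)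

lemma lower_germW: "germG x *v germW = (\<chi> j. germ_at x (\<lambda>y. w y $ j))"
  by (simp add: germW_def matrix_vector_mul_assoc M.GH)

lemma smooth_cov_deriv: "smooth_on U (cov_deriv G w i j)"
  unfolding cov_deriv_def[abs_def]
  by (intro smooth_on_mult smooth_on_sum smooth_on_diff smooth_on_pd U smooth_christoffel smooth_w)

lemma germ_cov_deriv: "(germG x ** M.nabla germW) $ j $ i = germ_at x (cov_deriv G w i j)"
  unfolding M.nabla_lower[OF lower_germW[symmetric]] cov_deriv_def[abs_def]
  by (simp add: germC_def germ_at_pd[OF U x smooth_w] germ_at_diff[OF U x] germ_at_sum[OF U x]
      germ_at_mult[OF U x] smooth_on_mult smooth_on_sum smooth_on_pd U smooth_christoffel smooth_w)

lemma germ_sym_deriv: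
  "(germG x ** M.nabla germW + transpose (germG x ** M.nabla germW)) $ i $ j
    = germ_at x (\<lambda>y. 2 * sym_deriv G w y $ i $ j)"
proof -
  have "(\<lambda>y. 2 * sym_deriv G w y $ i $ j) = (\<lambda>y. cov_deriv G w j i y + cov_deriv G w i j y)"
    by (rule ext) (simp add: sym_deriv_def)
  then show ?thesis
    by (simp only: vector_add_component transpose_nth germ_cov_deriv germ_at_add[OF U x smooth_cov_deriv smooth_cov_deriv])
qed

lemma smooth_sym_deriv: "smooth_on U (\<lambda>y. sym_deriv G w y $ i $ j)"
  unfolding sym_deriv_def
  by simp (intro smooth_on_mult smooth_on_add smooth_on_const U smooth_cov_deriv
    smooth_on_mult[of U "\<lambda>_. 1/2", simplified])

text \<open>The value of \<open>soliton_laplacian\<close> at a critical point of the scalar curvature,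
  where the term with \<open>ds\<close> drops out.\<close>
lemma soliton_value:
  assumes sol: "\<And>y. y \<in> U \<Longrightarrow> ricci G y = sym_deriv G w y + c *\<^sub>R G y"
    and crit: "\<And>i. pd i (scal G) x = 0"
  defines "R \<equiv> matrix_inv (G x) ** ricci G x"
  shows "(\<Sum>i\<in>UNIV. \<Sum>j\<in>UNIV. matrix_inv (G x) $ i $ j * pd i (pd j (scal G)) x)
    + 2 * trace (R ** (R - c *\<^sub>R mat 1)) = 0"
proof -
  have "2 *\<^sub>R M.Ric = germG x ** M.nabla germW + transpose (germG x ** M.nabla germW) + (2 * c) *\<^sub>R germG x"
    unfolding vec_eq_iff
  proof (intro allI)
    fix i j
    have "2 *\<^sub>R germ_at x (\<lambda>y. ricci G y $ i $ j) = germ_at x (\<lambda>y. 2 * ricci G y $ i $ j)"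
      by (rule germ_at_scale[OF U x smooth_ricci, symmetric])
    also have "\<dots> = germ_at x (\<lambda>y. 2 * sym_deriv G w y $ i $ j + (2 * c) * G y $ i $ j)"
      by (rule germ_at_cong[OF U x]) (auto simp: sol intro!: smooth_on_mult smooth_on_const U smooth_ricci)
    also have "\<dots> = germ_at x (\<lambda>y. 2 * sym_deriv G w y $ i $ j) + (2 * c) *\<^sub>R germ_at x (\<lambda>y. G y $ i $ j)"
      by (simp add: germ_at_add[OF U x] germ_at_scale[OF U x] smooth_G smooth_sym_deriv smooth_on_mult
          smooth_on_const U)
    finally have "2 *\<^sub>R germ_at x (\<lambda>y. ricci G y $ i $ j) = (germG x ** M.nabla germW
        + transpose (germG x ** M.nabla germW)) $ i $ j + (2 * c) *\<^sub>R germG x $ i $ j"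
      unfolding germ_sym_deriv by (simp add: germG_def)
    then show "(2 *\<^sub>R M.Ric) $ i $ j = (germG x ** M.nabla germW + transpose (germG x ** M.nabla germW)
        + (2 * c) *\<^sub>R germG x) $ i $ j"
      by (simp add: germ_ricci)
  qed
  from M.soliton_laplacian[OF this]
  have "germ_val (M.divergence (germH x *v germ.grad M.scalar)) + (\<Sum>l\<in>UNIV. germ_val (germ_pd l M.scalar) * germ_val (germW $ l))
    + 2 * trace (valm (M.ric_endo ** (M.ric_endo - c *\<^sub>R mat 1))) = 0"
    by (metis (no_types, lifting) germ_val_hom(1,3,6,7) germ_val_sum val_trace sum.cong)
  moreover have crit': "germ_val (germ_pd j M.scalar) = 0" for j
    using crit[of j] germ_at_val[OF U x smooth_on_pd[OF smooth_scal]]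
    by (simp add: germ_scal germ_at_pd[OF U x smooth_scal])
  moreover have "germ_val (germ_pd i (germ_pd j M.scalar)) = pd i (pd j (scal G)) x" for i j
    unfolding germ_scal germ_at_pd[OF U x smooth_scal] germ_at_pd[OF U x smooth_on_pd[OF smooth_scal]]
    by (rule germ_at_val[OF U x]) (intro smooth_on_pd smooth_scal)
  moreover have "valm M.ric_endo = R"
  proof -
    have sdt: "transpose (sym_deriv G w x) = sym_deriv G w x"
      by (simp add: vec_eq_iff transpose_nth sym_deriv_def add.commute)
    have "transpose (ricci G x) = ricci G x"
      unfolding sol[OF x] by (simp add: transpose_add transpose_scalar sdt sym[OF x])
    moreover have "transpose (matrix_inv (G x)) = matrix_inv (G x)"
      using arg_cong[OF M.H_sym, of valm] by (simp add: valm_transpose valm_H)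
    ultimately show ?thesis
      by (simp add: M.ric_endo_Ric valm_transpose valm_mult valm_Ric valm_H matrix_transpose_mul R_def)
  qed
  ultimately show ?thesis
    using germ_laplacian_value[of M.scalar] by (simp add: valm_mult valm_diff valm_scalar)
qed

lemma smooth_sqnorm: "smooth_on U (sqnorm G w)"
  unfolding sqnorm_def[abs_def] by (intro smooth_on_sum smooth_on_mult U smooth_H smooth_w)

text \<open>The value of \<open>killing_laplacian\<close> at a critical point of
  \<open>\<bar>w\<bar>\<^sup>2\<close>; the endomorphism \<open>N\<close> is the covariant
  derivative of the dual vector field.\<close>
lemma killing_value:
  assumes ric: "\<And>y. y \<in> U \<Longrightarrow> ricci G y = c *\<^sub>R G y"
    and kil: "\<And>y. y \<in> U \<Longrightarrow> sym_deriv G w y = 0"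
    and crit: "\<And>i. pd i (sqnorm G w) x = 0"
  shows "\<exists>N. transpose (G x ** N) = - (G x ** N) \<and>
    (\<Sum>i\<in>UNIV. \<Sum>j\<in>UNIV. matrix_inv (G x) $ i $ j * pd i (pd j (sqnorm G w)) x)
    + 2 * c * (sqnorm G w) x + 2 * trace (N ** N) = 0"
proof -
  let ?f = "\<Sum>i\<in>UNIV. germW $ i * (germG x *v germW) $ i"
  have "M.Ric = c *\<^sub>R germG x"
    unfolding vec_eq_iff
  proof (intro allI)
    fix i j
    have "germ_at x (\<lambda>y. ricci G y $ i $ j) = germ_at x (\<lambda>y. c * G y $ i $ j)"
      by (rule germ_at_cong[OF U x smooth_ricci]) (simp add: ric)
    then show "M.Ric $ i $ j = (c *\<^sub>R germG x) $ i $ j"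
      by (simp add: germ_ricci germG_def germ_at_scale[OF U x smooth_G])
  qed
  moreover have kil': "germG x ** M.nabla germW + transpose (germG x ** M.nabla germW) = 0"
    unfolding vec_eq_iff germ_sym_deriv
  proof (intro allI)
    fix i j
    have "germ_at x (\<lambda>y. 2 * sym_deriv G w y $ i $ j) = germ_at x (\<lambda>y. 0)"
      by (rule germ_at_cong[OF U x]) (auto simp: kil intro!: smooth_on_mult smooth_on_const smooth_sym_deriv U)
    then show "germ_at x (\<lambda>y. 2 * sym_deriv G w y $ i $ j) = 0 $ i $ j"
      by (simp add: germ_at_def zero_germ.abs_eq)
  qed
  ultimately have eq: "M.divergence (germH x *v germ.grad ?f) + (2 * c) *\<^sub>R ?f
     + 2 *\<^sub>R trace (M.nabla germW ** M.nabla germW) = 0"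
    by (rule M.killing_laplacian)
  have f: "?f = germ_at x (sqnorm G w)"
    unfolding sqnorm_def[abs_def] lower_germW
    by (simp add: germW_def M.matrix_vector_mult_nth germH_def germ_at_sum[OF U x] germ_at_mult[OF U x]
        smooth_on_mult smooth_on_sum U smooth_H smooth_w sum_distrib_left mult_ac)
  have crit': "germ_val (germ_pd j ?f) = 0" for j
    using crit[of j] germ_at_val[OF U x smooth_on_pd[OF smooth_sqnorm]]
    unfolding f germ_at_pd[OF U x smooth_sqnorm] by simp
  have hess: "germ_val (germ_pd i (germ_pd j ?f)) = pd i (pd j (sqnorm G w)) x" for i j
    unfolding f germ_at_pd[OF U x smooth_sqnorm] germ_at_pd[OF U x smooth_on_pd[OF smooth_sqnorm]]
    by (rule germ_at_val[OF U x]) (intro smooth_on_pd smooth_sqnorm)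
  have "germ_val (M.divergence (germH x *v germ.grad ?f)) + (2 * c) * germ_val ?f
     + 2 * trace (valm (M.nabla germW) ** valm (M.nabla germW)) = 0"
    using arg_cong[OF eq, of germ_val] by (simp only: germ_val_hom val_trace valm_mult)
  moreover have "germ_val ?f = (sqnorm G w) x" unfolding f by (rule germ_at_val[OF U x smooth_sqnorm])
  moreover have "transpose (G x ** valm (M.nabla germW)) = - (G x ** valm (M.nabla germW))"
    using arg_cong[OF kil', of valm]
    by (simp add: valm_add valm_transpose valm_mult valm_G valm_zero eq_neg_iff_add_eq_0 add.commute)
  ultimately show ?thesis
    using germ_laplacian_value[OF crit'] hess by (intro exI[of _ "valm (M.nabla germW)"]) simp
qed

end
end
end

section \<open>Positive definite matrices and the second derivative test\<close>

text \<open>Cholesky decomposition by completing squares. The set \<open>I\<close> contains the indices of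
  the rows not yet eliminated. If the diagonal entry at \<open>a\<close> is zero,
  semidefiniteness forces the whole row to be zero; otherwise the square \<open>(u \<bullet>
  v)\<^sup>2 / Q $ a $ a\<close> is split off.\<close>
lemma psd_sum_of_squares:
  fixes Q :: "real^'n^'n"
  assumes "finite I" "transpose Q = Q" "\<And>v. v \<bullet> (Q *v v) \<ge> 0"
    "\<And>i j. i \<notin> I \<Longrightarrow> Q $ i $ j = 0"
  shows "\<exists>V :: 'n \<Rightarrow> 'n \<Rightarrow> real. \<forall>i j. Q $ i $ j = (\<Sum>a\<in>I. V a i * V a j)"
  using assms
proof (induction I arbitrary: Q rule: finite_induct)
  case empty then show ?case by auto
next
  case (insert a I)
  have sym: "Q $ i $ j = Q $ j $ i" for i j using insert.prems(1) by (metis transpose_nth)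
  define u where "u = Q $ a"
  have Qe: "Q *v axis a 1 = u"
    by (simp add: vec_eq_iff u_def matrix_vector_mult_def axis_def if_distrib sym[of _ a] cong: if_cong)
  have adj: "v \<bullet> (Q *v w) = w \<bullet> (Q *v v)" for v w
    using insert.prems(1) by (metis dot_lmul_matrix inner_commute transpose_matrix_vector)
  have e_inner: "axis a 1 \<bullet> (Q *v v) = u \<bullet> v" for v
    by (subst adj) (simp add: Qe inner_commute)
  have expand: "(v + t *\<^sub>R axis a 1) \<bullet> (Q *v (v + t *\<^sub>R axis a 1))
      = v \<bullet> (Q *v v) + 2 * t * (u \<bullet> v) + t\<^sup>2 * Q $ a $ a" for v t
  proof -
    have "axis a 1 \<bullet> u = Q $ a $ a" by (simp add: u_def inner_axis')
    then show ?thesis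
      by (simp add: matrix_vector_right_distrib matrix_vector_mult_scaleR inner_add_left inner_add_right
          e_inner Qe inner_commute[of v u] power2_eq_square algebra_simps)
  qed
  show ?case
  proof (cases "Q $ a $ a = 0")
    case True
    have "Q $ i $ j = 0" if "i \<notin> I" for i j
    proof (cases "i = a")
      case True': True
      have "u $ j = 0"
      proof (rule ccontr)
        assume nz: "u $ j \<noteq> 0"
        \<comment> \<open>For \<open>Q $ a $ a = 0\<close> the form is affine in \<open>t\<close> along \<open>axis j 1 + t *\<^sub>R axis a 1\<close>; here it takes the value \<open>-1\<close>.\<close>
        define t where "t = - (Q $ j $ j + 1) / (2 * u $ j)"
        have "0 \<le> axis j 1 \<bullet> (Q *v axis j 1) + 2 * t * (u \<bullet> axis j 1) + t\<^sup>2 * Q $ a $ a"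
          using insert.prems(2) unfolding expand[symmetric] .
        also have "axis j 1 \<bullet> (Q *v axis j 1) = Q $ j $ j"
          by (simp add: inner_axis' matrix_vector_mult_def) (simp add: axis_def if_distrib cong: if_cong)
        finally show False using nz True by (simp add: inner_axis t_def field_simps)
      qed
      then show ?thesis by (simp add: u_def True')
    qed (use insert.prems(3) that in auto)
    from insert.IH[OF insert.prems(1,2) this] obtain V where
      V: "Q $ i $ j = (\<Sum>a\<in>I. V a i * V a j)" for i j by blast
    have "Q $ i $ j = (\<Sum>b\<in>insert a I. (V(a := \<lambda>_. 0)) b i * (V(a := \<lambda>_. 0)) b j)" for i j
      using insert.hyps by (simp add: V) (intro sum.cong refl, auto)
    then show ?thesis by blast
  next
    case False
    have "0 \<le> Q $ a $ a"
      using insert.prems(2)[of "axis a 1"] by (simp add: Qe) (simp add: u_def inner_axis')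
    with False have pos: "Q $ a $ a > 0" by simp
    define R where "R = (\<chi> i j. Q $ i $ j - u $ i * u $ j / Q $ a $ a)"
    have Rv: "R *v v = Q *v v - ((u \<bullet> v) / Q $ a $ a) *\<^sub>R u" for v
      by (simp add: vec_eq_iff R_def matrix_vector_mult_def inner_vec_def left_diff_distrib right_diff_distrib
          sum_subtractf sum_divide_distrib sum_distrib_left sum_distrib_right mult_ac)
    have psd: "v \<bullet> (R *v v) \<ge> 0" for v
    proof -
      \<comment> \<open>semidefiniteness at the point \<open>v - ((u \<bullet> v) / Q $ a $ a) *\<^sub>R axis a 1\<close>, which minimizes the form on its line\<close>
      have "0 \<le> v \<bullet> (Q *v v) + 2 * (- (u \<bullet> v) / Q $ a $ a) * (u \<bullet> v) + (- (u \<bullet> v) / Q $ a $ a)\<^sup>2 * Q $ a $ a"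
        using insert.prems(2) unfolding expand[symmetric] .
      also have "\<dots> = v \<bullet> (R *v v)"
        using pos by (simp add: Rv inner_diff_right inner_commute[of v u] power2_eq_square field_simps)
      finally show ?thesis .
    qed
    have "R $ i $ j = 0" if "i \<notin> I" for i j
    proof (cases "i = a")
      case True then show ?thesis using pos by (simp add: R_def u_def)
    next
      case False
      then have "Q $ i $ k = 0" for k using that insert.prems(3) by auto
      then show ?thesis by (simp add: R_def u_def sym[of a i])
    qed
    moreover have "transpose R = R" by (simp add: vec_eq_iff R_def transpose_nth sym mult.commute)
    ultimately obtain V where V: "R $ i $ j = (\<Sum>a\<in>I. V a i * V a j)" for i j
      using insert.IH[of R] psd by blast
    define W where "W = V(a := \<lambda>i. u $ i / sqrt (Q $ a $ a))"
    have "Q $ i $ j = (\<Sum>b\<in>insert a I. W b i * W b j)" for i j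
    proof -
      have "(\<Sum>b\<in>insert a I. W b i * W b j) = u $ i * u $ j / Q $ a $ a + (\<Sum>b\<in>I. W b i * W b j)"
        using insert.hyps pos by (simp add: W_def)
      also have "(\<Sum>b\<in>I. W b i * W b j) = (\<Sum>b\<in>I. V b i * V b j)"
        using insert.hyps by (intro sum.cong) (auto simp: W_def)
      finally show ?thesis by (simp add: V[symmetric] R_def)
    qed
    then show ?thesis by blast
  qed
qed

lemma psd_factor:
  fixes Q :: "real^'n^'n"
  assumes "transpose Q = Q" "\<And>v. v \<bullet> (Q *v v) \<ge> 0"
  shows "\<exists>B :: real^'n^'n. Q = B ** transpose B"
proof -
  obtain V :: "'n \<Rightarrow> 'n \<Rightarrow> real" where "\<forall>i j. Q $ i $ j = (\<Sum>a\<in>UNIV. V a i * V a j)"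
    using psd_sum_of_squares[OF finite assms, of UNIV] by auto
  then have "Q = (\<chi> i a. V a i) ** transpose (\<chi> i a. V a i)"
    by (simp add: vec_eq_iff matrix_mult_nth transpose_nth)
  then show ?thesis by blast
qed

lemma posdef_inverse_factor:
  fixes G :: "real^'n^'n"
  assumes sym: "transpose G = G" and pos: "\<And>v. v \<noteq> 0 \<Longrightarrow> v \<bullet> (G *v v) > 0"
  obtains B :: "real^'n^'n" where "matrix_inv G = B ** transpose B"
proof -
  have inv: "invertible G" by (rule posdef_invertible) (rule pos)
  have sH: "transpose (matrix_inv G) = matrix_inv G"
  proof -
    have "transpose (matrix_inv G) ** G = mat 1"
      using arg_cong[OF matrix_inv_right[OF inv], of transpose] by (simp add: matrix_transpose_mul sym)
    then have "transpose (matrix_inv G) ** (G ** matrix_inv G) = matrix_inv G"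
      by (simp add: matrix_mul_assoc)
    then show ?thesis by (simp add: matrix_inv_right[OF inv])
  qed
  have psd: "v \<bullet> (matrix_inv G *v v) \<ge> 0" for v
  proof -
    let ?w = "matrix_inv G *v v"
    have "G *v ?w = v" by (simp add: matrix_vector_mul_assoc matrix_inv_right[OF inv])
    then have "v \<bullet> ?w = ?w \<bullet> (G *v ?w)" by (simp add: inner_commute)
    then show ?thesis using pos[of ?w] by (cases "?w = 0") auto
  qed
  show thesis using psd_factor[OF sH psd] that by blast
qed

context
  fixes G :: "real^'n^'n"
  assumes sym: "transpose G = G" and pos: "\<And>v. v \<noteq> 0 \<Longrightarrow> v \<bullet> (G *v v) > 0"
begin

lemma inv_G: "invertible G" by (rule posdef_invertible) (rule pos)

text \<open>With \<open>G\<^sup>-\<^sup>1 = B B\<^sup>T\<close> the trace is the sum of the values of the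
  quadratic form \<open>P\<close> at the columns of \<open>B\<close>.\<close>
lemma trace_inverse_psd_nonneg:
  assumes "\<And>v. (\<Sum>i\<in>UNIV. \<Sum>j\<in>UNIV. v $ i * v $ j * P i j) \<ge> 0"
  shows "(\<Sum>i\<in>UNIV. \<Sum>j\<in>UNIV. matrix_inv G $ i $ j * P i j) \<ge> 0"
proof -
  obtain B :: "real^'n^'n" where B: "matrix_inv G = B ** transpose B" by (rule posdef_inverse_factor[OF sym pos])
  have "(\<Sum>i\<in>UNIV. \<Sum>j\<in>UNIV. matrix_inv G $ i $ j * P i j) =
     (\<Sum>i\<in>UNIV. \<Sum>j\<in>UNIV. \<Sum>a\<in>UNIV. B $ i $ a * B $ j $ a * P i j)"
    by (simp add: B matrix_mult_nth transpose_nth sum_distrib_right)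
  also have "\<dots> = (\<Sum>i\<in>UNIV. \<Sum>a\<in>UNIV. \<Sum>j\<in>UNIV. B $ i $ a * B $ j $ a * P i j)"
    by (rule sum.cong[OF refl]) (rule sum.swap)
  also have "\<dots> = (\<Sum>a\<in>UNIV. \<Sum>i\<in>UNIV. \<Sum>j\<in>UNIV. B $ i $ a * B $ j $ a * P i j)"
    by (rule sum.swap)
  also have "\<dots> \<ge> 0"
    by (rule sum_nonneg) (use assms[of "\<chi> i. B $ i $ _"] in simp)
  finally show ?thesis .
qed

text \<open>The columns of \<open>B\<close> form an orthonormal basis for \<open>G\<close>, and the matrix
  \<open>B\<^sup>T (G S) B\<close> represents \<open>S\<close> in this basis.\<close>
lemma trace_square_factor:
  obtains B :: "real^'n^'n" where "matrix_inv G = B ** transpose B"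
    "\<And>S. trace (S ** S) = trace ((transpose B ** (G ** S) ** B) ** (transpose B ** (G ** S) ** B))"
proof -
  obtain B :: "real^'n^'n" where B: "matrix_inv G = B ** transpose B" by (rule posdef_inverse_factor[OF sym pos])
  have "trace (S ** S) = trace ((transpose B ** (G ** S) ** B) ** (transpose B ** (G ** S) ** B))" for S
  proof -
    let ?T = "G ** S" and ?H = "matrix_inv G"
    have S: "S = ?H ** ?T" by (simp add: matrix_mul_assoc matrix_inv_left[OF inv_G])
    have "trace (S ** S) = trace (B ** (transpose B ** ?T ** B ** transpose B ** ?T))"
      by (subst (1 2) S) (simp add: B matrix_mul_assoc)
    also have "\<dots> = trace ((transpose B ** ?T ** B ** transpose B ** ?T) ** B)" by (rule trace_mul_sym)
    finally show ?thesis by (simp add: matrix_mul_assoc)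
  qed
  then show thesis using B that by blast
qed

text \<open>In an orthonormal basis a self-adjoint endomorphism has a symmetric matrix, and the trace of
  its square is the sum of the squares of the entries; in the skew-adjoint case below it is the
  negative of that sum.\<close>
lemma trace_square_sym:
  assumes "transpose (G ** S) = G ** S"
  shows "trace (S ** S) \<ge> 0" "trace (S ** S) = 0 \<Longrightarrow> S = 0"
proof -
  obtain B :: "real^'n^'n" where B: "matrix_inv G = B ** transpose B"
    "\<And>S. trace (S ** S) = trace ((transpose B ** (G ** S) ** B) ** (transpose B ** (G ** S) ** B))"
    using trace_square_factor by blast
  define C where "C = transpose B ** (G ** S) ** B"
  have "transpose C = transpose B ** transpose (G ** S) ** B"
    unfolding C_def by (simp add: matrix_transpose_mul matrix_mul_assoc)
  then have "transpose C = C" unfolding assms C_def .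
  then have C: "C $ i $ j = C $ j $ i" for i j by (metis transpose_nth)
  have CC: "trace (S ** S) = trace (C ** C)" using B(2)[of S] by (simp only: C_def)
  have tr: "trace (S ** S) = (\<Sum>i\<in>UNIV. \<Sum>j\<in>UNIV. (C $ i $ j)\<^sup>2)"
    unfolding CC unfolding trace_def matrix_mult_nth
  proof (intro sum.cong refl)
    fix i j show "C $ i $ j * C $ j $ i = (C $ i $ j)\<^sup>2"
      using C[of i j] by (simp add: power2_eq_square)
  qed
  then show "trace (S ** S) \<ge> 0" by (simp add: sum_nonneg)
  assume "trace (S ** S) = 0"
  then have "C = 0"
    unfolding tr by (simp add: sum_nonneg_eq_0_iff sum_nonneg vec_eq_iff)
  then have "B ** C ** transpose B = 0" by simp
  then have "(B ** transpose B) ** (G ** S) ** (B ** transpose B) = 0"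
    by (simp add: C_def matrix_mul_assoc)
  then have "S ** matrix_inv G = 0"
    unfolding B(1)[symmetric] by (simp add: matrix_mul_assoc matrix_inv_left[OF inv_G])
  then have "S ** matrix_inv G ** G = 0" by simp
  then show "S = 0" by (simp add: matrix_mul_assoc[symmetric] matrix_inv_left[OF inv_G])
qed

lemma trace_square_antisym:
  assumes "transpose (G ** S) = - (G ** S)"
  shows "trace (S ** S) \<le> 0"
proof -
  obtain B :: "real^'n^'n" where B: "matrix_inv G = B ** transpose B"
    "\<And>S. trace (S ** S) = trace ((transpose B ** (G ** S) ** B) ** (transpose B ** (G ** S) ** B))"
    using trace_square_factor by blast
  define C where "C = transpose B ** (G ** S) ** B"
  have "transpose C = transpose B ** transpose (G ** S) ** B"
    unfolding C_def by (simp add: matrix_transpose_mul matrix_mul_assoc)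
  then have "transpose C = - C" unfolding assms C_def by (simp only: matrix_neg_left matrix_neg_right)
  then have C: "C $ j $ i = - C $ i $ j" for i j by (metis transpose_nth vector_uminus_component)
  have CC: "trace (S ** S) = trace (C ** C)" using B(2)[of S] by (simp only: C_def)
  have tr: "trace (S ** S) = (\<Sum>i\<in>UNIV. \<Sum>j\<in>UNIV. - (C $ i $ j)\<^sup>2)"
    unfolding CC unfolding trace_def matrix_mult_nth
  proof (intro sum.cong refl)
    fix i j show "C $ i $ j * C $ j $ i = - (C $ i $ j)\<^sup>2"
      using C[of i j] by (simp add: power2_eq_square)
  qed
  show ?thesis unfolding tr by (intro sum_nonpos) simp
qed

end

lemma local_min_derivatives:
  fixes f :: "real^'n \<Rightarrow> real"
  assumes U: "open U" "x \<in> U" and f: "smooth_on U f" and min: "\<And>y. y \<in> U \<Longrightarrow> f x \<le> f y"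
  shows "pd i f x = 0" "(\<Sum>i\<in>UNIV. \<Sum>j\<in>UNIV. v $ i * v $ j * pd i (pd j f) x) \<ge> 0"
proof -
  have "\<exists>d>0. \<forall>t. \<bar>t\<bar> < d \<longrightarrow> x + t *\<^sub>R v \<in> U" for v
  proof -
    obtain e where e: "e > 0" "ball x e \<subseteq> U" using U open_contains_ball by blast
    have "x + t *\<^sub>R v \<in> U" if "\<bar>t\<bar> < e / (norm v + 1)" for t
    proof -
      have "\<bar>t\<bar> * norm v \<le> \<bar>t\<bar> * (norm v + 1)" by (intro mult_left_mono) auto
      also have "\<dots> < e" using that by (simp add: pos_less_divide_eq add_nonneg_pos)
      finally have "x + t *\<^sub>R v \<in> ball x e" by (simp add: dist_norm)
      then show ?thesis using e(2) by blast
    qed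
    moreover have "e / (norm v + 1) > 0" using e(1) by (simp add: add_nonneg_pos)
    ultimately show ?thesis by blast
  qed
  note nbhd = this
  have d1: "((\<lambda>u. f (x + u *\<^sub>R v)) has_real_derivative (\<Sum>i\<in>UNIV. v $ i * pd i f (x + u *\<^sub>R v))) (at u)"
    if "x + u *\<^sub>R v \<in> U" for u v
    by (rule pd_line[OF smooth_on_differentiable[OF f] U(1) that])
  have zero: "(\<Sum>i\<in>UNIV. v $ i * pd i f x) = 0" for v
  proof -
    obtain d where d: "d > 0" "\<And>t. \<bar>t\<bar> < d \<Longrightarrow> x + t *\<^sub>R v \<in> U" using nbhd by blast
    have "\<forall>y. \<bar>0 - y\<bar> < d \<longrightarrow> f (x + 0 *\<^sub>R v) \<le> f (x + y *\<^sub>R v)" using d min by simp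
    from DERIV_local_min[OF d1[of 0 v] d(1) this] show ?thesis using U by simp
  qed
  have "(\<Sum>k\<in>UNIV. axis i 1 $ k * pd k f x) = pd i f x"
    by (simp add: axis_def if_distrib if_distribR cong: if_cong)
  then show "pd i f x = 0" using zero[of "axis i 1"] by simp
  show "(\<Sum>i\<in>UNIV. \<Sum>j\<in>UNIV. v $ i * v $ j * pd i (pd j f) x) \<ge> 0"
  proof (rule ccontr)
    assume neg: "\<not> ?thesis"
    obtain d where d: "d > 0" "\<And>t. \<bar>t\<bar> < d \<Longrightarrow> x + t *\<^sub>R v \<in> U" using nbhd by blast
    define g where "g u = (\<Sum>j\<in>UNIV. v $ j * pd j f (x + u *\<^sub>R v))" for u
    have "(g has_real_derivative (\<Sum>j\<in>UNIV. v $ j * (\<Sum>i\<in>UNIV. v $ i * pd i (pd j f) (x + 0 *\<^sub>R v)))) (at 0)"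
      unfolding g_def using U
      by (intro DERIV_sum DERIV_cmult pd_line[OF smooth_on_differentiable[OF smooth_on_pd[OF f]] U(1)]) simp
    moreover have "(\<Sum>j\<in>UNIV. v $ j * (\<Sum>i\<in>UNIV. v $ i * pd i (pd j f) (x + 0 *\<^sub>R v)))
       = (\<Sum>i\<in>UNIV. \<Sum>j\<in>UNIV. v $ i * v $ j * pd i (pd j f) x)"
      by (subst sum.swap) (simp add: sum_distrib_left mult_ac)
    ultimately obtain e where e: "e > 0" "\<And>h. h > 0 \<Longrightarrow> h < e \<Longrightarrow> g h < g 0"
      using DERIV_neg_dec_right[of g _ 0] neg by force
    define t where "t = min d e / 2"
    have t: "t > 0" "t < d" "t < e" using d(1) e(1) by (auto simp: t_def)
    have "\<exists>z>0. z < t \<and> f (x + t *\<^sub>R v) - f (x + 0 *\<^sub>R v) = (t - 0) * g z"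
      unfolding g_def by (rule MVT2[OF t(1)]) (use d t in \<open>auto intro!: d1\<close>)
    then obtain z where z: "0 < z" "z < t" "f (x + t *\<^sub>R v) - f x = t * g z" by auto
    have "g 0 = 0" using zero by (simp add: g_def)
    then have "g z < 0" using e(2)[of z] z t by simp
    then have "f (x + t *\<^sub>R v) < f x" using z(3) t(1) by (smt (verit) mult_pos_neg)
    then show False using min[OF d(2)[of t]] t by simp
  qed
qed

section \<open>Change of coordinates\<close>

lemma pd_chain:
  fixes h :: "real^'n::finite \<Rightarrow> real" and \<phi> :: "real^'n \<Rightarrow> real^'n"
  assumes "\<phi> differentiable_on S" "open S" "x \<in> S" "h differentiable_on T" "open T" "\<phi> x \<in> T"
  shows "pd l (\<lambda>y. h (\<phi> y)) x = (\<Sum>c\<in>UNIV. pd l \<phi> x $ c * pd c h (\<phi> x))"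
proof -
  have h: "(h has_derivative frechet_derivative h (at (\<phi> x))) (at (\<phi> x))"
    by (rule differentiable_on_has_derivative[OF assms(4-6)])
  have p: "(\<phi> has_derivative frechet_derivative \<phi> (at x)) (at x)"
    by (rule differentiable_on_has_derivative[OF assms(1-3)])
  have "((\<lambda>y. h (\<phi> y)) has_derivative (\<lambda>v. frechet_derivative h (at (\<phi> x)) (frechet_derivative \<phi> (at x) v))) (at x)"
    using diff_chain_at[OF p h] by (simp add: o_def)
  from has_derivative_pd[OF this]
  have "pd l (\<lambda>y. h (\<phi> y)) x = frechet_derivative h (at (\<phi> x)) (pd l \<phi> x)"
    by (simp only: pd_def[of l \<phi>])
  also have "\<dots> = (\<Sum>c\<in>UNIV. pd l \<phi> x $ c * pd c h (\<phi> x))"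
    by (subst derivative_pd_sum[OF h]) simp
  finally show ?thesis .
qed

lemma pd_mult2:
  fixes f g h :: "real^'n::finite \<Rightarrow> real"
  assumes "f differentiable_on S" "g differentiable_on S" "h differentiable_on S" "open S" "x \<in> S"
  shows "pd i (\<lambda>x. f x * g x * h x) x = pd i f x * g x * h x + f x * pd i g x * h x + f x * g x * pd i h x"
  by (simp add: pd_mult[OF differentiable_on_mult[OF assms(1,2)] assms(3,4,5)] pd_mult[OF assms(1,2,4,5)]
      distrib_right)

lemma differentiable_on_sum:
  fixes f :: "'i \<Rightarrow> real^'n \<Rightarrow> real"
  shows "(\<And>i. i \<in> I \<Longrightarrow> f i differentiable_on S) \<Longrightarrow> (\<lambda>x. \<Sum>i\<in>I. f i x) differentiable_on S"
  by (induction I rule: infinite_finite_induct) (auto intro: differentiable_on_add)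

lemma sum_rotate:
  "(\<Sum>a\<in>A. \<Sum>b\<in>B. \<Sum>c\<in>C. f a b c) = (\<Sum>c\<in>C. \<Sum>a\<in>A. \<Sum>b\<in>B. f a b c)"
proof -
  have "(\<Sum>a\<in>A. \<Sum>b\<in>B. \<Sum>c\<in>C. f a b c) = (\<Sum>a\<in>A. \<Sum>c\<in>C. \<Sum>b\<in>B. f a b c)"
    by (rule sum.cong[OF refl]) (rule sum.swap)
  also have "\<dots> = (\<Sum>c\<in>C. \<Sum>a\<in>A. \<Sum>b\<in>B. f a b c)" by (rule sum.swap)
  finally show ?thesis .
qed

lemma pd_sum:
  fixes f :: "'i \<Rightarrow> real^'n::finite \<Rightarrow> real"
  assumes "\<And>i. i \<in> I \<Longrightarrow> f i differentiable_on S" "open S" "x \<in> S"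
  shows "pd k (\<lambda>x. \<Sum>i\<in>I. f i x) x = (\<Sum>i\<in>I. pd k (f i) x)"
  using assms(1)
proof (induction I rule: infinite_finite_induct)
  case (insert a I)
  have "(\<lambda>x. \<Sum>i\<in>I. f i x) differentiable_on S"
    using insert.prems insert.hyps(1) by (intro differentiable_on_sum) auto
  with insert show ?case by (simp add: pd_add[OF _ _ assms(2,3)])
qed auto

text \<open>The situation on the overlap of two charts, with \<open>\<phi>\<close> the transition map: the
  tensor transformation law says that \<open>G\<close> is the pullback of \<open>H\<close>.\<close>
locale chart_change = src: local_metric S G + tgt: local_metric T H
  for S T :: "(real^'n::finite) set" and G H :: "real^'n \<Rightarrow> real^'n^'n" +
  fixes \<phi> :: "real^'n \<Rightarrow> real^'n"
  assumes smooth_\<phi>: "smooth_on S \<phi>" and maps: "x \<in> S \<Longrightarrow> \<phi> x \<in> T"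
    and transform: "x \<in> S \<Longrightarrow> G x $ i $ j =
      (\<Sum>k\<in>UNIV. \<Sum>l\<in>UNIV. pd i \<phi> x $ k * pd j \<phi> x $ l * H (\<phi> x) $ k $ l)"
begin

definition J :: "real^'n \<Rightarrow> real^'n^'n" where "J x = (\<chi> a i. pd i \<phi> x $ a)"

lemma metric_pullback: "x \<in> S \<Longrightarrow> G x = transpose (J x) ** H (\<phi> x) ** J x"
proof -
  assume x: "x \<in> S"
  have "(\<Sum>k\<in>UNIV. \<Sum>l\<in>UNIV. pd i \<phi> x $ k * pd j \<phi> x $ l * H (\<phi> x) $ k $ l) = 
   (\<Sum>l\<in>UNIV. (\<Sum>k\<in>UNIV. pd i \<phi> x $ k * H (\<phi> x) $ k $ l) * pd j \<phi> x $ l)" for i j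
    by (subst sum.swap) (simp add: sum_distrib_left mult_ac)
  then show ?thesis
    by (simp add: vec_eq_iff transform[OF x] matrix_mult_nth transpose_nth J_def)
qed

text \<open>The transformation of the volume density; as \<open>G\<close> is nondegenerate, it also shows
  that \<open>\<phi>\<close> is a local diffeomorphism.\<close>
lemma det_G: "x \<in> S \<Longrightarrow> det (G x) = (det (J x))\<^sup>2 * det (H (\<phi> x))"
  by (simp add: metric_pullback det_mul det_transpose power2_eq_square)

lemma det_J_nz: "x \<in> S \<Longrightarrow> det (J x) \<noteq> 0"
  using det_G src.inv by (fastforce simp: invertible_det_nz)

lemma inverse_transform:
  assumes x: "x \<in> S"
  shows "J x ** matrix_inv (G x) ** transpose (J x) = matrix_inv (H (\<phi> x))"
proof -
  let ?J = "J x" and ?H = "H (\<phi> x)" and ?K = "matrix_inv (J x)"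
  have J: "invertible ?J" "invertible (transpose ?J)"
    using det_J_nz[OF x] by (simp_all add: invertible_det_nz det_transpose)
  have H: "invertible ?H" using tgt.inv maps x by blast
  have "transpose ?J ** ?H ** (?J ** matrix_inv (G x) ** transpose ?J) = transpose ?J"
    using metric_pullback[OF x] matrix_inv_right[OF src.inv[OF x]] by (simp add: matrix_mul_assoc)
  then have "matrix_inv (transpose ?J) ** (transpose ?J ** ?H ** (?J ** matrix_inv (G x) ** transpose ?J)) = mat 1"
    by (simp add: matrix_inv_left[OF J(2)])
  then have "?H ** (?J ** matrix_inv (G x) ** transpose ?J) = mat 1"
    by (simp add: matrix_mul_assoc matrix_inv_left[OF J(2)])
  then have "matrix_inv ?H ** (?H ** (?J ** matrix_inv (G x) ** transpose ?J)) = matrix_inv ?H"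
    by simp
  then show ?thesis by (simp add: matrix_mul_assoc matrix_inv_left[OF H])
qed

text \<open>Full contractions of covariant tensors of degree two are invariant.\<close>
lemma contract_transform:
  assumes x: "x \<in> S"
  shows "(\<Sum>i\<in>UNIV. \<Sum>j\<in>UNIV. matrix_inv (G x) $ i $ j *
      (\<Sum>a\<in>UNIV. \<Sum>b\<in>UNIV. pd i \<phi> x $ a * pd j \<phi> x $ b * C a b))
    = (\<Sum>a\<in>UNIV. \<Sum>b\<in>UNIV. matrix_inv (H (\<phi> x)) $ a $ b * C a b)"
proof -
  let ?f = "\<lambda>i j a b. matrix_inv (G x) $ i $ j * (pd i \<phi> x $ a * pd j \<phi> x $ b * C a b)"
  have "(\<Sum>i\<in>UNIV. \<Sum>j\<in>UNIV. matrix_inv (G x) $ i $ j *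
      (\<Sum>a\<in>UNIV. \<Sum>b\<in>UNIV. pd i \<phi> x $ a * pd j \<phi> x $ b * C a b))
    = (\<Sum>i\<in>UNIV. \<Sum>j\<in>UNIV. \<Sum>a\<in>UNIV. \<Sum>b\<in>UNIV. ?f i j a b)"
    by (simp add: sum_distrib_left)
  also have "\<dots> = (\<Sum>a\<in>UNIV. \<Sum>i\<in>UNIV. \<Sum>j\<in>UNIV. \<Sum>b\<in>UNIV. ?f i j a b)" by (rule sum_rotate)
  also have "\<dots> = (\<Sum>a\<in>UNIV. \<Sum>b\<in>UNIV. \<Sum>i\<in>UNIV. \<Sum>j\<in>UNIV. ?f i j a b)"
    by (rule sum.cong[OF refl]) (rule sum_rotate)
  also have "\<dots> = (\<Sum>a\<in>UNIV. \<Sum>b\<in>UNIV. \<Sum>j\<in>UNIV. \<Sum>i\<in>UNIV. ?f i j a b)"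
    by (rule sum.cong[OF refl], rule sum.cong[OF refl], rule sum.swap)
  also have "\<dots> = (\<Sum>a\<in>UNIV. \<Sum>b\<in>UNIV. (J x ** matrix_inv (G x) ** transpose (J x)) $ a $ b * C a b)"
    by (simp add: matrix_mult_nth transpose_nth J_def sum_distrib_left mult_ac)
  finally show ?thesis unfolding inverse_transform[OF x] .
qed

lemma \<phi>_diff: "\<phi> differentiable_on S" by (rule smooth_on_differentiable[OF smooth_\<phi>])

lemma smooth_pd_\<phi>: "smooth_on S (\<lambda>y. pd i \<phi> y $ a)"
  by (intro smooth_on_nth smooth_on_pd smooth_\<phi> src.U)

lemma pd_\<phi>_component: "y \<in> S \<Longrightarrow> pd i \<phi> y $ a = pd i (\<lambda>y. \<phi> y $ a) y"
  by (rule pd_linear[OF bounded_linear_vec_nth \<phi>_diff src.U, symmetric])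

lemma pd2_\<phi>_sym:
  assumes "x \<in> S" shows "pd j (\<lambda>y. pd i \<phi> y $ a) x = pd i (\<lambda>y. pd j \<phi> y $ a) x"
proof -
  have "pd j (\<lambda>y. pd i \<phi> y $ a) x = pd j (pd i (\<lambda>y. \<phi> y $ a)) x" for i j
    by (rule pd_cong[OF src.U assms]) (rule pd_\<phi>_component)
  moreover have "pd j (pd i (\<lambda>y. \<phi> y $ a)) x = pd i (pd j (\<lambda>y. \<phi> y $ a)) x"
    by (rule pd_commute[OF _ src.U assms]) (use smooth_on_nth[OF src.U smooth_\<phi>] in \<open>simp add: smooth_on_def\<close>)
  ultimately show ?thesis by metis
qed

lemma compose_differentiable: "smooth_on T h \<Longrightarrow> (\<lambda>y. h (\<phi> y)) differentiable_on S" for h :: "real^'n \<Rightarrow> real"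
proof -
  assume h: "smooth_on T h"
  have "h differentiable_on \<phi> ` S"
    using smooth_on_differentiable[OF h] differentiable_on_subset maps by blast
  from differentiable_on_compose[OF \<phi>_diff this] show ?thesis by (simp add: o_def)
qed

context
  fixes x assumes x: "x \<in> S"
begin

text \<open>The second derivatives of \<open>\<phi>\<close>: they are the inhomogeneous part of the
  transformation law of the Christoffel symbols, and \<open>Y\<close> below is its tensorial
  part.\<close>
definition X :: "'n \<Rightarrow> 'n \<Rightarrow> real^'n" where "X i j = (\<chi> a. pd j (\<lambda>y. pd i \<phi> y $ a) x)"

lemma X_sym: "X i j = X j i" by (simp add: X_def vec_eq_iff pd2_\<phi>_sym[OF x])

text \<open>Differentiating the pullback formula for \<open>G\<close> produces terms \<open>P\<close> with
  second derivatives of \<open>\<phi>\<close> and terms \<open>Q\<close> with derivatives of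
  \<open>H\<close>.\<close>
definition P where "P i j m = (\<Sum>a\<in>UNIV. \<Sum>b\<in>UNIV. X i j $ a * pd m \<phi> x $ b * H (\<phi> x) $ a $ b)"
definition Q where "Q i j l = (\<Sum>a\<in>UNIV. \<Sum>b\<in>UNIV. pd i \<phi> x $ a * pd j \<phi> x $ b *
   (\<Sum>c\<in>UNIV. pd l \<phi> x $ c * pd c (\<lambda>z. H z $ a $ b) (\<phi> x)))"

lemma P_sym: "P i j m = P j i m" by (simp add: P_def X_sym)

lemma pd_G: "pd l (\<lambda>y. G y $ i $ j) x = P i l j + P j l i + Q i j l"
proof -
  have d: "(\<lambda>y. pd i \<phi> y $ a) differentiable_on S" for i a
    by (rule smooth_on_differentiable[OF smooth_pd_\<phi>])
  have dH: "(\<lambda>y. H (\<phi> y) $ a $ b) differentiable_on S" for a b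
    by (rule compose_differentiable[OF tgt.smooth_G])
  have "pd l (\<lambda>y. G y $ i $ j) x = pd l (\<lambda>y. \<Sum>k\<in>UNIV. \<Sum>m\<in>UNIV. pd i \<phi> y $ k * pd j \<phi> y $ m * H (\<phi> y) $ k $ m) x"
    by (rule pd_cong[OF src.U x]) (rule transform)
  also have "\<dots> = (\<Sum>k\<in>UNIV. \<Sum>m\<in>UNIV. pd l (\<lambda>y. pd i \<phi> y $ k * pd j \<phi> y $ m * H (\<phi> y) $ k $ m) x)"
    using d dH by (subst pd_sum[OF _ src.U x]; (subst pd_sum[OF _ src.U x])?)
      (auto intro!: differentiable_on_sum differentiable_on_mult)
  also have "\<dots> = (\<Sum>k\<in>UNIV. \<Sum>m\<in>UNIV. X i l $ k * pd j \<phi> x $ m * H (\<phi> x) $ k $ m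
     + X j l $ m * pd i \<phi> x $ k * H (\<phi> x) $ k $ m
     + pd i \<phi> x $ k * pd j \<phi> x $ m * (\<Sum>c\<in>UNIV. pd l \<phi> x $ c * pd c (\<lambda>z. H z $ k $ m) (\<phi> x)))"
    by (intro sum.cong refl, subst pd_mult2[OF d d dH src.U x],
        subst pd_chain[OF \<phi>_diff src.U x smooth_on_differentiable[OF tgt.smooth_G] tgt.U maps[OF x]])
      (simp add: X_def mult_ac)
  also have "\<dots> = P i l j + (\<Sum>k\<in>UNIV. \<Sum>m\<in>UNIV. X j l $ m * pd i \<phi> x $ k * H (\<phi> x) $ k $ m) + Q i j l"
    by (simp add: sum.distrib P_def Q_def)
  also have "(\<Sum>k\<in>UNIV. \<Sum>m\<in>UNIV. X j l $ m * pd i \<phi> x $ k * H (\<phi> x) $ k $ m) = P j l i"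
    unfolding P_def by (subst sum.swap) (simp add: tgt.G_nth_sym[OF maps[OF x]])
  finally show ?thesis .
qed

text \<open>Of the six terms with second derivatives of \<open>\<phi>\<close>, four cancel and the other
  two are equal.\<close>
lemma lower_christoffel_transform:
  "(\<Sum>k\<in>UNIV. G x $ m $ k * christoffel G k i j x) = P i j m + (1/2) * (Q j m i + Q i m j - Q i j m)"
  unfolding src.lower_christoffel[OF x] pd_G
  by (simp add: P_sym[of j i] P_sym[of m i] P_sym[of m j] algebra_simps)

definition Y :: "'n \<Rightarrow> 'n \<Rightarrow> real^'n" where
  "Y i j = (\<chi> a. \<Sum>b\<in>UNIV. \<Sum>c\<in>UNIV. pd i \<phi> x $ b * pd j \<phi> x $ c * christoffel H a b c (\<phi> x))"

lemma Q_lower: "(1/2) * (Q j m i + Q i m j - Q i j m) = (\<Sum>d\<in>UNIV. pd m \<phi> x $ d * (H (\<phi> x) *v Y i j) $ d)"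
proof -
  let ?p = "\<lambda>i a. pd i \<phi> x $ a" and ?h = "\<lambda>c a b. pd c (\<lambda>z. H z $ a $ b) (\<phi> x)"
  have Q1: "Q i j m = (\<Sum>d\<in>UNIV. \<Sum>b\<in>UNIV. \<Sum>c\<in>UNIV. ?p m d * ?p i b * ?p j c * ?h d b c)"
    unfolding Q_def sum_distrib_left by (subst sum_rotate) (simp add: mult_ac)
  have Q2: "Q i m j = (\<Sum>d\<in>UNIV. \<Sum>b\<in>UNIV. \<Sum>c\<in>UNIV. ?p m d * ?p i b * ?p j c * ?h c b d)"
    unfolding Q_def sum_distrib_left by (subst sum.swap) (simp add: mult_ac)
  have Q3: "Q j m i = (\<Sum>d\<in>UNIV. \<Sum>b\<in>UNIV. \<Sum>c\<in>UNIV. ?p m d * ?p i b * ?p j c * ?h b c d)"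
  proof -
    have "Q j m i = (\<Sum>d\<in>UNIV. \<Sum>c\<in>UNIV. \<Sum>b\<in>UNIV. ?p m d * ?p i b * ?p j c * ?h b c d)"
      unfolding Q_def sum_distrib_left by (subst sum.swap) (simp add: mult_ac)
    also have "\<dots> = (\<Sum>d\<in>UNIV. \<Sum>b\<in>UNIV. \<Sum>c\<in>UNIV. ?p m d * ?p i b * ?p j c * ?h b c d)"
      by (rule sum.cong[OF refl]) (rule sum.swap)
    finally show ?thesis .
  qed
  have HY: "(H (\<phi> x) *v Y i j) $ d = (\<Sum>b\<in>UNIV. \<Sum>c\<in>UNIV. ?p i b * ?p j c * ((1/2) * (?h b c d + ?h c b d - ?h d b c)))" for d
  proof -
    have "(H (\<phi> x) *v Y i j) $ d = (\<Sum>a\<in>UNIV. \<Sum>b\<in>UNIV. \<Sum>c\<in>UNIV. ?p i b * ?p j c * (H (\<phi> x) $ d $ a * christoffel H a b c (\<phi> x)))"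
      by (simp add: matrix_vector_mult_def Y_def sum_distrib_left mult_ac)
    also have "\<dots> = (\<Sum>b\<in>UNIV. \<Sum>c\<in>UNIV. \<Sum>a\<in>UNIV. ?p i b * ?p j c * (H (\<phi> x) $ d $ a * christoffel H a b c (\<phi> x)))"
      by (rule sum_rotate[symmetric])
    finally show ?thesis by (simp add: sum_distrib_left[symmetric] tgt.lower_christoffel[OF maps[OF x]])
  qed
  show ?thesis
    unfolding Q1 Q2 Q3 HY
    by (simp add: sum_distrib_left sum.distrib sum_subtractf sum_divide_distrib algebra_simps)
qed

text \<open>Both sides agree after lowering the index with the invertible matrix \<open>J\<^sup>T
  H\<close>.\<close>
lemma christoffel_transform:
  "(\<Sum>k\<in>UNIV. pd k \<phi> x $ a * christoffel G k i j x) = X i j $ a + Y i j $ a"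
proof -
  let ?c = "\<chi> k. christoffel G k i j x"
  have "(transpose (J x) *v (H (\<phi> x) *v (J x *v ?c))) $ m = (transpose (J x) *v (H (\<phi> x) *v (X i j + Y i j))) $ m" for m
  proof -
    have "(transpose (J x) *v (H (\<phi> x) *v (J x *v ?c))) $ m = (G x *v ?c) $ m"
      by (simp add: matrix_vector_mul_assoc metric_pullback[OF x] matrix_mul_assoc)
    also have "\<dots> = P i j m + (1/2) * (Q j m i + Q i m j - Q i j m)"
      by (simp add: matrix_vector_mult_def lower_christoffel_transform)
    also have "P i j m = (\<Sum>d\<in>UNIV. pd m \<phi> x $ d * (H (\<phi> x) *v X i j) $ d)"
      unfolding P_def matrix_vector_mult_def
      by (subst sum.swap) (simp add: sum_distrib_left tgt.G_nth_sym[OF maps[OF x]] mult_ac)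
    finally show ?thesis
      unfolding Q_lower by (simp add: matrix_vector_right_distrib sum.distrib[symmetric] distrib_left[symmetric]
        matrix_vector_mult_def[of "transpose _"] transpose_nth J_def del: transpose_matrix_vector)
  qed
  then have "transpose (J x) *v (H (\<phi> x) *v (J x *v ?c)) = transpose (J x) *v (H (\<phi> x) *v (X i j + Y i j))"
    unfolding vec_eq_iff by blast
  then have eq: "(transpose (J x) ** H (\<phi> x)) *v (J x *v ?c) = (transpose (J x) ** H (\<phi> x)) *v (X i j + Y i j)"
    by (simp only: matrix_vector_mul_assoc matrix_mul_assoc)
  have "invertible (transpose (J x) ** H (\<phi> x))"
    using det_J_nz[OF x] tgt.inv[OF maps[OF x]] by (simp add: invertible_det_nz det_mul det_transpose)
  then have "J x *v ?c = X i j + Y i j"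
    using eq injD[OF inj_matrix_vector_mult] by blast
  then have "(J x *v ?c) $ a = (X i j + Y i j) $ a" by simp
  then show ?thesis by (simp add: matrix_vector_mult_def J_def)
qed

context
  fixes w v :: "real^'n \<Rightarrow> real^'n"
  assumes v: "smooth_on T v"
    and w: "\<And>y i. y \<in> S \<Longrightarrow> w y $ i = (\<Sum>k\<in>UNIV. pd i \<phi> y $ k * v (\<phi> y) $ k)"
begin

text \<open>The second derivatives of \<open>\<phi>\<close> from the derivative of \<open>w\<close> and
  from the Christoffel symbols cancel.\<close>
lemma cov_deriv_transform:
  "cov_deriv G w i j x = (\<Sum>a\<in>UNIV. \<Sum>b\<in>UNIV. pd i \<phi> x $ a * pd j \<phi> x $ b * cov_deriv H v a b (\<phi> x))"
proof -
  have sv: "smooth_on T (\<lambda>y. v y $ k)" for k using v tgt.U by (intro smooth_on_nth)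
  have d: "(\<lambda>y. pd i \<phi> y $ a) differentiable_on S" for i a
    by (rule smooth_on_differentiable[OF smooth_pd_\<phi>])
  have div_endo: "(\<lambda>y. v (\<phi> y) $ k) differentiable_on S" for k
    by (rule compose_differentiable[OF sv])
  have "pd i (\<lambda>y. w y $ j) x = pd i (\<lambda>y. \<Sum>k\<in>UNIV. pd j \<phi> y $ k * v (\<phi> y) $ k) x"
    by (rule pd_cong[OF src.U x]) (rule w)
  also have "\<dots> = (\<Sum>k\<in>UNIV. X j i $ k * v (\<phi> x) $ k
     + pd j \<phi> x $ k * (\<Sum>a\<in>UNIV. pd i \<phi> x $ a * pd a (\<lambda>z. v z $ k) (\<phi> x)))"
    using d div_endo by (subst pd_sum[OF _ src.U x])
      (simp_all add: X_def pd_mult[OF _ _ src.U x]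
        pd_chain[OF \<phi>_diff src.U x smooth_on_differentiable[OF sv] tgt.U maps[OF x]])
  finally have 1: "pd i (\<lambda>y. w y $ j) x = (\<Sum>k\<in>UNIV. X i j $ k * v (\<phi> x) $ k)
     + (\<Sum>a\<in>UNIV. \<Sum>b\<in>UNIV. pd i \<phi> x $ a * pd j \<phi> x $ b * pd a (\<lambda>z. v z $ b) (\<phi> x))"
    by (simp add: sum.distrib X_sym[of j i] sum_distrib_left) (subst sum.swap, simp add: mult_ac)
  have "(\<Sum>k\<in>UNIV. christoffel G k i j x * w x $ k)
     = (\<Sum>a\<in>UNIV. (\<Sum>k\<in>UNIV. pd k \<phi> x $ a * christoffel G k i j x) * v (\<phi> x) $ a)"
    unfolding w[OF x] sum_distrib_left sum_distrib_right
    by (subst sum.swap) (simp add: mult_ac)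
  also have "\<dots> = (\<Sum>k\<in>UNIV. X i j $ k * v (\<phi> x) $ k) + (\<Sum>c\<in>UNIV. Y i j $ c * v (\<phi> x) $ c)"
    unfolding christoffel_transform by (simp add: sum.distrib distrib_right)
  also have "(\<Sum>c\<in>UNIV. Y i j $ c * v (\<phi> x) $ c) =
    (\<Sum>a\<in>UNIV. \<Sum>b\<in>UNIV. pd i \<phi> x $ a * pd j \<phi> x $ b * (\<Sum>c\<in>UNIV. christoffel H c a b (\<phi> x) * v (\<phi> x) $ c))"
  proof -
    have "(\<Sum>c\<in>UNIV. Y i j $ c * v (\<phi> x) $ c) = (\<Sum>c\<in>UNIV. \<Sum>a\<in>UNIV. \<Sum>b\<in>UNIV. pd i \<phi> x $ a * pd j \<phi> x $ b * (christoffel H c a b (\<phi> x) * v (\<phi> x) $ c))"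
      by (simp add: Y_def sum_distrib_right mult.assoc)
    also have "\<dots> = (\<Sum>a\<in>UNIV. \<Sum>c\<in>UNIV. \<Sum>b\<in>UNIV. pd i \<phi> x $ a * pd j \<phi> x $ b * (christoffel H c a b (\<phi> x) * v (\<phi> x) $ c))"
      by (rule sum.swap)
    also have "\<dots> = (\<Sum>a\<in>UNIV. \<Sum>b\<in>UNIV. \<Sum>c\<in>UNIV. pd i \<phi> x $ a * pd j \<phi> x $ b * (christoffel H c a b (\<phi> x) * v (\<phi> x) $ c))"
      by (rule sum.cong[OF refl]) (rule sum.swap)
    finally show ?thesis by (simp add: sum_distrib_left)
  qed
  finally show ?thesis
    unfolding cov_deriv_def 1 by (simp add: right_diff_distrib sum_subtractf)
qed

lemma codiff_transform: "codiff G w x = codiff H v (\<phi> x)"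
  unfolding codiff_def cov_deriv_transform contract_transform[OF x] ..

lemma sqnorm_transform: "sqnorm G w x = sqnorm H v (\<phi> x)"
proof -
  have "w x $ i * w x $ j = (\<Sum>a\<in>UNIV. \<Sum>b\<in>UNIV. pd i \<phi> x $ a * pd j \<phi> x $ b * (v (\<phi> x) $ a * v (\<phi> x) $ b))" for i j
    unfolding w[OF x] sum_product by (simp add: mult_ac)
  then show ?thesis
    using contract_transform[OF x, of "\<lambda>a b. v (\<phi> x) $ a * v (\<phi> x) $ b"]
    unfolding sqnorm_def by (simp add: mult.assoc)
qed

end
end
end

section \<open>Change of variables in the Lebesgue integral\<close>

text \<open>A well-ordered index type with as many elements as \<open>'n\<close>. Change of variables is
  proved on \<open>real^('n idx)\<close>, where the order on the indices is available, and
  carried over to \<open>real^'n\<close> by relabelling the coordinates.\<close>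
typedef ('n::finite) idx = "{..<CARD('n)}"
  by (rule exI[of _ 0]) simp

instantiation idx :: (finite) "{finite,wellorder}"
begin
definition less_eq_idx :: "'a idx \<Rightarrow> 'a idx \<Rightarrow> bool" where "less_eq_idx a b \<longleftrightarrow> Rep_idx a \<le> Rep_idx b"
definition less_idx :: "'a idx \<Rightarrow> 'a idx \<Rightarrow> bool" where "less_idx a b \<longleftrightarrow> Rep_idx a < Rep_idx b"
instance
proof
  fix x y z :: "'a idx" and P
  show "finite (UNIV :: 'a idx set)"
    using type_definition.Abs_image[OF type_definition_idx[where 'n = 'a]] finite_imageI finite_lessThan by metis
  show "x < y \<longleftrightarrow> x \<le> y \<and> \<not> y \<le> x" by (auto simp: less_eq_idx_def less_idx_def)
  show "x \<le> x" by (simp add: less_eq_idx_def)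
  show "x \<le> y \<Longrightarrow> y \<le> z \<Longrightarrow> x \<le> z" by (simp add: less_eq_idx_def)
  show "x \<le> y \<Longrightarrow> y \<le> x \<Longrightarrow> x = y" by (simp add: less_eq_idx_def Rep_idx_inject)
  show "x \<le> y \<or> y \<le> x" by (auto simp: less_eq_idx_def)
  assume step: "\<And>x::'a idx. (\<And>y. y < x \<Longrightarrow> P y) \<Longrightarrow> P x"
  show "P x"
    by (induction x rule: measure_induct_rule[of Rep_idx]) (use step in \<open>simp add: less_idx_def\<close>)
qed
end

lemma ex_bij_idx: "\<exists>e :: 'n::finite idx \<Rightarrow> 'n. bij e"
proof -
  have "CARD('n idx) = CARD('n)"
    using type_definition.card[OF type_definition_idx[where 'n = 'n]] by simp
  then show ?thesis using finite_same_card_bij[of "UNIV :: 'n idx set" "UNIV :: 'n set"] by auto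
qed

lemma det_reindex:
  fixes A :: "real^'n::finite^'n" and e :: "'m::finite \<Rightarrow> 'n"
  assumes e: "bij e"
  shows "det (\<chi> i j. A $ e i $ e j) = det A"
proof -
  have inj: "inj e" and surj: "surj e" using e by (auto simp: bij_def)
  have ei: "e (inv e x) = x" "inv e (e y) = y" for x y
    using surj_f_inv_f[OF surj] inv_f_f[OF inj] by auto
  have sign: "sign (e \<circ> p \<circ> inv e) = sign p" if "p permutes UNIV" for p
  proof -
    have "map_permutation UNIV e p = e \<circ> p \<circ> inv e"
      using surj by (auto simp: map_permutation_def fun_eq_iff restrict_id_def inj inv_into_def)
    then show ?thesis using sign_map_permutation[of e UNIV p] inj that by simp
  qed
  have bijp: "p permutes UNIV \<longleftrightarrow> bij p" for p :: "'b \<Rightarrow> 'b"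
    by (metis bij_imp_permutes permutes_bij UNIV_I)
  have bie: "bij (inv e)" using e by (rule bij_imp_bij_inv)
  show ?thesis unfolding det_def
  proof (rule sum.reindex_bij_witness[of _ "\<lambda>p. inv e \<circ> p \<circ> e" "\<lambda>p. e \<circ> p \<circ> inv e"])
    fix p :: "'m \<Rightarrow> 'm" assume p: "p \<in> {p. p permutes UNIV}"
    show "inv e \<circ> (e \<circ> p \<circ> inv e) \<circ> e = p" by (simp add: fun_eq_iff ei)
    show "e \<circ> p \<circ> inv e \<in> {p. p permutes UNIV}" using p e bie by (auto simp: bijp intro!: bij_comp)
    have "(\<Prod>i\<in>UNIV. A $ i $ (e \<circ> p \<circ> inv e) i) = (\<Prod>i\<in>UNIV. A $ e i $ (e \<circ> p \<circ> inv e) (e i))"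
      using prod.reindex_bij_betw[OF e, of "\<lambda>i. A $ i $ (e \<circ> p \<circ> inv e) i"] by simp
    then show "of_int (sign (e \<circ> p \<circ> inv e)) * (\<Prod>i\<in>UNIV. A $ i $ (e \<circ> p \<circ> inv e) i) =
       of_int (sign p) * (\<Prod>i\<in>UNIV. (\<chi> i j. A $ e i $ e j) $ i $ p i)"
      using sign p by (simp add: ei)
  next
    fix p :: "'n \<Rightarrow> 'n" assume p: "p \<in> {p. p permutes UNIV}"
    show "e \<circ> (inv e \<circ> p \<circ> e) \<circ> inv e = p" by (simp add: fun_eq_iff ei)
    show "inv e \<circ> p \<circ> e \<in> {p. p permutes UNIV}" using p e bie by (auto simp: bijp intro!: bij_comp)
  qed
qed

lemma prod_Basis_cart:
  fixes f :: "real^'n::finite \<Rightarrow> real"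
  shows "(\<Prod>b\<in>Basis. f b) = (\<Prod>i\<in>UNIV. f (axis i 1))"
proof -
  have B: "(Basis :: (real^'n) set) = range (\<lambda>i::'n. axis i (1::real))" by (auto simp: Basis_vec_def)
  have "inj (\<lambda>i::'n. axis i (1::real))" by (auto simp: inj_def axis_eq_axis)
  then show ?thesis unfolding B by (subst prod.reindex) (simp_all add: o_def)
qed

lemma lborel_reindex:
  fixes e :: "'a::finite \<Rightarrow> 'b::finite"
  assumes e: "bij e"
  shows "distr lborel borel (\<lambda>x::real^'b. \<chi> i. x $ e i) = (lborel :: (real^'a) measure)"
proof (rule lborel_eqI[symmetric])
  have meas: "(\<lambda>x::real^'b. \<chi> i. x $ e i) \<in> borel_measurable borel"
    by (intro borel_measurable_continuous_onI continuous_intros)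
  fix l u :: "real^'a" assume lu: "\<And>b. b \<in> Basis \<Longrightarrow> l \<bullet> b \<le> u \<bullet> b"
  have le: "l $ i \<le> u $ i" for i using lu[of "axis i 1"] by (simp add: inner_axis)
  define l' u' :: "real^'b" where "l' = (\<chi> k. l $ inv e k)" and "u' = (\<chi> k. u $ inv e k)"
  have ei: "e (inv e x) = x" "inv e (e y) = y" for x y
    using e by (auto simp: bij_def surj_f_inv_f inv_f_f)
  have "(\<lambda>x::real^'b. \<chi> i. x $ e i) -` box l u = box l' u'"
    by (auto simp: mem_box_cart l'_def u'_def) (metis ei)+
  then have "emeasure (distr lborel borel (\<lambda>x::real^'b. \<chi> i. x $ e i)) (box l u) = emeasure lborel (box l' u')"
    using meas by (simp add: emeasure_distr)
  also have "\<dots> = ennreal (\<Prod>b\<in>Basis. (u' - l') \<bullet> b)"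
    by (rule emeasure_lborel_box) (use le in \<open>auto simp: Basis_vec_def inner_axis l'_def u'_def\<close>)
  also have "(\<Prod>b\<in>Basis. (u' - l') \<bullet> b) = (\<Prod>k\<in>UNIV. u $ inv e k - l $ inv e k)"
    by (simp add: prod_Basis_cart inner_axis u'_def l'_def)
  also have "\<dots> = (\<Prod>i\<in>UNIV. u $ i - l $ i)"
    using prod.reindex_bij_betw[OF bij_imp_bij_inv[OF e], of "\<lambda>i. u $ i - l $ i"] .
  also have "\<dots> = (\<Prod>b\<in>Basis. (u - l) \<bullet> b)" by (simp add: prod_Basis_cart inner_axis)
  finally show "emeasure (distr lborel borel (\<lambda>x::real^'b. \<chi> i. x $ e i)) (box l u) = ennreal (\<Prod>b\<in>Basis. (u - l) \<bullet> b)" .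
qed simp

text \<open>If the image has infinite measure, the integral is infinite as well: otherwise the Jacobian
  would be integrable, and the image would have finite measure.\<close>
lemma emeasure_differentiable_image_wellorder:
  fixes \<phi> :: "real^'m::{finite,wellorder} \<Rightarrow> real^'m::_"
  assumes S: "S \<in> sets borel" and der: "\<And>x. x \<in> S \<Longrightarrow> (\<phi> has_derivative \<phi>' x) (at x within S)"
    and inj: "inj_on \<phi> S" and im: "\<phi> ` S \<in> sets borel"
    and meas: "(\<lambda>x. \<bar>det (matrix (\<phi>' x))\<bar> * indicator S x) \<in> borel_measurable borel"
  shows "emeasure lborel (\<phi> ` S) = (\<integral>\<^sup>+x. ennreal \<bar>det (matrix (\<phi>' x))\<bar> * indicator S x \<partial>lborel)"
proof -
  let ?d = "\<lambda>x. \<bar>det (matrix (\<phi>' x))\<bar>"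
  have Sl: "S \<in> sets lebesgue" using S by simp
  note iff = has_measure_differentiable_image[OF Sl der inj]
  have em: "emeasure lebesgue (\<phi> ` S) = emeasure lborel (\<phi> ` S)" using im by simp
  have cmul: "ennreal (?d x) * indicator S x = ennreal (?d x * indicator S x)" for x
    by (simp add: indicator_def)
  show ?thesis
  proof (cases "\<phi> ` S \<in> lmeasurable")
    case True
    then have "(?d has_integral measure lebesgue (\<phi> ` S)) S" using iff by blast
    then have "(\<integral>\<^sup>+x. ennreal (?d x) * indicator S x \<partial>lborel) = ennreal (measure lebesgue (\<phi> ` S))"
      by (rule nn_integral_has_integral_lebesgue'[rotated]) simp
    also have "\<dots> = emeasure lebesgue (\<phi> ` S)"
      by (rule emeasure_eq_ennreal_measure[symmetric]) (rule fmeasurableD2[OF True])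
    finally show ?thesis unfolding em ..
  next
    case False
    have inf: "emeasure lborel (\<phi> ` S) = \<infinity>"
    proof (rule ccontr)
      assume "emeasure lborel (\<phi> ` S) \<noteq> \<infinity>"
      then have "emeasure lebesgue (\<phi> ` S) < \<infinity>" unfolding em by (simp add: less_top)
      moreover have "\<phi> ` S \<in> sets lebesgue" using im by simp
      ultimately show False using fmeasurableI False by blast
    qed
    have "(\<integral>\<^sup>+x. ennreal (?d x) * indicator S x \<partial>lborel) = \<infinity>"
    proof (rule ccontr)
      assume "(\<integral>\<^sup>+x. ennreal (?d x) * indicator S x \<partial>lborel) \<noteq> \<infinity>"
      then have "integrable lborel (\<lambda>x. ?d x * indicator S x)"
        using meas by (intro integrableI_nonneg) (auto simp: cmul less_top)
      from has_integral_integral_lborel[OF this]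
      have "((\<lambda>x. ?d x * indicator S x) has_integral (LBINT x. ?d x * indicator S x)) UNIV" .
      moreover have "(\<lambda>x. ?d x * indicator S x) = (\<lambda>x. if x \<in> S then ?d x else 0)"
        by (auto simp: indicator_def)
      ultimately have "(?d has_integral (LBINT x. ?d x * indicator S x)) S"
        by (simp add: has_integral_restrict_UNIV)
      then show False using iff False by blast
    qed
    then show ?thesis using inf by simp
  qed
qed

text \<open>Conjugate \<open>\<phi>\<close> by the relabelling \<open>T\<close> of the coordinates, which
  preserves Lebesgue measure and Jacobian determinants.\<close>
lemma emeasure_differentiable_image:
  fixes \<phi> :: "real^'n::finite \<Rightarrow> real^'n"
  assumes S: "S \<in> sets borel" and der: "\<And>x. x \<in> S \<Longrightarrow> (\<phi> has_derivative \<phi>' x) (at x)"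
    and inj: "inj_on \<phi> S" and im: "\<phi> ` S \<in> sets borel"
    and meas: "(\<lambda>x. \<bar>det (matrix (\<phi>' x))\<bar> * indicator S x) \<in> borel_measurable borel"
  shows "emeasure lborel (\<phi> ` S) = (\<integral>\<^sup>+x. ennreal \<bar>det (matrix (\<phi>' x))\<bar> * indicator S x \<partial>lborel)"
proof -
  obtain e :: "'n idx \<Rightarrow> 'n" where e: "bij e" using ex_bij_idx by blast
  have ei: "e (inv e x) = x" "inv e (e y) = y" for x y
    using e by (auto simp: bij_def surj_f_inv_f inv_f_f)
  define T :: "real^'n \<Rightarrow> real^'n idx" where "T x = (\<chi> i. x $ e i)" for x
  define T' :: "real^'n idx \<Rightarrow> real^'n" where "T' y = (\<chi> k. y $ inv e k)" for y
  have TT: "T (T' y) = y" "T' (T x) = x" for x y by (simp_all add: T_def T'_def vec_eq_iff ei)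
  have lin: "bounded_linear T" "bounded_linear T'"
    by (auto simp: T_def[abs_def] T'_def[abs_def] vec_eq_iff linear_iff intro!: linear_conv_bounded_linear[THEN iffD1])
  have mT': "T' \<in> borel_measurable borel" and mT: "T \<in> borel_measurable borel"
    using lin by (auto intro!: borel_measurable_continuous_onI linear_continuous_on)
  have lb: "distr lborel borel T' = lborel"
    using lborel_reindex[OF bij_imp_bij_inv[OF e]] by (simp add: T'_def[abs_def])
  define \<psi> where "\<psi> = (\<lambda>y. T (\<phi> (T' y)))"
  define \<psi>' where "\<psi>' y = (\<lambda>h. T (\<phi>' (T' y) (T' h)))" for y
  have Tax: "T' (axis j 1) = axis (e j) 1" for j
    by (auto simp: T'_def vec_eq_iff axis_def ei)
  have det: "det (matrix (\<psi>' y)) = det (matrix (\<phi>' (T' y)))" for y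
  proof -
    have "matrix (\<psi>' y) = (\<chi> i j. matrix (\<phi>' (T' y)) $ e i $ e j)"
      by (simp add: matrix_def \<psi>'_def Tax) (simp add: T_def)
    then show ?thesis by (simp add: det_reindex[OF e])
  qed
  have preim: "T' -` B \<in> sets borel" if "B \<in> sets borel" for B
    using measurable_sets[OF mT' that] by simp
  have im\<psi>: "\<psi> ` (T' -` S) = T' -` (\<phi> ` S)"
  proof (intro set_eqI iffI)
    fix y assume "y \<in> T' -` (\<phi> ` S)"
    then obtain x where x: "x \<in> S" "T' y = \<phi> x" by auto
    then have "T (T' y) = T (\<phi> x)" by simp
    then have "y = \<psi> (T x)" by (simp add: \<psi>_def TT)
    then show "y \<in> \<psi> ` (T' -` S)" using x by (auto simp: TT)
  qed (auto simp: \<psi>_def TT)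
  have "emeasure lborel (\<phi> ` S) = emeasure lborel (T' -` (\<phi> ` S))"
    by (subst lb[symmetric], subst emeasure_distr) (use im mT' in auto)
  also have "\<dots> = emeasure lborel (\<psi> ` (T' -` S))" by (simp only: im\<psi>)
  also have "\<dots> = (\<integral>\<^sup>+y. ennreal \<bar>det (matrix (\<psi>' y))\<bar> * indicator (T' -` S) y \<partial>lborel)"
  proof (rule emeasure_differentiable_image_wellorder)
    show "T' -` S \<in> sets borel" by (rule preim[OF S])
    show "inj_on \<psi> (T' -` S)"
    proof (rule inj_onI)
      fix x y assume xy: "x \<in> T' -` S" "y \<in> T' -` S" "\<psi> x = \<psi> y"
      then have "T' (\<psi> x) = T' (\<psi> y)" by simp
      then have "\<phi> (T' x) = \<phi> (T' y)" by (simp only: \<psi>_def TT)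
      then have "T' x = T' y" using inj xy(1,2) by (auto dest: inj_onD)
      then have "T (T' x) = T (T' y)" by simp
      then show "x = y" by (simp only: TT)
    qed
    show "\<psi> ` (T' -` S) \<in> sets borel" unfolding im\<psi> by (rule preim[OF im])
    fix y assume "y \<in> T' -` S"
    then have d: "(\<phi> has_derivative \<phi>' (T' y)) (at (T' y))" using der by simp
    have lT: "(T' has_derivative T') (at y)" "(T has_derivative T) (at (\<phi> (T' y)))"
      using lin by (auto intro: bounded_linear_imp_has_derivative)
    have "((\<phi> \<circ> T') has_derivative (\<phi>' (T' y) \<circ> T')) (at y)" by (rule diff_chain_at[OF lT(1) d])
    have "((\<lambda>y. T ((\<phi> \<circ> T') y)) has_derivative (\<lambda>h. T ((\<phi>' (T' y) \<circ> T') h))) (at y)"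
      by (rule bounded_linear.has_derivative[OF lin(1)]) fact
    then show "(\<psi> has_derivative \<psi>' y) (at y within T' -` S)"
      unfolding \<psi>_def \<psi>'_def o_apply by (rule has_derivative_at_withinI)
  next
    have "(\<lambda>x. \<bar>det (matrix (\<psi>' x))\<bar> * indicator (T' -` S) x) =
       (\<lambda>x. \<bar>det (matrix (\<phi>' x))\<bar> * indicator S x) \<circ> T'"
      by (auto simp: det indicator_def)
    also have "\<dots> \<in> borel_measurable borel" by (rule measurable_comp[OF mT' meas])
    finally show "(\<lambda>x. \<bar>det (matrix (\<psi>' x))\<bar> * indicator (T' -` S) x) \<in> borel_measurable borel" .
  qed
  also have "\<dots> = (\<integral>\<^sup>+y. ennreal (\<bar>det (matrix (\<phi>' (T' y)))\<bar> * indicator S (T' y)) \<partial>lborel)"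
    by (intro nn_integral_cong) (simp add: det indicator_def)
  also have "\<dots> = (\<integral>\<^sup>+x. ennreal (\<bar>det (matrix (\<phi>' x))\<bar> * indicator S x) \<partial>lborel)"
  proof -
    have "(\<integral>\<^sup>+x. ennreal (\<bar>det (matrix (\<phi>' x))\<bar> * indicator S x) \<partial>distr lborel borel T')
      = (\<integral>\<^sup>+y. ennreal (\<bar>det (matrix (\<phi>' (T' y)))\<bar> * indicator S (T' y)) \<partial>lborel)"
      by (rule nn_integral_distr) (use mT' measurable_compose[OF meas measurable_ennreal] in simp_all)
    then show ?thesis unfolding lb ..
  qed
  also have "\<dots> = (\<integral>\<^sup>+x. ennreal \<bar>det (matrix (\<phi>' x))\<bar> * indicator S x \<partial>lborel)"
    by (intro nn_integral_cong) (simp add: indicator_def)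
  finally show ?thesis .
qed

text \<open>By the preceding lemma \<open>\<phi>\<close> maps the measure with density \<open>\<bar>det
  \<phi>'\<bar>\<close> on \<open>B\<close> to Lebesgue measure on \<open>\<phi> ` B\<close>.\<close>
lemma nn_integral_change_of_variables:
  fixes \<phi> :: "real^'n::finite \<Rightarrow> real^'n" and f :: "real^'n \<Rightarrow> ennreal"
  assumes B: "B \<in> sets borel" and der: "\<And>x. x \<in> B \<Longrightarrow> (\<phi> has_derivative \<phi>' x) (at x)"
    and inj: "inj_on \<phi> B" and im: "\<phi> ` B \<in> sets borel"
    and meas\<phi>: "(\<lambda>x. if x \<in> B then \<phi> x else 0) \<in> borel_measurable borel"
    and meas: "(\<lambda>x. \<bar>det (matrix (\<phi>' x))\<bar> * indicator B x) \<in> borel_measurable borel"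
    and f: "(\<lambda>y. f y * indicator (\<phi> ` B) y) \<in> borel_measurable borel"
  shows "(\<integral>\<^sup>+y\<in>\<phi> ` B. f y \<partial>lborel) = (\<integral>\<^sup>+x\<in>B. ennreal \<bar>det (matrix (\<phi>' x))\<bar> * f (\<phi> x) \<partial>lborel)"
proof -
  \<comment> \<open>total and measurable; its values outside \<open>B\<close> have weight zero\<close>
  define \<psi> where "\<psi> = (\<lambda>x. if x \<in> B then \<phi> x else 0)"
  have m\<psi>: "\<psi> \<in> borel_measurable borel" unfolding \<psi>_def by (rule meas\<phi>)
  have m\<psi>': "\<psi> \<in> measurable (density lborel h) borel" for h :: "real^'n \<Rightarrow> ennreal"
    by (subst measurable_cong_sets[of _ borel _ borel]) (simp_all only: sets_density sets_lborel m\<psi>)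
  define k where "k x = ennreal (\<bar>det (matrix (\<phi>' x))\<bar> * indicator B x)" for x
  have mk: "k \<in> borel_measurable borel" 
    unfolding k_def[abs_def] by (rule measurable_compose[OF meas measurable_ennreal])
  have eq: "distr (density lborel k) borel \<psi> = density lborel (indicator (\<phi> ` B))"
  proof (rule measure_eqI)
    fix A assume "A \<in> sets (distr (density lborel k) borel \<psi>)"
    then have A: "A \<in> sets borel" by simp
    have pre: "\<psi> -` A \<in> sets borel" using measurable_sets[OF m\<psi> A] by simp
    let ?S = "B \<inter> \<psi> -` A"
    have imS: "\<phi> ` ?S = A \<inter> \<phi> ` B" by (auto simp: \<psi>_def)
    have "emeasure (distr (density lborel k) borel \<psi>) A = emeasure (density lborel k) (\<psi> -` A)"
      by (subst emeasure_distr[OF m\<psi>' A]) simp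
    also have "\<dots> = (\<integral>\<^sup>+x. k x * indicator (\<psi> -` A) x \<partial>lborel)"
      by (rule emeasure_density) (use mk pre in simp_all)
    also have "\<dots> = (\<integral>\<^sup>+x. ennreal \<bar>det (matrix (\<phi>' x))\<bar> * indicator ?S x \<partial>lborel)"
      by (intro nn_integral_cong) (simp add: k_def indicator_def)
    also have "\<dots> = emeasure lborel (\<phi> ` ?S)"
    proof (rule emeasure_differentiable_image[symmetric])
      show "?S \<in> sets borel" by (rule sets.Int[OF B pre])
      show "\<phi> ` ?S \<in> sets borel" unfolding imS by (rule sets.Int[OF A im])
      show "inj_on \<phi> ?S" by (rule inj_on_subset[OF inj]) simp
      show "(\<phi> has_derivative \<phi>' x) (at x)" if "x \<in> ?S" for x using der that by simp
      have "(\<lambda>x. \<bar>det (matrix (\<phi>' x))\<bar> * indicator ?S x) = (\<lambda>x. (\<bar>det (matrix (\<phi>' x))\<bar> * indicator B x) * indicator (\<psi> -` A) x)"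
        by (simp only: indicator_inter_arith mult.assoc)
      moreover have "\<dots> \<in> borel_measurable borel"
        by (rule borel_measurable_times[OF meas borel_measurable_indicator[OF pre]])
      ultimately show "(\<lambda>x. \<bar>det (matrix (\<phi>' x))\<bar> * indicator ?S x) \<in> borel_measurable borel"
        by (simp only:)
    qed
    also have "\<dots> = emeasure (density lborel (indicator (\<phi> ` B))) A"
      unfolding imS using A im by (simp add: emeasure_density Int_commute flip: indicator_inter_arith)
    finally show "emeasure (distr (density lborel k) borel \<psi>) A = emeasure (density lborel (indicator (\<phi> ` B))) A" .
  qed simp
  have "(\<integral>\<^sup>+y\<in>\<phi> ` B. f y \<partial>lborel) = (\<integral>\<^sup>+y. (f y * indicator (\<phi> ` B) y) \<partial>density lborel (indicator (\<phi> ` B)))"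
    using f im by (subst nn_integral_density) (auto intro!: nn_integral_cong simp: indicator_def)
  also have "\<dots> = (\<integral>\<^sup>+x. (f (\<psi> x) * indicator (\<phi> ` B) (\<psi> x)) \<partial>density lborel k)"
    unfolding eq[symmetric] using f m\<psi> by (subst nn_integral_distr) auto
  also have "\<dots> = (\<integral>\<^sup>+x. k x * (f (\<psi> x) * indicator (\<phi> ` B) (\<psi> x)) \<partial>lborel)"
    using mk measurable_compose[OF m\<psi> f] by (subst nn_integral_density) auto
  also have "\<dots> = (\<integral>\<^sup>+x\<in>B. ennreal \<bar>det (matrix (\<phi>' x))\<bar> * f (\<phi> x) \<partial>lborel)"
    by (intro nn_integral_cong) (auto simp: k_def \<psi>_def indicator_def)
  finally show ?thesis .
qed

section \<open>Volume in a chart\<close>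

locale closed_manifold =
  fixes X :: "'a topology" and A :: "('a, 'n::finite) chart set" and g :: "('a, 'n) two_tensor"
  assumes manifold: "smooth_manifold X A" and compact: "compact_space X"
    and metric: "riemannian_metric A g"
begin

definition borelX :: "'a set set" where "borelX = sigma_sets (topspace X) {U. openin X U}"

lemma open_Pow: "{U. openin X U} \<subseteq> Pow (topspace X)" using openin_subset by blast

interpretation sigma_algebra "topspace X" borelX
  unfolding borelX_def by (rule sigma_algebra_sigma_sets[OF open_Pow])

lemma open_borelX: "openin X U \<Longrightarrow> U \<in> borelX" unfolding borelX_def by auto

definition chart_image :: "('a, 'n) chart \<Rightarrow> (real^'n) set" where "chart_image c = snd c ` fst c"

lemma chart: "c \<in> A \<Longrightarrow> is_chart X c" using manifold by (simp add: smooth_manifold_def)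

lemma cover: "(\<Union>c\<in>A. fst c) = topspace X" using manifold by (simp add: smooth_manifold_def)

lemma chart_at: "p \<in> topspace X \<Longrightarrow> \<exists>c\<in>A. p \<in> fst c" using cover by blast

context
  fixes c assumes c: "c \<in> A"
begin

lemma dom_open: "openin X (fst c)" and img_open: "open (chart_image c)"
  and homeo: "homeomorphic_map (subtopology X (fst c)) (top_of_set (chart_image c)) (snd c)"
  using chart[OF c] by (auto simp: is_chart_def chart_image_def)

lemma dom_sub: "fst c \<subseteq> topspace X" using dom_open openin_subset by blast

lemma chart_inj: "inj_on (snd c) (fst c)"
  using homeomorphic_imp_injective_map[OF homeo] dom_sub by (simp add: Int_absorb1)

lemma preimage_open: "open W \<Longrightarrow> openin X {p \<in> fst c. snd c p \<in> W}"
proof -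
  assume W: "open W"
  have "continuous_map (subtopology X (fst c)) (top_of_set (chart_image c)) (snd c)"
    using homeo by (rule homeomorphic_imp_continuous_map)
  moreover have "openin (top_of_set (chart_image c)) (chart_image c \<inter> W)" using W by auto
  ultimately have "openin (subtopology X (fst c)) {p \<in> topspace (subtopology X (fst c)). snd c p \<in> chart_image c \<inter> W}"
    by (rule openin_continuous_map_preimage)
  moreover have "{p \<in> topspace (subtopology X (fst c)). snd c p \<in> chart_image c \<inter> W} = {p \<in> fst c. snd c p \<in> W}"
    using dom_sub by (auto simp: chart_image_def)
  ultimately show ?thesis using dom_open openin_trans_full by metis
qed

lemma image_open: "openin X O' \<Longrightarrow> open (snd c ` (fst c \<inter> O'))"
proof -
  assume "openin X O'"
  then have "openin (subtopology X (fst c)) (fst c \<inter> O')" by (rule openin_subtopology_Int2)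
  then have "openin (top_of_set (chart_image c)) (snd c ` (fst c \<inter> O'))"
    using homeomorphic_imp_open_map[OF homeo] by (simp add: open_map_def)
  then show ?thesis using img_open openin_open_trans by blast
qed

lemma image_borelX: "B \<in> borelX \<Longrightarrow> snd c ` (fst c \<inter> B) \<in> sets borel"
proof -
  assume "B \<in> borelX"
  then have "B \<in> sigma_sets (topspace X) {U. openin X U}" by (simp add: borelX_def)
  then show ?thesis
  proof induction
    case (Basic a) then show ?case by (intro borel_open image_open) simp
  next
    case (Compl a)
    have "snd c ` (fst c \<inter> (topspace X - a)) = chart_image c - snd c ` (fst c \<inter> a)"
      using chart_inj dom_sub by (auto simp: chart_image_def inj_on_def)
    then show ?case using Compl img_open by auto
  next
    case (Union a)
    have "snd c ` (fst c \<inter> \<Union> (range a)) = (\<Union>i. snd c ` (fst c \<inter> a i))" by auto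
    then show ?case using Union by auto
  qed simp
qed

lemma image_borelX_subset: "B \<in> borelX \<Longrightarrow> B \<subseteq> fst c \<Longrightarrow> snd c ` B \<in> sets borel"
  using image_borelX[of B] by (simp add: Int_absorb1)

lemma local_metric_chart: "local_metric (chart_image c) (g c)"
  using metric c img_open
  by (auto simp: local_metric_def riemannian_metric_def smooth_two_tensor_def chart_image_def)

interpretation local_metric "chart_image c" "g c" by (rule local_metric_chart)

text \<open>\<open>det (B B\<^sup>T) = (det B)\<^sup>2\<close> for a factorization of the inverse matrix.\<close>
lemma det_pos: "x \<in> chart_image c \<Longrightarrow> det (g c x) > 0"
proof -
  assume x: "x \<in> chart_image c"
  obtain B :: "real^'n^'n" where B: "matrix_inv (g c x) = B ** transpose B"
    by (rule posdef_inverse_factor[OF sym[OF x] pos[OF x]])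
  have "det (matrix_inv (g c x)) = (det B)\<^sup>2" by (simp add: B det_mul det_transpose power2_eq_square)
  moreover have "det (g c x) * det (matrix_inv (g c x)) = 1"
    using matrix_inv_right[OF inv[OF x]] by (metis det_mul det_I)
  ultimately show ?thesis by (metis zero_le_power2 zero_less_mult_pos2 less_numeral_extra(1)
      order_less_le mult_zero_right zero_neq_one)
qed

lemma density_continuous: "continuous_on (chart_image c) (\<lambda>x. sqrt (det (g c x)))"
proof -
  have "smooth_on (chart_image c) (\<lambda>x. det (g c x))" by (intro smooth_on_det U smooth_G)
  then show ?thesis by (intro continuous_on_real_sqrt smooth_on_continuous)
qed

lemma density_measurable:
  assumes "B \<in> sets borel" "B \<subseteq> chart_image c"
  shows "(\<lambda>x. ennreal (sqrt (det (g c x))) * indicator B x) \<in> borel_measurable borel"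
proof -
  have "continuous_on B (\<lambda>x. sqrt (det (g c x)))"
    using density_continuous assms(2) by (rule continuous_on_subset)
  from borel_measurable_continuous_on_indicator[OF assms(1) this]
  have "(\<lambda>x. ennreal (indicator B x *\<^sub>R sqrt (det (g c x)))) \<in> borel_measurable borel"
    by (rule measurable_compose[OF _ measurable_ennreal])
  moreover have "ennreal (indicator B x *\<^sub>R sqrt (det (g c x))) = ennreal (sqrt (det (g c x))) * indicator B x" for x
    by (simp add: indicator_def)
  ultimately show ?thesis by simp
qed

end

definition chart_volume :: "('a, 'n) chart \<Rightarrow> 'a set \<Rightarrow> ennreal" where
  "chart_volume c B = (\<integral>\<^sup>+x\<in>snd c ` B. ennreal (sqrt (det (g c x))) \<partial>lborel)"

definition chart_measure :: "('a, 'n) chart \<Rightarrow> (real^'n) measure" where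
  "chart_measure c = density lborel (\<lambda>x. ennreal (sqrt (det (g c x))) * indicator (chart_image c) x)"

lemma chart_volume_eq_measure: "c \<in> A \<Longrightarrow> B \<in> borelX \<Longrightarrow> B \<subseteq> fst c \<Longrightarrow> chart_volume c B = emeasure (chart_measure c) (snd c ` B)"
proof -
  assume c: "c \<in> A" and B: "B \<in> borelX" "B \<subseteq> fst c"
  have img: "chart_image c \<in> sets borel" using img_open[OF c] by simp
  have sub: "snd c ` B \<subseteq> chart_image c" using B(2) by (auto simp: chart_image_def)
  have "emeasure (chart_measure c) (snd c ` B) = (\<integral>\<^sup>+x. ennreal (sqrt (det (g c x))) * indicator (chart_image c) x * indicator (snd c ` B) x \<partial>lborel)"
    unfolding chart_measure_def
    by (rule emeasure_density) (use density_measurable[OF c img order_refl] image_borelX_subset[OF c B] in simp_all)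
  also have "\<dots> = chart_volume c B" unfolding chart_volume_def
    using sub by (intro nn_integral_cong) (auto simp: indicator_def)
  finally show ?thesis ..
qed

lemma transition_chart: "c \<in> A \<Longrightarrow> p \<in> fst c \<Longrightarrow> transition c d (snd c p) = snd d p"
  by (simp add: transition_def inv_into_f_f[OF chart_inj])

lemma local_metric_subset: "local_metric U G \<Longrightarrow> open V \<Longrightarrow> V \<subseteq> U \<Longrightarrow> local_metric V G"
  unfolding local_metric_def using smooth_on_subset by (metis subsetD)

lemma chart_change_transition:
  assumes c: "c \<in> A" and d: "d \<in> A"
  shows "chart_change (snd c ` (fst c \<inter> fst d)) (snd d ` (fst c \<inter> fst d)) (g c) (g d) (transition c d)"
proof -
  have o1: "open (snd c ` (fst c \<inter> fst d))" by (rule image_open[OF c dom_open[OF d]])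
  have o2: "open (snd d ` (fst c \<inter> fst d))" using image_open[OF d dom_open[OF c]] by (simp add: Int_commute)
  have "local_metric (snd c ` (fst c \<inter> fst d)) (g c)"
    by (rule local_metric_subset[OF local_metric_chart[OF c] o1]) (auto simp: chart_image_def)
  moreover have "local_metric (snd d ` (fst c \<inter> fst d)) (g d)"
    by (rule local_metric_subset[OF local_metric_chart[OF d] o2]) (auto simp: chart_image_def)
  moreover have "chart_change_axioms (snd c ` (fst c \<inter> fst d)) (snd d ` (fst c \<inter> fst d)) (g c) (g d) (transition c d)"
  proof
    show "smooth_on (snd c ` (fst c \<inter> fst d)) (transition c d)"
      using manifold c d by (simp add: smooth_manifold_def)
    fix x assume "x \<in> snd c ` (fst c \<inter> fst d)"
    then obtain p where p: "p \<in> fst c \<inter> fst d" "x = snd c p" by blast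
    then have t: "transition c d x = snd d p" by (simp add: transition_chart[OF c])
    then show "transition c d x \<in> snd d ` (fst c \<inter> fst d)" using p by simp
    show "g c x $ i $ j = (\<Sum>k\<in>UNIV. \<Sum>l\<in>UNIV. pd i (transition c d) x $ k * pd j (transition c d) x $ l *
        g d (transition c d x) $ k $ l)" for i j
      unfolding t unfolding p(2) using metric c d p(1) unfolding riemannian_metric_def smooth_two_tensor_def by blast
  qed
  ultimately show ?thesis by (simp add: chart_change_def)
qed

text \<open>The Jacobian determinant from the change of variables cancels against the one in the
  transformation of \<open>sqrt (det G)\<close>.\<close>
lemma chart_volume_independent:
  assumes c: "c \<in> A" and d: "d \<in> A" and B: "B \<in> borelX" "B \<subseteq> fst c" "B \<subseteq> fst d"
  shows "chart_volume c B = chart_volume d B"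
proof -
  let ?S = "snd c ` (fst c \<inter> fst d)" and ?\<phi> = "transition c d"
  interpret chart_change ?S "snd d ` (fst c \<inter> fst d)" "g c" "g d" ?\<phi>
    by (rule chart_change_transition[OF c d])
  let ?B = "snd c ` B"
  have sub: "?B \<subseteq> ?S" using B by auto
  have tr: "?\<phi> (snd c p) = snd d p" if "p \<in> B" for p using transition_chart[OF c] that B by blast
  have im: "?\<phi> ` ?B = snd d ` B" using tr by (force simp: image_image)
  have Bb: "?B \<in> sets borel" by (rule image_borelX_subset[OF c B(1,2)])
  have Bd: "snd d ` B \<in> sets borel" by (rule image_borelX_subset[OF d B(1,3)])
  have mat: "matrix (frechet_derivative ?\<phi> (at x)) = J x" for x
    by (simp add: matrix_def J_def pd_def)
  have contJ: "continuous_on ?B (\<lambda>x. \<bar>det (J x)\<bar>)"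
  proof -
    have "smooth_on ?S (\<lambda>x. det (J x))"
      by (intro smooth_on_det src.U) (simp add: J_def smooth_pd_\<phi>)
    then show ?thesis using sub by (intro continuous_on_rabs) (meson smooth_on_continuous continuous_on_subset)
  qed
  have "(\<integral>\<^sup>+y\<in>?\<phi> ` ?B. ennreal (sqrt (det (g d y))) \<partial>lborel)
     = (\<integral>\<^sup>+x\<in>?B. ennreal \<bar>det (matrix (frechet_derivative ?\<phi> (at x)))\<bar> * ennreal (sqrt (det (g d (?\<phi> x)))) \<partial>lborel)"
  proof (rule nn_integral_change_of_variables[OF Bb])
    show "(?\<phi> has_derivative frechet_derivative ?\<phi> (at x)) (at x)" if "x \<in> ?B" for x
      using smooth_on_has_derivative[OF smooth_\<phi> src.U] sub that by blast
    show "inj_on ?\<phi> ?B"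
      using tr chart_inj[OF d] B(3) by (auto simp: inj_on_def)
    show "?\<phi> ` ?B \<in> sets borel" unfolding im by (rule Bd)
    have "continuous_on ?B ?\<phi>" using smooth_on_continuous[OF smooth_\<phi>] sub by (rule continuous_on_subset)
    from borel_measurable_continuous_on_indicator[OF Bb this]
    show "(\<lambda>x. if x \<in> ?B then ?\<phi> x else 0) \<in> borel_measurable borel"
      by (rule measurable_cong[THEN iffD1, rotated]) (simp add: indicator_def)
    have eq: "(\<lambda>x. indicator ?B x *\<^sub>R \<bar>det (J x)\<bar>) = (\<lambda>x. \<bar>det (J x)\<bar> * indicator ?B x)"
      by (simp add: mult.commute)
    show "(\<lambda>x. \<bar>det (matrix (frechet_derivative ?\<phi> (at x)))\<bar> * indicator ?B x) \<in> borel_measurable borel"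
      unfolding mat eq[symmetric] by (rule borel_measurable_continuous_on_indicator[OF Bb contJ])
    show "(\<lambda>y. ennreal (sqrt (det (g d y))) * indicator (?\<phi> ` ?B) y) \<in> borel_measurable borel"
      unfolding im by (rule density_measurable[OF d Bd]) (use B in \<open>auto simp: chart_image_def\<close>)
  qed
  also have "\<dots> = (\<integral>\<^sup>+x\<in>?B. ennreal (sqrt (det (g c x))) \<partial>lborel)"
  proof (rule nn_integral_cong)
    fix x
    show "ennreal \<bar>det (matrix (frechet_derivative ?\<phi> (at x)))\<bar> * ennreal (sqrt (det (g d (?\<phi> x)))) * indicator ?B x
      = ennreal (sqrt (det (g c x))) * indicator ?B x"
    proof (cases "x \<in> ?B")
      case True
      then have "sqrt (det (g c x)) = \<bar>det (J x)\<bar> * sqrt (det (g d (?\<phi> x)))"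
        using det_G[of x] sub by (auto simp: real_sqrt_mult)
      then show ?thesis by (simp add: mat ennreal_mult')
    qed simp
  qed
  finally show ?thesis unfolding chart_volume_def im ..
qed

end

section \<open>The Riemannian volume measure\<close>

context closed_manifold begin

interpretation sigma_algebra "topspace X" borelX
  unfolding borelX_def by (rule sigma_algebra_sigma_sets[OF open_Pow])

lemma open_cover_finite:
  assumes "\<And>U. U \<in> \<U> \<Longrightarrow> openin X U" "topspace X \<subseteq> \<Union>\<U>"
  obtains \<F> where "finite \<F>" "\<F> \<subseteq> \<U>" "topspace X \<subseteq> \<Union>\<F>"
  using compact assms unfolding compact_space_def compactin_def by metis

lemma ex_finite_atlas: "\<exists>cs. set cs \<subseteq> A \<and> topspace X = (\<Union>c\<in>set cs. fst c)"
proof -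
  obtain \<F> where F: "finite \<F>" "\<F> \<subseteq> fst ` A" "topspace X \<subseteq> \<Union>\<F>"
    by (rule open_cover_finite[of "fst ` A"]) (use dom_open cover in auto)
  obtain C where C: "C \<subseteq> A" "finite C" "\<F> = fst ` C" using finite_subset_image[OF F(1,2)] by blast
  obtain cs where "set cs = C" using finite_list[OF C(2)] by blast
  then show ?thesis using C F(3) dom_sub by (intro exI[of _ cs]) blast
qed

definition chart_list :: "('a, 'n) chart list" where
  "chart_list = (SOME cs. set cs \<subseteq> A \<and> topspace X = (\<Union>c\<in>set cs. fst c))"

lemma chart_list: "set chart_list \<subseteq> A" "topspace X = (\<Union>c\<in>set chart_list. fst c)"
  using someI_ex[OF ex_finite_atlas] by (auto simp: chart_list_def)

lemma chart_list_nth: "i < length chart_list \<Longrightarrow> chart_list ! i \<in> A" using chart_list(1) nth_mem by blast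

text \<open>Cutting each chart domain of a finite atlas by the earlier ones leaves disjoint Borel sets,
  each inside a single chart.\<close>
definition piece :: "nat \<Rightarrow> 'a set" where
  "piece i = fst (chart_list ! i) - (\<Union>j<i. fst (chart_list ! j))"

lemma piece_borelX: "i < length chart_list \<Longrightarrow> piece i \<in> borelX"
  unfolding piece_def by (intro Diff finite_UN) (auto intro!: open_borelX dom_open chart_list_nth)

lemma piece_sub: "piece i \<subseteq> fst (chart_list ! i)" by (auto simp: piece_def)

lemma piece_disjoint: "disjoint_family_on piece I"
  unfolding disjoint_family_on_def
proof (intro ballI impI)
  fix m n :: nat assume "m \<noteq> n"
  then have "m < n \<or> n < m" by auto
  then show "piece m \<inter> piece n = {}" by (auto simp: piece_def)
qed

lemma piece_cover: "topspace X = (\<Union>i<length chart_list. piece i)"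
proof
  show "topspace X \<subseteq> (\<Union>i<length chart_list. piece i)"
  proof
    fix p assume "p \<in> topspace X"
    then have ex: "\<exists>i. i < length chart_list \<and> p \<in> fst (chart_list ! i)" using chart_list(2) by (metis UN_E in_set_conv_nth)
    define i where "i = (LEAST i. i < length chart_list \<and> p \<in> fst (chart_list ! i))"
    have i: "i < length chart_list" "p \<in> fst (chart_list ! i)" using LeastI_ex[OF ex] by (auto simp: i_def)
    have "p \<notin> fst (chart_list ! j)" if "j < i" for j
      using not_less_Least[of j "\<lambda>i. i < length chart_list \<and> p \<in> fst (chart_list ! i)"] that i(1) by (auto simp: i_def)
    then have "p \<in> piece i" using i by (auto simp: piece_def)
    then show "p \<in> (\<Union>i<length chart_list. piece i)" using i by blast
  qed
  show "(\<Union>i<length chart_list. piece i) \<subseteq> topspace X"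
    using piece_sub dom_sub chart_list_nth by blast
qed

text \<open>The only possible value of the volume: on each piece it is dictated by the chart.\<close>
definition pieced_volume :: "'a set \<Rightarrow> ennreal" where
  "pieced_volume B = (\<Sum>i<length chart_list. chart_volume (chart_list ! i) (B \<inter> piece i))"

lemma disjoint_pieces: "disjoint_family_on (\<lambda>i. B \<inter> piece i) I"
  using piece_disjoint[of I] by (auto simp: disjoint_family_on_def)

lemma borelX_pieces: "B \<in> borelX \<Longrightarrow> B = (\<Union>i<length chart_list. B \<inter> piece i)"
  using sets_into_space[of B] piece_cover by blast

lemma emeasure_riemannian_volume:
  assumes \<mu>: "is_riemannian_volume X A g \<mu>" and B: "B \<in> borelX"
  shows "emeasure \<mu> B = pieced_volume B"
proof -
  have sets: "sets \<mu> = borelX" using \<mu> by (simp add: is_riemannian_volume_def borelX_def)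
  have "emeasure \<mu> B = emeasure \<mu> (\<Union>i<length chart_list. B \<inter> piece i)" using borelX_pieces[OF B] by simp
  also have "\<dots> = (\<Sum>i<length chart_list. emeasure \<mu> (B \<inter> piece i))"
    by (rule sum_emeasure[symmetric]) (use B piece_borelX sets disjoint_pieces in auto)
  also have "\<dots> = pieced_volume B" unfolding pieced_volume_def
  proof (rule sum.cong[OF refl])
    fix i assume "i \<in> {..<length chart_list}"
    then have i: "i < length chart_list" by simp
    have "B \<inter> piece i \<in> sets \<mu>" using B piece_borelX[OF i] sets by auto
    moreover have "B \<inter> piece i \<subseteq> fst (chart_list ! i)" using piece_sub by blast
    ultimately show "emeasure \<mu> (B \<inter> piece i) = chart_volume (chart_list ! i) (B \<inter> piece i)"
      using \<mu> chart_list_nth[OF i] by (simp add: is_riemannian_volume_def chart_volume_def)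
  qed
  finally show ?thesis .
qed

definition vol_measure :: "'a measure" where "vol_measure = measure_of (topspace X) borelX pieced_volume"

lemma sets_vol_measure: "sets vol_measure = borelX" and space_vol_measure: "space vol_measure = topspace X"
  unfolding vol_measure_def using space_closed by (simp_all add: sigma_sets_eq)

lemma suminf_chart_volume:
  assumes c: "c \<in> A" and F: "range F \<subseteq> borelX" "disjoint_family F" "\<And>k::nat. F k \<subseteq> fst c"
  shows "(\<Sum>k. chart_volume c (F k)) = chart_volume c (\<Union>k. F k)"
proof -
  have "(\<Sum>k. chart_volume c (F k)) = (\<Sum>k. emeasure (chart_measure c) (snd c ` F k))"
    using chart_volume_eq_measure[OF c] F by (intro arg_cong[where f = suminf] ext) blast
  also have "\<dots> = emeasure (chart_measure c) (\<Union>k. snd c ` F k)"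
  proof (rule suminf_emeasure)
    show "range (\<lambda>k. snd c ` F k) \<subseteq> sets (chart_measure c)"
      using image_borelX_subset[OF c] F by (auto simp: chart_measure_def)
    show "disjoint_family (\<lambda>k. snd c ` F k)"
      unfolding disjoint_family_on_def
    proof (intro ballI impI)
      fix k l :: nat assume "k \<noteq> l"
      then have "F k \<inter> F l = {}" using F(2) by (auto simp: disjoint_family_on_def)
      then show "snd c ` F k \<inter> snd c ` F l = {}"
        using inj_on_image_Int[OF chart_inj[OF c] F(3) F(3), of k l] by simp
    qed
  qed
  also have "(\<Union>k. snd c ` F k) = snd c ` (\<Union>k. F k)" by blast
  also have "emeasure (chart_measure c) (snd c ` (\<Union>k. F k)) = chart_volume c (\<Union>k. F k)"
    using F by (intro chart_volume_eq_measure[OF c, symmetric]) auto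
  finally show ?thesis .
qed

lemma chart_volume_empty: "chart_volume c {} = 0" by (simp add: chart_volume_def)

text \<open>Countable additivity holds on each piece, where the volume is the image of a measure on
  Euclidean space.\<close>
lemma emeasure_vol_measure:
  assumes B: "B \<in> borelX"
  shows "emeasure vol_measure B = pieced_volume B"
proof (rule emeasure_measure_of[OF vol_measure_def])
  show "borelX \<subseteq> Pow (topspace X)" by (rule space_closed)
  show "B \<in> sets vol_measure" using B by (simp add: sets_vol_measure)
  show "positive (sets vol_measure) pieced_volume" by (simp add: positive_def pieced_volume_def chart_volume_empty)
  show "countably_additive (sets vol_measure) pieced_volume"
    unfolding countably_additive_def sets_vol_measure
  proof (intro allI impI)
    fix F :: "nat \<Rightarrow> 'a set" assume F: "range F \<subseteq> borelX" "disjoint_family F"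
    have "(\<Sum>k. pieced_volume (F k)) = (\<Sum>i<length chart_list. \<Sum>k. chart_volume (chart_list ! i) (F k \<inter> piece i))"
      unfolding pieced_volume_def by (rule suminf_sum) simp
    also have "\<dots> = (\<Sum>i<length chart_list. chart_volume (chart_list ! i) (\<Union>k. F k \<inter> piece i))"
    proof (rule sum.cong[OF refl])
      fix i assume "i \<in> {..<length chart_list}"
      then have i: "i < length chart_list" by simp
      show "(\<Sum>k. chart_volume (chart_list ! i) (F k \<inter> piece i)) = chart_volume (chart_list ! i) (\<Union>k. F k \<inter> piece i)"
      proof (rule suminf_chart_volume[OF chart_list_nth[OF i]])
        show "range (\<lambda>k. F k \<inter> piece i) \<subseteq> borelX" using F(1) piece_borelX[OF i] by auto
        show "disjoint_family (\<lambda>k. F k \<inter> piece i)" using F(2) by (auto simp: disjoint_family_on_def)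
        show "F k \<inter> piece i \<subseteq> fst (chart_list ! i)" for k using piece_sub by blast
      qed
    qed
    also have "\<dots> = pieced_volume (\<Union>(range F))" unfolding pieced_volume_def Int_commute[of "\<Union> _"] Int_UN_distrib
      by (simp only: Int_commute)
    finally show "(\<Sum>k. pieced_volume (F k)) = pieced_volume (\<Union>(range F))" .
  qed
qed

text \<open>The volumes of the pieces may be computed in the given chart instead of the charts of the
  finite atlas, and there they add up.\<close>
lemma pieced_volume_chart:
  assumes c: "c \<in> A" and B: "B \<in> borelX" "B \<subseteq> fst c"
  shows "pieced_volume B = chart_volume c B"
proof -
  have Bi: "B \<inter> piece i \<in> borelX" if "i < length chart_list" for i using B(1) piece_borelX[OF that] by auto
  have "pieced_volume B = (\<Sum>i<length chart_list. emeasure (chart_measure c) (snd c ` (B \<inter> piece i)))"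
    unfolding pieced_volume_def
  proof (rule sum.cong[OF refl])
    fix i assume "i \<in> {..<length chart_list}"
    then have i: "i < length chart_list" by simp
    have "chart_volume (chart_list ! i) (B \<inter> piece i) = chart_volume c (B \<inter> piece i)"
      using piece_sub[of i] B(2) by (intro chart_volume_independent[OF chart_list_nth[OF i] c Bi[OF i]]) auto
    also have "\<dots> = emeasure (chart_measure c) (snd c ` (B \<inter> piece i))"
      using B(2) by (intro chart_volume_eq_measure[OF c Bi[OF i]]) auto
    finally show "chart_volume (chart_list ! i) (B \<inter> piece i) = emeasure (chart_measure c) (snd c ` (B \<inter> piece i))" .
  qed
  also have "\<dots> = emeasure (chart_measure c) (\<Union>i<length chart_list. snd c ` (B \<inter> piece i))"
  proof (rule sum_emeasure)
    show "(\<lambda>i. snd c ` (B \<inter> piece i)) ` {..<length chart_list} \<subseteq> sets (chart_measure c)"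
      using image_borelX_subset[OF c] Bi B(2) by (auto simp: chart_measure_def)
    show "disjoint_family_on (\<lambda>i. snd c ` (B \<inter> piece i)) {..<length chart_list}"
      unfolding disjoint_family_on_def
    proof (intro ballI impI)
      fix k l :: nat assume kl: "k \<noteq> l"
      have "(B \<inter> piece k) \<inter> (B \<inter> piece l) = {}"
        using disjoint_pieces[of B UNIV] kl unfolding disjoint_family_on_def by blast
      then show "snd c ` (B \<inter> piece k) \<inter> snd c ` (B \<inter> piece l) = {}"
        using inj_on_image_Int[OF chart_inj[OF c], of "B \<inter> piece k" "B \<inter> piece l"] B(2) by auto
    qed
  qed simp
  also have "(\<Union>i<length chart_list. snd c ` (B \<inter> piece i)) = snd c ` (\<Union>i<length chart_list. B \<inter> piece i)" by blast
  also have "\<dots> = snd c ` B" using borelX_pieces[OF B(1)] by simp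
  finally show ?thesis using chart_volume_eq_measure[OF c B] by simp
qed

lemma vol_measure_is_volume: "is_riemannian_volume X A g vol_measure"
  unfolding is_riemannian_volume_def
  using emeasure_vol_measure pieced_volume_chart sets_vol_measure space_vol_measure by (simp add: chart_volume_def borelX_def)

text \<open>Existence and uniqueness make the definite description in \<open>riemannian_volume\<close>
  meaningful.\<close>
lemma riemannian_volume_eq: "riemannian_volume X A g = vol_measure"
  unfolding riemannian_volume_def
proof (rule the_equality)
  show "is_riemannian_volume X A g vol_measure" by (rule vol_measure_is_volume)
  fix \<mu> assume \<mu>: "is_riemannian_volume X A g \<mu>"
  have "sets \<mu> = borelX" using \<mu> by (simp add: is_riemannian_volume_def borelX_def)
  then show "\<mu> = vol_measure"
    by (intro measure_eqI) (simp_all add: sets_vol_measure emeasure_riemannian_volume[OF \<mu>] emeasure_vol_measure)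
qed

lemma emeasure_vol_measure_chart: "c \<in> A \<Longrightarrow> B \<in> borelX \<Longrightarrow> B \<subseteq> fst c \<Longrightarrow> emeasure vol_measure B = chart_volume c B"
  by (simp add: emeasure_vol_measure pieced_volume_chart)

text \<open>Every point has a neighbourhood whose coordinates lie in a closed ball, where the density is
  bounded; finitely many of these neighbourhoods cover the compact manifold.\<close>
lemma finite_vol_measure: "emeasure vol_measure (topspace X) < \<infinity>"
proof -
  let ?\<U> = "{U. openin X U \<and> emeasure vol_measure U < \<infinity>}"
  have "topspace X \<subseteq> \<Union>?\<U>"
  proof
    fix p assume "p \<in> topspace X"
    then obtain c where c: "c \<in> A" "p \<in> fst c" using chart_at by blast
    obtain e where e: "e > 0" "cball (snd c p) e \<subseteq> chart_image c"
      using img_open[OF c(1)] c(2) open_contains_cball by (metis chart_image_def imageI)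
    let ?O = "{q \<in> fst c. snd c q \<in> ball (snd c p) e}"
    have O: "openin X ?O" by (rule preimage_open[OF c(1)]) simp
    have "continuous_on (cball (snd c p) e) (\<lambda>x. sqrt (det (g c x)))"
      using density_continuous[OF c(1)] e(2) by (rule continuous_on_subset)
    then have "bounded ((\<lambda>x. sqrt (det (g c x))) ` cball (snd c p) e)"
      by (intro compact_imp_bounded compact_continuous_image) auto
    then obtain K where "\<forall>y\<in>(\<lambda>x. sqrt (det (g c x))) ` cball (snd c p) e. norm y \<le> K"
      unfolding bounded_iff by blast
    then have K: "\<bar>sqrt (det (g c x))\<bar> \<le> K" if "x \<in> cball (snd c p) e" for x using that by auto
    have "emeasure vol_measure ?O = chart_volume c ?O" using O by (intro emeasure_vol_measure_chart[OF c(1) open_borelX]) auto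
    also have "\<dots> \<le> (\<integral>\<^sup>+x\<in>ball (snd c p) e. ennreal K \<partial>lborel)"
      unfolding chart_volume_def
    proof (rule nn_integral_mono)
      fix x
      show "ennreal (sqrt (det (g c x))) * indicator (snd c ` ?O) x \<le> ennreal K * indicator (ball (snd c p) e) x"
      proof (cases "x \<in> snd c ` ?O")
        case True
        then have "x \<in> ball (snd c p) e" by auto
        then show ?thesis using K[of x] by (auto intro!: ennreal_leI simp: indicator_def)
      qed simp
    qed
    also have "\<dots> = ennreal K * emeasure lborel (ball (snd c p) e)"
      by (rule nn_integral_cmult_indicator) simp
    also have "\<dots> < \<infinity>"
      using emeasure_bounded_finite[OF bounded_ball, of "snd c p" e] by (simp add: ennreal_mult_less_top)
    finally have "emeasure vol_measure ?O < \<infinity>" .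
    moreover have "p \<in> ?O" using c(2) e(1) by simp
    ultimately show "p \<in> \<Union>?\<U>" using O by blast
  qed
  then obtain \<F> where F: "finite \<F>" "\<F> \<subseteq> ?\<U>" "topspace X \<subseteq> \<Union>\<F>"
    by (rule open_cover_finite[rotated]) auto
  have FB: "\<F> \<subseteq> sets vol_measure" using F(2) open_borelX sets_vol_measure by auto
  have "emeasure vol_measure (topspace X) \<le> emeasure vol_measure (\<Union>U\<in>\<F>. U)"
    using F FB by (intro emeasure_mono) (auto intro!: sets.finite_UN)
  also have "\<dots> \<le> (\<Sum>U\<in>\<F>. emeasure vol_measure U)"
    using F FB by (intro emeasure_subadditive_finite) auto
  also have "\<dots> < \<infinity>" using F(1,2) by (simp add: subset_eq)
  finally show ?thesis .
qed

text \<open>In a chart an open set of volume zero would be a null set for Lebesgue measure, as the density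
  is positive.\<close>
lemma vol_measure_open_pos:
  assumes O: "openin X O'" "O' \<noteq> {}"
  shows "emeasure vol_measure O' \<noteq> 0"
proof
  assume z: "emeasure vol_measure O' = 0"
  obtain p where p: "p \<in> O'" using O(2) by blast
  then obtain c where c: "c \<in> A" "p \<in> fst c" using chart_at openin_subset[OF O(1)] by blast
  let ?W = "snd c ` (fst c \<inter> O')"
  have W: "open ?W" by (rule image_open[OF c(1) O(1)])
  have sub: "?W \<subseteq> chart_image c" by (auto simp: chart_image_def)
  have B: "fst c \<inter> O' \<in> borelX" using dom_open[OF c(1)] O(1) by (intro open_borelX openin_Int)
  have "emeasure vol_measure (fst c \<inter> O') \<le> emeasure vol_measure O'"
    using O(1) by (intro emeasure_mono) (auto simp: sets_vol_measure intro: open_borelX)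
  then have "chart_volume c (fst c \<inter> O') = 0"
    using z emeasure_vol_measure_chart[OF c(1) B] by simp
  moreover have m: "(\<lambda>x. ennreal (sqrt (det (g c x))) * indicator ?W x) \<in> borel_measurable borel"
    by (rule density_measurable[OF c(1) _ sub]) (use W in simp)
  ultimately have ae: "AE x in lborel. ennreal (sqrt (det (g c x))) * indicator ?W x = 0"
    unfolding chart_volume_def by (subst (asm) nn_integral_0_iff_AE) auto
  have "AE x in lborel. x \<notin> ?W"
    using ae
  proof (rule AE_mp, intro AE_I2 impI)
    fix x assume eq: "ennreal (sqrt (det (g c x))) * indicator ?W x = 0"
    show "x \<notin> ?W"
    proof
      assume x: "x \<in> ?W"
      then have "det (g c x) > 0" using det_pos[OF c(1)] sub by blast
      then have "ennreal (sqrt (det (g c x))) > 0" by simp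
      then show False using eq x by simp
    qed
  qed
  then have "emeasure lborel ?W = 0" using W by (subst (asm) AE_iff_measurable[of ?W]) auto
  then have "emeasure lebesgue ?W = 0" using W by simp
  then have "negligible ?W" using W negligible_iff_emeasure0[of ?W] by simp
  then have "?W = {}" using W open_not_negligible by blast
  then show False using p c(2) by blast
qed

end

section \<open>Gauge forms of harmonic critical metrics\<close>

context closed_manifold begin

text \<open>A function that is continuous in the coordinates of every chart is continuous, because chart
  domains are open.\<close>
lemma minimum_attained:
  fixes f :: "'a \<Rightarrow> real"
  assumes f: "\<And>c. c \<in> A \<Longrightarrow> continuous_on (chart_image c) (F c)" "\<And>c p. c \<in> A \<Longrightarrow> p \<in> fst c \<Longrightarrow> f p = F c (snd c p)"
  shows "continuous_map X euclideanreal f"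
    "topspace X \<noteq> {} \<Longrightarrow> \<exists>p\<in>topspace X. \<forall>q\<in>topspace X. f p \<le> f q"
proof -
  show cont: "continuous_map X euclideanreal f"
    unfolding continuous_map_def
  proof (intro conjI allI impI)
    fix U :: "real set" assume "openin euclideanreal U"
    then have U: "open U" by simp
    have "openin X {p \<in> fst c. snd c p \<in> F c -` U \<inter> chart_image c}" if c: "c \<in> A" for c
      using f(1)[OF c] U continuous_on_open_vimage[OF img_open[OF c]] by (intro preimage_open[OF c]) blast
    then have "openin X (\<Union>c\<in>A. {p \<in> fst c. snd c p \<in> F c -` U \<inter> chart_image c})" by blast
    also have "(\<Union>c\<in>A. {p \<in> fst c. snd c p \<in> F c -` U \<inter> chart_image c}) = {p \<in> topspace X. f p \<in> U}"
      using f(2) cover by (fastforce simp: chart_image_def)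
    finally show "openin X {p \<in> topspace X. f p \<in> U}" .
  qed auto
  assume ne: "topspace X \<noteq> {}"
  have "compactin euclideanreal (f ` topspace X)"
    using compact cont by (intro image_compactin) (simp_all add: compact_space_def)
  then have "compact (f ` topspace X)" by simp
  from compact_attains_inf[OF this] ne
  show "\<exists>p\<in>topspace X. \<forall>q\<in>topspace X. f p \<le> f q" by auto
qed

end

locale gauged_manifold = closed_manifold X A g
  for X :: "'a topology" and A :: "('a, 'n::finite) chart set" and g :: "('a, 'n) two_tensor" +
  fixes \<theta> :: "('a, 'n) one_form"
  assumes dim: "CARD('n) \<ge> 3" and gauge: "gauge_one_form X A g \<theta>"
begin

definition sbar :: real where "sbar = average_scalar_curvature X A g"
definition lam :: real where "lam = sbar / real CARD('n)"

lemma form: "smooth_one_form A \<theta>" using gauge by (simp add: gauge_one_form_def)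

lemma smooth_theta: "c \<in> A \<Longrightarrow> smooth_on (chart_image c) (\<theta> c)"
  using form by (simp add: smooth_one_form_def chart_image_def)

text \<open>The trace of the gauge equation is \<open>(n - 2) (s + \<delta>\<theta> - s\<^sub>a\<^sub>v) =
  0\<close> up to a constant factor. Eliminating \<open>s\<close> with it, the multiples of
  \<open>g\<close> add up to \<open>lam\<close>.\<close>
lemma gauge_trace:
  assumes c: "c \<in> A" and x: "x \<in> chart_image c"
  shows "scal (g c) x = sbar - codiff (g c) (\<theta> c) x"
    and "ricci (g c) x = sym_deriv (g c) (\<theta> c) x + lam *\<^sub>R g c x"
proof -
  interpret local_metric "chart_image c" "g c" by (rule local_metric_chart[OF c])
  let ?n = "real CARD('n)" and ?H = "matrix_inv (g c x)" and ?s = "scal (g c) x" and ?d = "codiff (g c) (\<theta> c) x"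
  let ?tr = "\<lambda>T :: real^'n^'n. \<Sum>i\<in>UNIV. \<Sum>j\<in>UNIV. ?H $ i $ j * T $ i $ j"
  have n: "?n \<ge> 3" using dim by simp
  have H_sym: "?H $ i $ j = ?H $ j $ i" for i j
  proof -
    have "transpose ?H = ?H"
      using posdef_inverse_factor[OF sym[OF x] pos[OF x]] by (metis matrix_transpose_mul transpose_transpose)
    then show ?thesis by (metis transpose_nth)
  qed
  have eq: "ricci (g c) x - ((1/2) * ?s) *\<^sub>R g c x = sym_deriv (g c) (\<theta> c) x + ((1/2) * ?d) *\<^sub>R g c x
     - ((?n - 2) / (2 * ?n) * sbar) *\<^sub>R g c x"
    using gauge c x
    unfolding gauge_one_form_def einstein_tensor_def bianchi_adjoint_def sbar_def chart_image_def by blast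
  have tr_lin: "?tr (S + T) = ?tr S + ?tr T" "?tr (S - T) = ?tr S - ?tr T" "?tr (k *\<^sub>R T) = k * ?tr T" for S T k
    by (simp_all add: distrib_left right_diff_distrib sum.distrib sum_subtractf sum_distrib_left mult_ac)
  have trG: "?tr (g c x) = ?n"
  proof -
    have "?tr (g c x) = trace (?H ** g c x)"
      using G_nth_sym[OF x] by (simp add: trace_def matrix_mult_nth)
    then show ?thesis by (simp add: matrix_inv_left[OF inv[OF x]] trace_I)
  qed
  have trsym: "?tr (sym_deriv (g c) (\<theta> c) x) = - ?d"
  proof -
    have "(\<Sum>i\<in>UNIV. \<Sum>j\<in>UNIV. ?H $ i $ j * cov_deriv (g c) (\<theta> c) j i x) = - ?d"
      unfolding codiff_def by (subst sum.swap) (simp add: H_sym)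
    then show ?thesis
      by (simp add: sym_deriv_def distrib_left sum.distrib add_divide_distrib flip: sum_divide_distrib)
        (simp add: codiff_def)
  qed
  have trR: "?tr (ricci (g c) x) = ?s" by (simp add: scal_def)
  have "?s - (1/2) * ?s * ?n = - ?d + (1/2) * ?d * ?n - (?n - 2) / (2 * ?n) * sbar * ?n"
    using arg_cong[OF eq, of ?tr] unfolding tr_lin trG trsym trR .
  moreover have "(?n - 2) / (2 * ?n) * sbar * ?n = (1/2) * ((?n - 2) * sbar)" using n by simp
  ultimately have "(?n - 2) * (?s + ?d - sbar) = 0" by (simp add: algebra_simps)
  then show s: "?s = sbar - ?d" using n by simp
  have "ricci (g c) x = sym_deriv (g c) (\<theta> c) x + ((1/2) * ?d) *\<^sub>R g c x
     - ((?n - 2) / (2 * ?n) * sbar) *\<^sub>R g c x + ((1/2) * ?s) *\<^sub>R g c x"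
    using eq by (simp add: algebra_simps)
  also have "\<dots> = sym_deriv (g c) (\<theta> c) x + ((1/2) * ?d - (?n - 2) / (2 * ?n) * sbar + (1/2) * ?s) *\<^sub>R g c x"
    by (simp add: algebra_simps)
  also have "(1/2) * ?d - (?n - 2) / (2 * ?n) * sbar + (1/2) * ?s = lam"
    unfolding s lam_def using n by (simp add: field_simps)
  finally show "ricci (g c) x = sym_deriv (g c) (\<theta> c) x + lam *\<^sub>R g c x" .
qed

lemma theta_transform:
  assumes c: "c \<in> A" and d: "d \<in> A" and p: "p \<in> fst c" "p \<in> fst d"
  shows "codiff (g c) (\<theta> c) (snd c p) = codiff (g d) (\<theta> d) (snd d p)"
    and "sqnorm (g c) (\<theta> c) (snd c p) = sqnorm (g d) (\<theta> d) (snd d p)"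
proof -
  interpret cc: chart_change "snd c ` (fst c \<inter> fst d)" "snd d ` (fst c \<inter> fst d)" "g c" "g d" "transition c d"
    by (rule chart_change_transition[OF c d])
  have x: "snd c p \<in> snd c ` (fst c \<inter> fst d)" using p by blast
  have t: "transition c d (snd c p) = snd d p" by (rule transition_chart[OF c p(1)])
  have s: "smooth_on (snd d ` (fst c \<inter> fst d)) (\<theta> d)"
    by (rule smooth_on_subset[OF img_open[OF d] cc.tgt.U _ smooth_theta[OF d]]) (auto simp: chart_image_def)
  have w: "\<theta> c y $ i = (\<Sum>k\<in>UNIV. pd i (transition c d) y $ k * \<theta> d (transition c d y) $ k)"
    if "y \<in> snd c ` (fst c \<inter> fst d)" for y i
  proof -
    from that obtain q where q: "q \<in> fst c \<inter> fst d" "y = snd c q" by blast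
    have tq: "transition c d y = snd d q" using transition_chart[OF c] q by blast
    show ?thesis unfolding tq unfolding q(2)
      using form c d q(1) unfolding smooth_one_form_def by blast
  qed
  show "codiff (g c) (\<theta> c) (snd c p) = codiff (g d) (\<theta> d) (snd d p)"
    using cc.codiff_transform[OF x s w] unfolding t by blast
  show "sqnorm (g c) (\<theta> c) (snd c p) = sqnorm (g d) (\<theta> d) (snd d p)"
    using cc.sqnorm_transform[OF x s w] unfolding t by blast
qed

definition some_chart :: "'a \<Rightarrow> ('a, 'n) chart" where
  "some_chart p = (SOME c. c \<in> A \<and> p \<in> fst c)"

lemma some_chart: "c \<in> A \<Longrightarrow> p \<in> fst c \<Longrightarrow> some_chart p \<in> A \<and> p \<in> fst (some_chart p)"
  unfolding some_chart_def by (rule someI) auto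

text \<open>Instead of the transformation of the curvature tensor it suffices to use that of the
  divergence, since \<open>s = s\<^sub>a\<^sub>v - \<delta>\<theta>\<close> in every chart.\<close>
lemma scalar_curvature_chart:
  assumes "c \<in> A" "p \<in> fst c"
  shows "scalar_curvature A g p = scal (g c) (snd c p)"
proof -
  let ?d = "some_chart p"
  have d: "?d \<in> A" "p \<in> fst ?d" using some_chart[OF assms] by auto
  have "scal (g ?d) (snd ?d p) = scal (g c) (snd c p)"
    using gauge_trace(1)[OF d(1)] gauge_trace(1)[OF assms(1)] theta_transform(1)[OF d(1) assms(1) d(2) assms(2)]
      assms d by (simp add: chart_image_def)
  then show ?thesis by (simp add: scalar_curvature_def some_chart_def Let_def)
qed

definition theta_sqnorm :: "'a \<Rightarrow> real" where
  "theta_sqnorm p = sqnorm (g (some_chart p)) (\<theta> (some_chart p)) (snd (some_chart p) p)"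

lemma theta_sqnorm_chart: "c \<in> A \<Longrightarrow> p \<in> fst c \<Longrightarrow> theta_sqnorm p = sqnorm (g c) (\<theta> c) (snd c p)"
  unfolding theta_sqnorm_def using theta_transform(2) some_chart by blast

text \<open>\<open>S\<close> is the self-adjoint endomorphism \<open>Ric - \<lambda>\<close>, whose trace
  is \<open>s - s\<^sub>a\<^sub>v\<close>.\<close>
lemma ricci_endomorphism:
  assumes c: "c \<in> A" and x: "x \<in> chart_image c"
  defines "R \<equiv> matrix_inv (g c x) ** ricci (g c) x"
  defines "S \<equiv> R - lam *\<^sub>R mat 1"
  shows "trace (R ** S) = trace (S ** S) + lam * (scal (g c) x - sbar)"
    and "transpose (g c x ** S) = g c x ** S"
    and "S = 0 \<Longrightarrow> ricci (g c) x = lam *\<^sub>R g c x"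
proof -
  interpret local_metric "chart_image c" "g c" by (rule local_metric_chart[OF c])
  have sdt: "transpose (sym_deriv (g c) (\<theta> c) x) = sym_deriv (g c) (\<theta> c) x"
    by (simp add: vec_eq_iff transpose_nth sym_deriv_def add.commute)
  have Rs: "transpose (ricci (g c) x) = ricci (g c) x"
    unfolding gauge_trace(2)[OF c x] by (simp add: transpose_add transpose_scalar sdt sym[OF x])
  have Rs': "ricci (g c) x $ i $ j = ricci (g c) x $ j $ i" for i j using Rs by (metis transpose_nth)
  have GS: "g c x ** S = ricci (g c) x - lam *\<^sub>R g c x"
  proof -
    have "g c x ** (lam *\<^sub>R mat 1) = lam *\<^sub>R g c x"
      by (simp add: vec_eq_iff matrix_mult_nth mat_def if_distrib[of "\<lambda>z. _ * z"] cong: if_cong)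
    then show ?thesis
      by (simp add: S_def R_def matrix_sub_ldistrib matrix_mul_assoc matrix_inv_right[OF inv[OF x]])
  qed
  show "transpose (g c x ** S) = g c x ** S"
    unfolding GS by (simp add: transpose_diff transpose_scalar Rs sym[OF x])
  show "S = 0 \<Longrightarrow> ricci (g c) x = lam *\<^sub>R g c x" using GS by simp
  have "trace R = scal (g c) x"
    by (simp add: R_def trace_def matrix_mult_nth scal_def Rs')
  moreover have "trace (lam *\<^sub>R (mat 1 :: real^'n^'n)) = sbar"
    by (simp add: trace_def mat_def lam_def)
  ultimately have trS: "trace S = scal (g c) x - sbar" by (simp add: S_def trace_sub)
  have "R = S + lam *\<^sub>R mat 1" by (simp add: S_def)
  then have "R ** S = S ** S + (lam *\<^sub>R mat 1) ** S" by (simp add: matrix_add_rdistrib_ring)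
  moreover have "trace ((lam *\<^sub>R mat 1) ** S) = lam * trace S"
    by (simp add: trace_def matrix_mult_nth mat_def sum_distrib_left if_distrib[of "\<lambda>z. lam * z"]
        if_distrib[of "\<lambda>z. z * _"] cong: if_cong)
  ultimately show "trace (R ** S) = trace (S ** S) + lam * (scal (g c) x - sbar)"
    by (simp add: trace_add trS)
qed

text \<open>The maximum principle for the scalar curvature. In the identity of
  \<open>soliton_value\<close> the second derivatives and the trace of \<open>S\<^sup>2\<close>
  are nonnegative, and so \<open>\<lambda> (s - s\<^sub>a\<^sub>v) \<le> 0\<close>; in the case
  of equality \<open>S\<close> vanishes.\<close>
lemma scalar_at_minimum:
  assumes neg: "sbar < 0" and c: "c \<in> A" and x: "x \<in> chart_image c"
    and min: "\<And>y. y \<in> chart_image c \<Longrightarrow> scal (g c) x \<le> scal (g c) y"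
  shows "sbar \<le> scal (g c) x" and "scal (g c) x = sbar \<Longrightarrow> ricci (g c) x = lam *\<^sub>R g c x"
proof -
  interpret local_metric "chart_image c" "g c" by (rule local_metric_chart[OF c])
  define R where "R = matrix_inv (g c x) ** ricci (g c) x"
  define S where "S = R - lam *\<^sub>R mat 1"
  note lm = local_min_derivatives[OF U x smooth_scal min]
  have "0 \<le> (\<Sum>i\<in>UNIV. \<Sum>j\<in>UNIV. matrix_inv (g c x) $ i $ j * pd i (pd j (scal (g c))) x)"
    by (rule trace_inverse_psd_nonneg[OF sym[OF x] pos[OF x] lm(2)])
  moreover have "(\<Sum>i\<in>UNIV. \<Sum>j\<in>UNIV. matrix_inv (g c x) $ i $ j * pd i (pd j (scal (g c))) x)
     + 2 * trace (R ** S) = 0"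
    unfolding R_def S_def
    by (rule soliton_value[OF x smooth_theta[OF c] gauge_trace(2)[OF c] lm(1)])
  ultimately have le: "trace (S ** S) + lam * (scal (g c) x - sbar) \<le> 0"
    using ricci_endomorphism(1)[OF c x] by (simp add: R_def S_def)
  have GS: "transpose (g c x ** S) = g c x ** S"
    unfolding S_def R_def by (rule ricci_endomorphism(2)[OF c x])
  have SS: "trace (S ** S) \<ge> 0" by (rule trace_square_sym(1)[OF sym[OF x] pos[OF x] GS])
  have lam: "lam < 0" using neg dim by (simp add: lam_def divide_neg_pos)
  have "lam * (scal (g c) x - sbar) \<le> 0" using le SS by linarith
  then show "sbar \<le> scal (g c) x" using lam by (simp add: mult_le_0_iff)
  assume "scal (g c) x = sbar"
  then have tr0: "trace (S ** S) = 0" using le SS by simp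
  have "S = 0" by (rule trace_square_sym(2)[OF sym[OF x] pos[OF x] GS]) (simp_all add: tr0)
  then show "ricci (g c) x = lam *\<^sub>R g c x" using ricci_endomorphism(3)[OF c x] by (simp add: R_def S_def)
qed

lemma scalar_lower_bound:
  assumes neg: "sbar < 0" and p: "p \<in> topspace X"
  shows "sbar \<le> scalar_curvature A g p"
proof -
  have "\<exists>q\<in>topspace X. \<forall>r\<in>topspace X. scalar_curvature A g q \<le> scalar_curvature A g r"
  proof (rule minimum_attained(2))
    fix c assume c: "c \<in> A"
    show "continuous_on (chart_image c) (scal (g c))"
      using local_metric.smooth_scal[OF local_metric_chart[OF c]] by (rule smooth_on_continuous)
  qed (use p scalar_curvature_chart in auto)
  then obtain q where q: "q \<in> topspace X" "\<And>r. r \<in> topspace X \<Longrightarrow> scalar_curvature A g q \<le> scalar_curvature A g r"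
    by blast
  obtain c where c: "c \<in> A" "q \<in> fst c" using chart_at q(1) by blast
  have "sbar \<le> scal (g c) (snd c q)"
  proof (rule scalar_at_minimum(1)[OF neg c(1)])
    show "snd c q \<in> chart_image c" using c(2) by (simp add: chart_image_def)
    fix y assume "y \<in> chart_image c"
    then obtain r where r: "r \<in> fst c" "y = snd c r" by (auto simp: chart_image_def)
    then show "scal (g c) (snd c q) \<le> scal (g c) y"
      using q(2)[of r] dom_sub[OF c(1)] scalar_curvature_chart[OF c(1)] c(2) by auto
  qed
  then show ?thesis using q(2)[OF p] scalar_curvature_chart[OF c] by simp
qed

definition total_volume :: real where "total_volume = measure vol_measure (topspace X)"

lemma sbar_eq: "sbar = total_scalar_curvature X A g / total_volume"
  by (simp add: sbar_def average_scalar_curvature_def total_volume_def riemannian_volume_eq)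

lemma total_scalar_eq: "total_scalar_curvature X A g = (\<integral>p. scalar_curvature A g p \<partial>vol_measure)"
  by (simp add: total_scalar_curvature_def riemannian_volume_eq)

lemma finite_measure_vol_measure: "finite_measure vol_measure"
  using finite_vol_measure by (intro finite_measureI) (simp add: space_vol_measure)

text \<open>The volume is finite, and it is nonzero if the total scalar curvature is nonzero; hence the
  average and the total have the same sign.\<close>
lemma average_neg_iff: "sbar < 0 \<longleftrightarrow> total_scalar_curvature X A g < 0"
proof
  have V: "total_volume \<ge> 0" by (simp add: total_volume_def)
  then show "sbar < 0 \<Longrightarrow> total_scalar_curvature X A g < 0"
    unfolding sbar_eq by (metis divide_nonneg_nonneg not_less)
  assume t: "total_scalar_curvature X A g < 0"
  have "total_volume \<noteq> 0"
  proof
    assume "total_volume = 0"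
    then have "emeasure vol_measure (space vol_measure) = 0"
      using finite_measure.emeasure_eq_measure[OF finite_measure_vol_measure] by (simp add: total_volume_def space_vol_measure)
    then have "AE p in vol_measure. scalar_curvature A g p = 0"
      by (intro AE_I[where N = "space vol_measure"]) auto
    then have "(\<integral>p. scalar_curvature A g p \<partial>vol_measure) = 0"
      by (rule integral_eq_zero_AE)
    then show False using t total_scalar_eq by simp
  qed
  then show "sbar < 0" using t V unfolding sbar_eq by (simp add: divide_neg_pos)
qed

text \<open>The function \<open>s - s\<^sub>a\<^sub>v\<close> is nonnegative with integral zero, hence
  zero almost everywhere; the set where it is positive is open and of measure zero, hence empty.\<close>
lemma scalar_constant:
  assumes neg: "sbar < 0" and p: "p \<in> topspace X"
  shows "scalar_curvature A g p = sbar"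
proof (rule ccontr)
  let ?s = "scalar_curvature A g"
  assume "?s p \<noteq> sbar"
  then have gt: "?s p > sbar" using scalar_lower_bound[OF neg p] by simp
  interpret finite_measure vol_measure by (rule finite_measure_vol_measure)
  have tot: "(\<integral>p. ?s p \<partial>vol_measure) = sbar * total_volume" "(\<integral>p. ?s p \<partial>vol_measure) < 0"
    using neg sbar_eq average_neg_iff unfolding total_scalar_eq[symmetric] by auto
  \<comment> \<open>The integral of a function that is not integrable is \<open>0\<close> by convention, but this one is negative.\<close>
  have int: "integrable vol_measure ?s" using tot(2) not_integrable_integral_eq by force
  have "(\<integral>p. (?s p - sbar) \<partial>vol_measure) = 0"
    using int tot(1) by (simp add: total_volume_def space_vol_measure)
  moreover have int': "integrable vol_measure (\<lambda>p. ?s p - sbar)" using int by simp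
  moreover have "AE p in vol_measure. 0 \<le> ?s p - sbar"
    using scalar_lower_bound[OF neg] by (intro AE_I2) (simp add: space_vol_measure)
  ultimately have ae: "AE p in vol_measure. ?s p - sbar = 0"
    using integral_nonneg_eq_0_iff_AE by blast
  have cont: "continuous_map X euclideanreal ?s"
  proof (rule minimum_attained(1))
    fix c assume c: "c \<in> A"
    show "continuous_on (chart_image c) (scal (g c))"
      using local_metric.smooth_scal[OF local_metric_chart[OF c]] by (rule smooth_on_continuous)
  qed (rule scalar_curvature_chart)
  let ?O = "{p \<in> topspace X. ?s p \<in> {sbar<..}}"
  have O: "openin X ?O" by (rule openin_continuous_map_preimage[OF cont]) simp
  have "AE p in vol_measure. p \<notin> ?O" using ae by (rule AE_mp) (auto intro!: AE_I2)
  then have "emeasure vol_measure ?O = 0"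
    using O by (subst (asm) AE_iff_measurable[of ?O]) (auto simp: space_vol_measure sets_vol_measure intro: open_borelX)
  moreover have "emeasure vol_measure ?O \<noteq> 0" using p gt by (intro vol_measure_open_pos[OF O]) auto
  ultimately show False by simp
qed

lemma scal_constant: "sbar < 0 \<Longrightarrow> c \<in> A \<Longrightarrow> x \<in> chart_image c \<Longrightarrow> scal (g c) x = sbar"
  using scalar_constant scalar_curvature_chart dom_sub by (fastforce simp: chart_image_def)

lemma einstein:
  assumes neg: "sbar < 0" and c: "c \<in> A" and x: "x \<in> chart_image c"
  shows "ricci (g c) x = lam *\<^sub>R g c x"
  by (rule scalar_at_minimum(2)[OF neg c x]) (simp_all add: scal_constant[OF neg c] x)

lemma killing:
  assumes "sbar < 0" "c \<in> A" "x \<in> chart_image c"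
  shows "sym_deriv (g c) (\<theta> c) x = 0"
  using einstein[OF assms] gauge_trace(2)[OF assms(2,3)] by simp

text \<open>The maximum principle for \<open>\<bar>\<theta>\<bar>\<^sup>2\<close>: in the identity of
  \<open>killing_value\<close> the second derivatives and the trace of \<open>N\<^sup>2\<close>
  are nonpositive, so \<open>\<lambda> \<bar>\<theta>\<bar>\<^sup>2 \<ge> 0\<close>.\<close>
lemma sqnorm_at_maximum:
  assumes neg: "sbar < 0" and c: "c \<in> A" and x: "x \<in> chart_image c"
    and max: "\<And>y. y \<in> chart_image c \<Longrightarrow> sqnorm (g c) (\<theta> c) y \<le> sqnorm (g c) (\<theta> c) x"
  shows "sqnorm (g c) (\<theta> c) x \<le> 0"
proof -
  interpret local_metric "chart_image c" "g c" by (rule local_metric_chart[OF c])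
  let ?f = "sqnorm (g c) (\<theta> c)" and ?H = "matrix_inv (g c x)"
  have sf: "smooth_on (chart_image c) ?f" by (rule smooth_sqnorm[OF x smooth_theta[OF c]])
  have neg_pd: "pd i (\<lambda>y. - F y) y = - pd i F y" if "smooth_on (chart_image c) F" "y \<in> chart_image c" for i F and y :: "real^'n"
    using pd_linear[OF bounded_linear_minus[OF bounded_linear_ident] smooth_on_differentiable[OF that(1)] U that(2)] .
  have neg_pd2: "pd i (pd j (\<lambda>y. - ?f y)) x = - pd i (pd j ?f) x" for i j
  proof -
    have "pd i (pd j (\<lambda>y. - ?f y)) x = pd i (\<lambda>y. - pd j ?f y) x"
      by (rule pd_cong[OF U x]) (rule neg_pd[OF sf])
    then show ?thesis by (simp add: neg_pd[OF smooth_on_pd[OF sf] x])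
  qed
  note lm = local_min_derivatives[OF U x smooth_on_minus[OF U sf], simplified, OF max]
  have crit: "pd i ?f x = 0" for i using lm(1)[of i] neg_pd[OF sf x, of i] by simp
  have "0 \<le> (\<Sum>i\<in>UNIV. \<Sum>j\<in>UNIV. ?H $ i $ j * pd i (pd j (\<lambda>y. - ?f y)) x)"
    by (rule trace_inverse_psd_nonneg[OF sym[OF x] pos[OF x] lm(2)])
  then have hess: "(\<Sum>i\<in>UNIV. \<Sum>j\<in>UNIV. ?H $ i $ j * pd i (pd j ?f) x) \<le> 0"
    by (simp add: neg_pd2 sum_negf)
  obtain N where N: "transpose (g c x ** N) = - (g c x ** N)"
    "(\<Sum>i\<in>UNIV. \<Sum>j\<in>UNIV. ?H $ i $ j * pd i (pd j ?f) x) + 2 * lam * ?f x + 2 * trace (N ** N) = 0"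
    using killing_value[OF x smooth_theta[OF c] einstein[OF neg c] killing[OF neg c] crit] by blast
  have "trace (N ** N) \<le> 0" by (rule trace_square_antisym[OF sym[OF x] pos[OF x] N(1)])
  then have "lam * ?f x \<ge> 0" using N(2) hess by linarith
  moreover have "lam < 0" using neg dim by (simp add: lam_def divide_neg_pos)
  ultimately show ?thesis by (simp add: zero_le_mult_iff)
qed

lemma theta_zero:
  assumes neg: "sbar < 0" and c: "c \<in> A" and x: "x \<in> chart_image c"
  shows "\<theta> c x = 0"
proof -
  interpret local_metric "chart_image c" "g c" by (rule local_metric_chart[OF c])
  obtain p where p: "p \<in> fst c" "x = snd c p" using x by (auto simp: chart_image_def)
  have pX: "p \<in> topspace X" using p(1) dom_sub[OF c] by blast
  have "\<exists>q\<in>topspace X. \<forall>r\<in>topspace X. - theta_sqnorm q \<le> - theta_sqnorm r"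
  proof (rule minimum_attained(2))
    fix d assume d: "d \<in> A"
    interpret ld: local_metric "chart_image d" "g d" by (rule local_metric_chart[OF d])
    show "continuous_on (chart_image d) (\<lambda>y. - sqnorm (g d) (\<theta> d) y)"
    proof (cases "chart_image d = {}")
      case False
      then obtain y where "y \<in> chart_image d" by blast
      from ld.smooth_sqnorm[OF this smooth_theta[OF d]]
      show ?thesis by (intro continuous_on_minus smooth_on_continuous)
    qed simp
    show "- theta_sqnorm q = - sqnorm (g d) (\<theta> d) (snd d q)" if "q \<in> fst d" for q
      using theta_sqnorm_chart[OF d that] by simp
  qed (use pX in auto)
  then obtain q where q: "q \<in> topspace X" "\<And>r. r \<in> topspace X \<Longrightarrow> theta_sqnorm r \<le> theta_sqnorm q" by auto
  obtain d where d: "d \<in> A" "q \<in> fst d" using chart_at q(1) by blast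
  have "sqnorm (g d) (\<theta> d) (snd d q) \<le> 0"
  proof (rule sqnorm_at_maximum[OF neg d(1)])
    show "snd d q \<in> chart_image d" using d(2) by (simp add: chart_image_def)
    fix y assume "y \<in> chart_image d"
    then obtain r where r: "r \<in> fst d" "y = snd d r" by (auto simp: chart_image_def)
    then show "sqnorm (g d) (\<theta> d) y \<le> sqnorm (g d) (\<theta> d) (snd d q)"
      using q(2)[of r] dom_sub[OF d(1)] theta_sqnorm_chart[OF d(1)] d(2) by auto
  qed
  then have "sqnorm (g c) (\<theta> c) x \<le> 0"
    using q(2)[OF pX] theta_sqnorm_chart[OF c p(1)] theta_sqnorm_chart[OF d] p(2) by simp
  moreover have "sqnorm (g c) (\<theta> c) x = (matrix_inv (g c x) *v \<theta> c x) \<bullet> \<theta> c x"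
    by (simp add: sqnorm_def inner_vec_def matrix_vector_mult_def sum_distrib_left sum_distrib_right mult_ac)
  moreover have Gz: "g c x *v (matrix_inv (g c x) *v \<theta> c x) = \<theta> c x"
    by (simp add: matrix_vector_mul_assoc matrix_inv_right[OF inv[OF x]])
  ultimately have "matrix_inv (g c x) *v \<theta> c x = 0"
    using pos[OF x, of "matrix_inv (g c x) *v \<theta> c x"] by fastforce
  then show ?thesis using Gz by simp
qed

end

theorem corollary4p6:
  fixes X :: "'a topology"
    and A :: "('a, 'n::finite) chart set"
    and g :: "('a, 'n) two_tensor"
    and \<theta> :: "('a, 'n) one_form"
  assumes "CARD('n) \<ge> 3"
    and "smooth_manifold X A"
    and "compact_space X"
    and "riemannian_metric A g"
    and "harmonic_critical X A g"
    and "gauge_one_form X A g \<theta>"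
  shows "(average_scalar_curvature X A g < 0 \<longleftrightarrow> total_scalar_curvature X A g < 0) \<and>
    (average_scalar_curvature X A g < 0 \<or> total_scalar_curvature X A g < 0 \<longrightarrow>
      (\<exists>l<0. einstein_with_constant A g l) \<and>
      (\<forall>c\<in>A. \<forall>x\<in>snd c ` fst c. \<theta> c x = 0) \<and>
      (\<forall>c\<in>A. \<forall>x\<in>snd c ` fst c.
         ricci (g c) x = (average_scalar_curvature X A g / real CARD('n)) *\<^sub>R g c x))"
proof -
  interpret gauged_manifold X A g \<theta>
    using assms by (simp add: gauged_manifold_def gauged_manifold_axioms_def closed_manifold_def)
  have "lam < 0" if "sbar < 0" using that assms(1) by (simp add: lam_def divide_neg_pos)
  moreover have "einstein_with_constant A g lam" if "sbar < 0"
    using einstein[OF that] by (simp add: einstein_with_constant_def chart_image_def)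
  ultimately show ?thesis
    using average_neg_iff einstein theta_zero by (auto simp: sbar_def[symmetric] lam_def chart_image_def)
qed

end
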